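(* (Bounded Separation.) In the v-set interpretation: for every set $y$ and every formula $\phi(x)$ of first-order set theory (possibly with set parameters) all of whose quantifiers are bounded (of the form $\exists u\in v$ or $\forall u\in v$), there is a set whose elements are exactly the elements $x$ of $y$ satisfying $\phi(x)$.
   Context: Work in Heyting arithmetic extended by unary predicates $\mathcal V$ ("v-set"), $\mathcal M$ ("Meaningful condition"), $\mathcal T$ ("True condition"). $\langle\cdot,\cdot\rangle$ is Cantor pairing with projections $(\cdot)_L,(\cdot)_R$; $en$ is Kleene application, $en\!\downarrow$ means it is defined. Write $\mathrm{cd}_x(n)=(xn)_R$, $\mathrm{el}_x(n)=(xn)_L$. $\Xi(f,g)$ is a fixed primitive recursive injective coding of pairs. Axioms: (V1) $\forall x\,[\forall n\,(xn\!\downarrow\wedge\mathcal M(\mathrm{cd}_x(n))\wedge(\mathcal T(\mathrm{cd}_x(n))\to\mathcal V(\mathrm{el}_x(n))))]\to\mathcal V(x)$; (V2) for every formula $\phi$: if the antecedent of (V1) with $\mathcal V$ replaced by $\phi$ implies $\phi(x)$ for all $x$, then $\forall x(\mathcal V(x)\to\phi(x))$; (X1) $\mathcal M(\Xi(f,g))\to(\mathcal T(\Xi(f,g))\leftrightarrow\forall n(fn\!\downarrow\wedge\mathcal T(fn)\to gn\!\downarrow\wedge\mathcal T(gn)))$; (X2) if $\forall n(fn\!\downarrow\to\mathcal M(fn))$ and $\forall n(fn\!\downarrow\wedge gn\!\downarrow\wedge\mathcal T(fn)\to\mathcal M(gn))$ then $\mathcal M(\Xi(f,g))$; ($\mathsf{ECT}_V$)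 $(\forall n(\phi(n)\to\exists m\,\psi(n,m)))\to\exists e\,\forall n(\phi(n)\to en\!\downarrow\wedge\psi(n,en))$ for arbitrary $\psi$ and almost-negative $\phi$ (built from $\Sigma_1$ formulas and atoms $\mathcal V(t),\mathcal M(t),\mathcal T(t)$ by $\wedge,\to,\forall_{\mathbb N}$). Sets are interpreted as v-sets (numbers $x$ with $\mathcal V(x)$); $EL(x)=\{\mathrm{el}_x(n):\mathcal T(\mathrm{cd}_x(n))\}$. Set equality is extensional equality $\simeq$ of v-sets, characterized by $x\simeq y\iff(\forall a\in EL(x)\exists b\in EL(y)\,a\simeq b)\wedge(\forall b\in EL(y)\exists a\in EL(x)\,b\simeq a)$. Unbounded set quantifiers range over v-sets, bounded quantifiers range over $EL(x)$, and $x\in y$ means $\exists y'\in EL(y)\,x\simeq y'$. A set-theoretic statement holds in the v-set interpretation if its interpretation is provable in this system. *)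

theory Defs
  imports Main "HOL-Library.Nat_Bijection"
begin

section \<open>Terms: primitive recursive functions\<close>

text \<open>
  Terms and formulas use de Bruijn indices. \<open>Rec t a b\<close> is the value at \<open>t\<close> of the function \<open>h\<close>
  with \<open>h 0 = a\<close> and \<open>h (k + 1) = b(h k, k)\<close>; in \<open>b\<close>, index 0 is \<open>h k\<close>, index 1 is \<open>k\<close>, and the
  ambient variables start at index 2. So the terms in the variables \<open>x\<^sub>1, \<dots>, x\<^sub>r\<close> are exactly the
  \<open>r\<close>-ary primitive recursive functions.
\<close>

datatype tm = Var nat | Zr | Sc tm | Rec tm tm tm

definition rup :: "(nat \<Rightarrow> nat) \<Rightarrow> nat \<Rightarrow> nat" where
  "rup r = case_nat 0 (\<lambda>k. Suc (r k))"

primrec tren :: "(nat \<Rightarrow> nat) \<Rightarrow> tm \<Rightarrow> tm" where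
  "tren r (Var i) = Var (r i)"
| "tren r Zr = Zr"
| "tren r (Sc t) = Sc (tren r t)"
| "tren r (Rec t a b) = Rec (tren r t) (tren r a) (tren (rup (rup r)) b)"

definition tup :: "(nat \<Rightarrow> tm) \<Rightarrow> nat \<Rightarrow> tm" where
  "tup \<sigma> = case_nat (Var 0) (\<lambda>k. tren Suc (\<sigma> k))"

primrec tsub :: "(nat \<Rightarrow> tm) \<Rightarrow> tm \<Rightarrow> tm" where
  "tsub \<sigma> (Var i) = \<sigma> i"
| "tsub \<sigma> Zr = Zr"
| "tsub \<sigma> (Sc t) = Sc (tsub \<sigma> t)"
| "tsub \<sigma> (Rec t a b) = Rec (tsub \<sigma> t) (tsub \<sigma> a) (tsub (tup (tup \<sigma>)) b)"

abbreviation lift_tm :: "tm \<Rightarrow> tm" where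
  "lift_tm \<equiv> tren Suc"

abbreviation lift2_tm :: "tm \<Rightarrow> tm" where
  "lift2_tm t \<equiv> lift_tm (lift_tm t)"

primrec tval :: "(nat \<Rightarrow> nat) \<Rightarrow> tm \<Rightarrow> nat" where
  "tval \<rho> (Var i) = \<rho> i"
| "tval \<rho> Zr = 0"
| "tval \<rho> (Sc t) = Suc (tval \<rho> t)"
| "tval \<rho> (Rec t a b) =
     rec_nat (tval \<rho> a) (\<lambda>k v. tval (case_nat v (case_nat k \<rho>)) b) (tval \<rho> t)"

definition plus_tm :: "tm \<Rightarrow> tm \<Rightarrow> tm" where
  "plus_tm s t = Rec t s (Sc (Var 0))"

definition times_tm :: "tm \<Rightarrow> tm \<Rightarrow> tm" where
  "times_tm s t = Rec t Zr (plus_tm (Var 0) (lift2_tm s))"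

definition pred_tm :: "tm \<Rightarrow> tm" where
  "pred_tm t = Rec t Zr (Var 1)"

definition minus_tm :: "tm \<Rightarrow> tm \<Rightarrow> tm" where
  "minus_tm s t = Rec t s (pred_tm (Var 0))"

text \<open>\<open>cond_tm c s t\<close> is \<open>s\<close> if \<open>c = 0\<close>, and \<open>t\<close> otherwise.\<close>

definition cond_tm :: "tm \<Rightarrow> tm \<Rightarrow> tm \<Rightarrow> tm" where
  "cond_tm c s t = Rec c s (lift2_tm t)"

text \<open>
  Characteristic terms take the value 0 for truth, so that \<open>plus_tm\<close> is conjunction, \<open>times_tm\<close>
  is disjunction and \<open>dist_tm\<close> is equality.
\<close>

definition dist_tm :: "tm \<Rightarrow> tm \<Rightarrow> tm" where
  "dist_tm s t = plus_tm (minus_tm s t) (minus_tm t s)"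

definition tri_tm :: "tm \<Rightarrow> tm" where
  "tri_tm t = Rec t Zr (plus_tm (Var 0) (Sc (Var 1)))"

text \<open>Cantor pairing \<open>\<langle>x, y\<rangle> = (x + y)(x + y + 1)/2 + x\<close>; \<open>diag_tm z\<close> recovers \<open>x + y\<close> from it.\<close>

definition pair_tm :: "tm \<Rightarrow> tm \<Rightarrow> tm" where
  "pair_tm s t = plus_tm (tri_tm (plus_tm s t)) s"

definition diag_tm :: "tm \<Rightarrow> tm" where
  "diag_tm z = Rec z Zr
     (cond_tm (dist_tm (tri_tm (Sc (Var 0))) (Sc (Var 1))) (Sc (Var 0)) (Var 0))"

definition fst_tm :: "tm \<Rightarrow> tm" where
  "fst_tm z = minus_tm z (tri_tm (diag_tm z))"

definition snd_tm :: "tm \<Rightarrow> tm" where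
  "snd_tm z = minus_tm (diag_tm z) (fst_tm z)"


section \<open>Formulas\<close>

datatype fm =
    Bot
  | Eq tm tm
  | VV tm
  | MM tm
  | TT tm
  | And fm fm
  | Or fm fm
  | Imp fm fm
  | All fm
  | Ex fm

abbreviation Iff :: "fm \<Rightarrow> fm \<Rightarrow> fm" where
  "Iff \<phi> \<psi> \<equiv> And (Imp \<phi> \<psi>) (Imp \<psi> \<phi>)"

primrec fsub :: "(nat \<Rightarrow> tm) \<Rightarrow> fm \<Rightarrow> fm" where
  "fsub \<sigma> Bot = Bot"
| "fsub \<sigma> (Eq s t) = Eq (tsub \<sigma> s) (tsub \<sigma> t)"
| "fsub \<sigma> (VV t) = VV (tsub \<sigma> t)"
| "fsub \<sigma> (MM t) = MM (tsub \<sigma> t)"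
| "fsub \<sigma> (TT t) = TT (tsub \<sigma> t)"
| "fsub \<sigma> (And \<phi> \<psi>) = And (fsub \<sigma> \<phi>) (fsub \<sigma> \<psi>)"
| "fsub \<sigma> (Or \<phi> \<psi>) = Or (fsub \<sigma> \<phi>) (fsub \<sigma> \<psi>)"
| "fsub \<sigma> (Imp \<phi> \<psi>) = Imp (fsub \<sigma> \<phi>) (fsub \<sigma> \<psi>)"
| "fsub \<sigma> (All \<phi>) = All (fsub (tup \<sigma>) \<phi>)"
| "fsub \<sigma> (Ex \<phi>) = Ex (fsub (tup \<sigma>) \<phi>)"

definition fren :: "(nat \<Rightarrow> nat) \<Rightarrow> fm \<Rightarrow> fm" where
  "fren r = fsub (\<lambda>i. Var (r i))"

text \<open>\<open>inst t \<phi>\<close> instantiates the outermost bound variable (index 0) of \<open>\<phi>\<close>, which disappears.\<close>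

definition inst :: "tm \<Rightarrow> fm \<Rightarrow> fm" where
  "inst t = fsub (case_nat t Var)"

text \<open>
  For a term or formula read as a binary function or relation: index 0 is the first argument
  and every other index is the second.
\<close>

definition args2 :: "'a \<Rightarrow> 'a \<Rightarrow> nat \<Rightarrow> 'a" where
  "args2 s t = (\<lambda>i. if i = 0 then s else t)"


section \<open>Kleene application\<close>

text \<open>
  An index is \<open>e = \<langle>tag, \<langle>a, b\<rangle>\<rangle>\<close>. Any other tag than 0 to 7 gives the empty function, and otherwise
  \<^item> 0: \<open>{e}(n) = a\<close>
  \<^item> 1: \<open>{e}(n) = n + 1\<close>
  \<^item> 2: \<open>{e}(n) = (n)\<^sub>L\<close>
  \<^item> 3: \<open>{e}(n) = (n)\<^sub>R\<close>
  \<^item> 4: \<open>{e}(n) = \<langle>{a}(n), {b}(n)\<rangle>\<close>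
  \<^item> 5: \<open>{e}(n) = {a}({b}(n))\<close>
  \<^item> 6: \<open>{e}(\<langle>x, 0\<rangle>) = {a}(x)\<close> and \<open>{e}(\<langle>x, y + 1\<rangle>) = {b}(\<langle>\<langle>x, y\<rangle>, {e}(\<langle>x, y\<rangle>)\<rangle>)\<close>
  \<^item> 7: \<open>{e}(\<langle>x, y\<rangle>)\<close> is the least \<open>k \<ge> y\<close> with \<open>{a}(\<langle>x, k\<rangle>) = 0\<close>, provided that \<open>{a}(\<langle>x, j\<rangle>)\<close> is
    defined for \<open>y \<le> j < k\<close>.

  A computation tree of \<open>{e}(n) = m\<close> with immediate subtrees \<open>w\<^sub>1\<close> and \<open>w\<^sub>2\<close> (dummies where a rule
  has fewer premises) is coded by \<open>\<langle>\<langle>e, \<langle>n, m\<rangle>\<rangle>, \<langle>w\<^sub>1, w\<^sub>2\<rangle>\<rangle> + 1\<close>.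
\<close>

primrec num_tm :: "nat \<Rightarrow> tm" where
  "num_tm 0 = Zr"
| "num_tm (Suc k) = Sc (num_tm k)"

definition ix_tm :: "tm \<Rightarrow> tm" where
  "ix_tm z = fst_tm (fst_tm (pred_tm z))"

definition in_tm :: "tm \<Rightarrow> tm" where
  "in_tm z = fst_tm (snd_tm (fst_tm (pred_tm z)))"

definition out_tm :: "tm \<Rightarrow> tm" where
  "out_tm z = snd_tm (snd_tm (fst_tm (pred_tm z)))"

definition sub1_tm :: "tm \<Rightarrow> tm" where
  "sub1_tm z = fst_tm (snd_tm (pred_tm z))"

definition sub2_tm :: "tm \<Rightarrow> tm" where
  "sub2_tm z = snd_tm (snd_tm (pred_tm z))"

text \<open>
  Validity of trees is defined by course-of-values recursion. In the following, \<open>h\<close> is the history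
  \<open>\<langle>v(z - 1), \<langle>v(z - 2), \<dots>\<langle>v(0), 0\<rangle>\<dots>\<rangle>\<rangle>\<close> of validity values below \<open>z\<close>, and \<open>look_tm h z w\<close> is \<open>v(w)\<close>
  for \<open>w < z\<close>.
\<close>

definition look_tm :: "tm \<Rightarrow> tm \<Rightarrow> tm \<Rightarrow> tm" where
  "look_tm h z w = fst_tm (Rec (minus_tm z (Sc w)) h (snd_tm (Var 0)))"

definition proves_tm :: "tm \<Rightarrow> tm \<Rightarrow> tm \<Rightarrow> tm \<Rightarrow> tm \<Rightarrow> tm \<Rightarrow> tm" where
  "proves_tm h z w e n m =
     plus_tm (look_tm h z w)
       (plus_tm (dist_tm (ix_tm w) e) (plus_tm (dist_tm (in_tm w) n) (dist_tm (out_tm w) m)))"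

definition rule_tm :: "tm \<Rightarrow> tm \<Rightarrow> tm" where
  "rule_tm h z =
    (let e = ix_tm z; n = in_tm z; m = out_tm z;
         w1 = sub1_tm z; w2 = sub2_tm z; k = out_tm w1;
         a = fst_tm (snd_tm e); b = snd_tm (snd_tm e);
         x = fst_tm n; y = snd_tm n; x_pred_y = pair_tm x (pred_tm y);
         tag = (\<lambda>j t. plus_tm (dist_tm (fst_tm e) (num_tm j)) t);
         prem = proves_tm h z
     in times_tm (tag 0 (dist_tm m a))
       (times_tm (tag 1 (dist_tm m (Sc n)))
       (times_tm (tag 2 (dist_tm m x))
       (times_tm (tag 3 (dist_tm m y))
       (times_tm (tag 4 (plus_tm (prem w1 a n (fst_tm m)) (prem w2 b n (snd_tm m))))
       (times_tm (tag 5 (plus_tm (prem w1 b n k) (prem w2 a k m)))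
       (times_tm (tag 6 (cond_tm y
                    (prem w1 a x m)
                    (plus_tm (prem w1 e x_pred_y k) (prem w2 b (pair_tm x_pred_y k) m))))
                 (tag 7 (plus_tm (prem w1 a n k)
                    (cond_tm k
                      (dist_tm m y)
                      (prem w2 e (pair_tm x (Sc y)) m)))))))))))"

definition check_tm :: "tm \<Rightarrow> tm \<Rightarrow> tm" where
  "check_tm h z = cond_tm z (Sc Zr) (rule_tm h z)"

definition hist_tm :: "tm \<Rightarrow> tm" where
  "hist_tm z = Rec z Zr (pair_tm (check_tm (Var 0) (Var 1)) (Var 0))"

text \<open>Kleene's T predicate (0 for truth), result extraction being \<open>out_tm\<close>.\<close>

definition T_tm :: "tm \<Rightarrow> tm \<Rightarrow> tm \<Rightarrow> tm" where
  "T_tm e n z =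
     plus_tm (check_tm (hist_tm z) z) (plus_tm (dist_tm (ix_tm z) e) (dist_tm (in_tm z) n))"

text \<open>0 iff \<open>T(e, n, k)\<close> fails for all \<open>k < z\<close>.\<close>

definition none_below_tm :: "tm \<Rightarrow> tm \<Rightarrow> tm \<Rightarrow> tm" where
  "none_below_tm e n z =
     Rec z Zr (cond_tm (T_tm (lift2_tm e) (lift2_tm n) (Var 1)) (Sc Zr) (Var 0))"

text \<open>\<open>App e n m\<close> says \<open>en \<simeq> m\<close> in Kleene's normal form \<open>en \<simeq> U(\<mu>z. T(e, n, z))\<close>.\<close>

definition App :: "tm \<Rightarrow> tm \<Rightarrow> tm \<Rightarrow> fm" where
  "App e n m =
     Ex (And (Eq (T_tm (lift_tm e) (lift_tm n) (Var 0)) Zr)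
        (And (Eq (none_below_tm (lift_tm e) (lift_tm n) (Var 0)) Zr)
             (Eq (out_tm (Var 0)) (lift_tm m))))"

definition defd :: "tm \<Rightarrow> tm \<Rightarrow> fm" where
  "defd e n = Ex (App (lift_tm e) (lift_tm n) (Var 0))"

text \<open>
  \<open>ap e n \<phi>\<close> says that \<open>en\<close> is defined and satisfies \<open>\<phi>\<close>, index 0 of \<open>\<phi>\<close> standing for \<open>en\<close>. An atom
  with \<open>en\<close> inside, such as \<open>\<T>((en)\<^sub>R)\<close>, is read in this way.
\<close>

definition ap :: "tm \<Rightarrow> tm \<Rightarrow> fm \<Rightarrow> fm" where
  "ap e n \<phi> = Ex (And (App (lift_tm e) (lift_tm n) (Var 0)) \<phi>)"


section \<open>Intuitionistic first-order logic with equality\<close>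

inductive deriv :: "(fm \<Rightarrow> bool) \<Rightarrow> fm set \<Rightarrow> fm \<Rightarrow> bool" for Ax :: "fm \<Rightarrow> bool" where
  AxI: "Ax \<phi> \<Longrightarrow> deriv Ax \<Gamma> \<phi>"
| Hyp: "\<phi> \<in> \<Gamma> \<Longrightarrow> deriv Ax \<Gamma> \<phi>"
| BotE: "deriv Ax \<Gamma> Bot \<Longrightarrow> deriv Ax \<Gamma> \<phi>"
| AndI: "deriv Ax \<Gamma> \<phi> \<Longrightarrow> deriv Ax \<Gamma> \<psi> \<Longrightarrow> deriv Ax \<Gamma> (And \<phi> \<psi>)"
| AndE1: "deriv Ax \<Gamma> (And \<phi> \<psi>) \<Longrightarrow> deriv Ax \<Gamma> \<phi>"
| AndE2: "deriv Ax \<Gamma> (And \<phi> \<psi>) \<Longrightarrow> deriv Ax \<Gamma> \<psi>"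
| OrI1: "deriv Ax \<Gamma> \<phi> \<Longrightarrow> deriv Ax \<Gamma> (Or \<phi> \<psi>)"
| OrI2: "deriv Ax \<Gamma> \<psi> \<Longrightarrow> deriv Ax \<Gamma> (Or \<phi> \<psi>)"
| OrE: "deriv Ax \<Gamma> (Or \<phi> \<psi>) \<Longrightarrow> deriv Ax (insert \<phi> \<Gamma>) \<chi> \<Longrightarrow> deriv Ax (insert \<psi> \<Gamma>) \<chi>
    \<Longrightarrow> deriv Ax \<Gamma> \<chi>"
| ImpI: "deriv Ax (insert \<phi> \<Gamma>) \<psi> \<Longrightarrow> deriv Ax \<Gamma> (Imp \<phi> \<psi>)"
| ImpE: "deriv Ax \<Gamma> (Imp \<phi> \<psi>) \<Longrightarrow> deriv Ax \<Gamma> \<phi> \<Longrightarrow> deriv Ax \<Gamma> \<psi>"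
| AllI: "deriv Ax (fren Suc ` \<Gamma>) \<phi> \<Longrightarrow> deriv Ax \<Gamma> (All \<phi>)"
| AllE: "deriv Ax \<Gamma> (All \<phi>) \<Longrightarrow> deriv Ax \<Gamma> (inst t \<phi>)"
| ExI: "deriv Ax \<Gamma> (inst t \<phi>) \<Longrightarrow> deriv Ax \<Gamma> (Ex \<phi>)"
| ExE: "deriv Ax \<Gamma> (Ex \<phi>) \<Longrightarrow> deriv Ax (insert \<phi> (fren Suc ` \<Gamma>)) (fren Suc \<psi>)
    \<Longrightarrow> deriv Ax \<Gamma> \<psi>"
| EqI: "deriv Ax \<Gamma> (Eq t t)"
| EqE: "deriv Ax \<Gamma> (Eq s t) \<Longrightarrow> deriv Ax \<Gamma> (inst s \<phi>) \<Longrightarrow> deriv Ax \<Gamma> (inst t \<phi>)"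


section \<open>The formal system\<close>

text \<open>
  Since every primitive recursive function is a term, a \<open>\<Sigma>\<^sub>1\<close> formula is an existentially quantified
  quantifier-free formula of arithmetic.
\<close>

inductive qfree :: "fm \<Rightarrow> bool" where
  "qfree Bot"
| "qfree (Eq s t)"
| "qfree \<phi> \<Longrightarrow> qfree \<psi> \<Longrightarrow> qfree (And \<phi> \<psi>)"
| "qfree \<phi> \<Longrightarrow> qfree \<psi> \<Longrightarrow> qfree (Or \<phi> \<psi>)"
| "qfree \<phi> \<Longrightarrow> qfree \<psi> \<Longrightarrow> qfree (Imp \<phi> \<psi>)"

inductive sigma1 :: "fm \<Rightarrow> bool" where
  "qfree \<phi> \<Longrightarrow> sigma1 \<phi>"
| "sigma1 \<phi> \<Longrightarrow> sigma1 (Ex \<phi>)"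

inductive almost_negative :: "fm \<Rightarrow> bool" where
  "sigma1 \<phi> \<Longrightarrow> almost_negative \<phi>"
| "almost_negative (VV t)"
| "almost_negative (MM t)"
| "almost_negative (TT t)"
| "almost_negative \<phi> \<Longrightarrow> almost_negative \<psi> \<Longrightarrow> almost_negative (And \<phi> \<psi>)"
| "almost_negative \<phi> \<Longrightarrow> almost_negative \<psi> \<Longrightarrow> almost_negative (Imp \<phi> \<psi>)"
| "almost_negative \<phi> \<Longrightarrow> almost_negative (All \<phi>)"

text \<open>
  \<open>vstep \<phi>\<close> is \<open>\<forall>n (xn\<down> \<and> \<M>(cd\<^sub>x(n)) \<and> (\<T>(cd\<^sub>x(n)) \<rightarrow> \<phi>(el\<^sub>x(n))))\<close> with \<open>x\<close> at index 0. Both in \<open>\<phi>\<close>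
  (whose argument is index 0) and in \<open>vstep \<phi>\<close>, the parameters of \<open>\<phi>\<close> start at index 1.
\<close>

definition vstep :: "fm \<Rightarrow> fm" where
  "vstep \<phi> =
     All (And (defd (Var 1) (Var 0))
         (And (ap (Var 1) (Var 0) (MM (snd_tm (Var 0))))
              (Imp (ap (Var 1) (Var 0) (TT (snd_tm (Var 0))))
                   (ap (Var 1) (Var 0)
                      (fsub (case_nat (fst_tm (Var 0)) (\<lambda>k. Var (k + 3))) \<phi>)))))"

text \<open>
  The argument \<open>\<xi>\<close> is a term for the coding \<open>\<Xi>\<close>. Axioms with free variables are meant universally
  closed. In \<open>ECT\<close>, \<open>\<phi>\<close> has \<open>n\<close> at index 0, and \<open>\<psi>\<close> has \<open>m\<close> at index 0 and \<open>n\<close> at index 1; the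
  renamings on the right-hand side make room for \<open>e\<close>.
\<close>

abbreviation Xi :: "tm \<Rightarrow> tm \<Rightarrow> tm \<Rightarrow> tm" where
  "Xi \<xi> f g \<equiv> tsub (args2 f g) \<xi>"

inductive sys_axiom :: "tm \<Rightarrow> fm \<Rightarrow> bool" for \<xi> :: tm where
  Succ_inject: "sys_axiom \<xi> (Imp (Eq (Sc s) (Sc t)) (Eq s t))"
| Succ_nonzero: "sys_axiom \<xi> (Imp (Eq (Sc t) Zr) Bot)"
| Rec_Zero: "sys_axiom \<xi> (Eq (Rec Zr a b) a)"
| Rec_Succ: "sys_axiom \<xi>
    (Eq (Rec (Sc t) a b) (tsub (case_nat (Rec t a b) (case_nat t Var)) b))"
| Induction: "sys_axiom \<xi>
    (Imp (inst Zr \<phi>)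
    (Imp (All (Imp \<phi> (fsub (case_nat (Sc (Var 0)) (\<lambda>k. Var (Suc k))) \<phi>)))
         (All \<phi>)))"
| V1: "sys_axiom \<xi> (All (Imp (vstep (VV (Var 0))) (VV (Var 0))))"
| V2: "sys_axiom \<xi> (Imp (All (Imp (vstep \<phi>) \<phi>)) (All (Imp (VV (Var 0)) \<phi>)))"
| X1: "sys_axiom \<xi>
    (All (All (Imp (MM (Xi \<xi> (Var 1) (Var 0)))
      (Iff (TT (Xi \<xi> (Var 1) (Var 0)))
           (All (Imp (ap (Var 2) (Var 0) (TT (Var 0))) (ap (Var 1) (Var 0) (TT (Var 0)))))))))"
| X2: "sys_axiom \<xi>
    (All (All
      (Imp (All (Imp (defd (Var 2) (Var 0)) (ap (Var 2) (Var 0) (MM (Var 0)))))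
      (Imp (All (Imp (And (And (defd (Var 2) (Var 0)) (defd (Var 1) (Var 0)))
                          (ap (Var 2) (Var 0) (TT (Var 0))))
                     (ap (Var 1) (Var 0) (MM (Var 0)))))
           (MM (Xi \<xi> (Var 1) (Var 0)))))))"
| ECT: "almost_negative \<phi> \<Longrightarrow> sys_axiom \<xi>
    (Imp (All (Imp \<phi> (Ex \<psi>)))
         (Ex (All (Imp (fren (case_nat 0 (\<lambda>k. k + 2)) \<phi>)
                       (ap (Var 1) (Var 0)
                          (fren (case_nat 0 (case_nat 1 (\<lambda>k. k + 3))) \<psi>))))))"

definition provable :: "tm \<Rightarrow> fm \<Rightarrow> bool" where
  "provable \<xi> \<phi> \<longleftrightarrow> deriv (sys_axiom \<xi>) {} \<phi>"

definition injective_coding :: "tm \<Rightarrow> bool" where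
  "injective_coding \<xi> \<longleftrightarrow> inj (\<lambda>(f, g). tval (args2 f g) \<xi>)"


section \<open>The v-set interpretation of set theory\<close>

text \<open>\<open>inEL a x\<close> is \<open>a \<in> EL(x)\<close>.\<close>

definition inEL :: "tm \<Rightarrow> tm \<Rightarrow> fm" where
  "inEL a x =
     Ex (ap (lift_tm x) (Var 0) (And (TT (snd_tm (Var 0))) (Eq (lift2_tm a) (fst_tm (Var 0)))))"

text \<open>
  There is no formula \<open>\<simeq>\<close> in the primitive vocabulary. A formula \<open>E\<close> expresses extensional equality if
  it provably has the characteristic property on v-sets; by V2, any two such formulas are provably
  equivalent on v-sets.
\<close>

abbreviation rel_fm :: "fm \<Rightarrow> tm \<Rightarrow> tm \<Rightarrow> fm" where
  "rel_fm E s t \<equiv> fsub (args2 s t) E"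

definition ext_equality :: "tm \<Rightarrow> fm \<Rightarrow> bool" where
  "ext_equality \<xi> E \<longleftrightarrow> provable \<xi>
     (All (All (Imp (And (VV (Var 1)) (VV (Var 0)))
       (Iff (rel_fm E (Var 1) (Var 0))
         (And (All (Imp (inEL (Var 0) (Var 2))
                (Ex (And (inEL (Var 0) (Var 2)) (rel_fm E (Var 1) (Var 0))))))
              (All (Imp (inEL (Var 0) (Var 1))
                (Ex (And (inEL (Var 0) (Var 3)) (rel_fm E (Var 1) (Var 0)))))))))))"

text \<open>
  Formulas of set theory, with de Bruijn indices. The bound \<open>v\<close> in \<open>SBAll v \<phi>\<close> and \<open>SBEx v \<phi>\<close> lies
  outside the scope of the quantifier.
\<close>

datatype sfm =
    SBot
  | SEq nat nat
  | SMem nat nat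
  | SAnd sfm sfm
  | SOr sfm sfm
  | SImp sfm sfm
  | SAll sfm
  | SEx sfm
  | SBAll nat sfm
  | SBEx nat sfm

abbreviation SIff :: "sfm \<Rightarrow> sfm \<Rightarrow> sfm" where
  "SIff \<phi> \<psi> \<equiv> SAnd (SImp \<phi> \<psi>) (SImp \<psi> \<phi>)"

primrec sfv :: "sfm \<Rightarrow> nat set" where
  "sfv SBot = {}"
| "sfv (SEq i j) = {i, j}"
| "sfv (SMem i j) = {i, j}"
| "sfv (SAnd \<phi> \<psi>) = sfv \<phi> \<union> sfv \<psi>"
| "sfv (SOr \<phi> \<psi>) = sfv \<phi> \<union> sfv \<psi>"
| "sfv (SImp \<phi> \<psi>) = sfv \<phi> \<union> sfv \<psi>"
| "sfv (SAll \<phi>) = {k. Suc k \<in> sfv \<phi>}"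
| "sfv (SEx \<phi>) = {k. Suc k \<in> sfv \<phi>}"
| "sfv (SBAll v \<phi>) = insert v {k. Suc k \<in> sfv \<phi>}"
| "sfv (SBEx v \<phi>) = insert v {k. Suc k \<in> sfv \<phi>}"

primrec sren :: "(nat \<Rightarrow> nat) \<Rightarrow> sfm \<Rightarrow> sfm" where
  "sren r SBot = SBot"
| "sren r (SEq i j) = SEq (r i) (r j)"
| "sren r (SMem i j) = SMem (r i) (r j)"
| "sren r (SAnd \<phi> \<psi>) = SAnd (sren r \<phi>) (sren r \<psi>)"
| "sren r (SOr \<phi> \<psi>) = SOr (sren r \<phi>) (sren r \<psi>)"
| "sren r (SImp \<phi> \<psi>) = SImp (sren r \<phi>) (sren r \<psi>)"
| "sren r (SAll \<phi>) = SAll (sren (rup r) \<phi>)"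
| "sren r (SEx \<phi>) = SEx (sren (rup r) \<phi>)"
| "sren r (SBAll v \<phi>) = SBAll (r v) (sren (rup r) \<phi>)"
| "sren r (SBEx v \<phi>) = SBEx (r v) (sren (rup r) \<phi>)"

primrec bounded_sfm :: "sfm \<Rightarrow> bool" where
  "bounded_sfm SBot \<longleftrightarrow> True"
| "bounded_sfm (SEq i j) \<longleftrightarrow> True"
| "bounded_sfm (SMem i j) \<longleftrightarrow> True"
| "bounded_sfm (SAnd \<phi> \<psi>) \<longleftrightarrow> bounded_sfm \<phi> \<and> bounded_sfm \<psi>"
| "bounded_sfm (SOr \<phi> \<psi>) \<longleftrightarrow> bounded_sfm \<phi> \<and> bounded_sfm \<psi>"
| "bounded_sfm (SImp \<phi> \<psi>) \<longleftrightarrow> bounded_sfm \<phi> \<and> bounded_sfm \<psi>"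
| "bounded_sfm (SAll \<phi>) \<longleftrightarrow> False"
| "bounded_sfm (SEx \<phi>) \<longleftrightarrow> False"
| "bounded_sfm (SBAll v \<phi>) \<longleftrightarrow> bounded_sfm \<phi>"
| "bounded_sfm (SBEx v \<phi>) \<longleftrightarrow> bounded_sfm \<phi>"

primrec interp :: "fm \<Rightarrow> sfm \<Rightarrow> fm" where
  "interp E SBot = Bot"
| "interp E (SEq i j) = rel_fm E (Var i) (Var j)"
| "interp E (SMem i j) =
     Ex (And (inEL (Var 0) (Var (Suc j))) (rel_fm E (Var (Suc i)) (Var 0)))"
| "interp E (SAnd \<phi> \<psi>) = And (interp E \<phi>) (interp E \<psi>)"
| "interp E (SOr \<phi> \<psi>) = Or (interp E \<phi>) (interp E \<psi>)"
| "interp E (SImp \<phi> \<psi>) = Imp (interp E \<phi>) (interp E \<psi>)"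
| "interp E (SAll \<phi>) = All (Imp (VV (Var 0)) (interp E \<phi>))"
| "interp E (SEx \<phi>) = Ex (And (VV (Var 0)) (interp E \<phi>))"
| "interp E (SBAll v \<phi>) = All (Imp (inEL (Var 0) (Var (Suc v))) (interp E \<phi>))"
| "interp E (SBEx v \<phi>) = Ex (And (inEL (Var 0) (Var (Suc v))) (interp E \<phi>))"

definition vset_holds :: "tm \<Rightarrow> fm \<Rightarrow> sfm \<Rightarrow> bool" where
  "vset_holds \<xi> E \<phi> \<longleftrightarrow> provable \<xi> (interp E \<phi>)"

text \<open>
  \<open>\<forall>y \<exists>z \<forall>x (x \<in> z \<longleftrightarrow> x \<in> y \<and> \<phi>)\<close>, where \<open>\<phi>\<close> has \<open>x\<close> at index 0, \<open>y\<close> at index 1 and its parameters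
  from index 2 on; the renaming makes room for \<open>z\<close>.
\<close>

definition separation :: "sfm \<Rightarrow> sfm" where
  "separation \<phi> =
     SAll (SEx (SAll
       (SIff (SMem 0 1) (SAnd (SMem 0 2) (sren (case_nat 0 (\<lambda>k. k + 2)) \<phi>)))))"

end

theory Submission
  imports Defs
begin

text \<open>
  Call a statement a condition if some meaningful code is true exactly when it holds. By X1, X2 and
  \<open>ECT\<close>, conditions are closed under \<open>\<and>\<close>, under \<open>\<rightarrow>\<close> and under numerical \<open>\<forall>\<close>, and they contain the
  equations and the statements \<open>en\<down>\<close>. Disjunctions and existential statements are not conditions, but
  they are represented by a family of conditions: \<open>A \<longleftrightarrow> \<exists>r \<T>(hr)\<close>, where \<open>r\<close> is a realizer of \<open>A\<close>.
  Representability is closed under all connectives and under quantifiers over \<open>EL(x)\<close>, because \<open>ECT\<close>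
  turns \<open>\<forall>n (P n \<rightarrow> \<exists>r \<T>(h\<^sub>n r))\<close> into \<open>\<exists>e \<forall>n (P n \<rightarrow> en\<down> \<and> \<T>(h\<^sub>n(en)))\<close>; by V2 the relation \<open>\<simeq>\<close>
  is representable, so every bounded formula is. The separated set is indexed by pairs \<open>\<langle>n, r\<rangle>\<close> with
  element \<open>el\<^sub>y(n)\<close> and condition \<open>\<T>(cd\<^sub>y(n)) \<and> r realizes \<phi>(el\<^sub>y(n))\<close>, and it has the right elements
  because bounded formulas respect \<open>\<simeq>\<close>.

  Derivations are not manipulated directly: \<open>\<Gamma> \<Vdash> A\<close> is treated as a forcing relation over finite
  contexts, in the style of Beth semantics with the terms as constant domain.
\<close>

text \<open>The engine is the dependent clause of X2: \<open>\<Xi>(f,g)\<close> needs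
  \<open>gn\<close> to be meaningful only where \<open>fn\<close> is true. Separation depends on it,
  since \<open>el\<^sub>y(n)\<close> is known to be a v-set only when
  \<open>\<T>(cd\<^sub>y(n))\<close> holds, and only then is \<phi> of it known to be representable.
  Hence the closure lemmas with a guarding condition P assume something about the guarded part only
  under P.

  Being a condition and being representable are formulas (\<open>cond\<close>, \<open>rep\<close>),
  not HOL predicates on formulas: ECT has to choose codes and families uniformly in a number, and V2
  has to be applied to the representability of equality.

  Little is used about the model of computation: application is single-valued, and there are indices
  of constant functions, of the empty function and of a constant function cut down to the domain of
  another. Every other index, the separated set included, is a witness delivered by ECT, so no s-m-n
  or recursion theorem occurs. The long arithmetical part mostly serves these few facts; pairing and
  decidable equality are used again for realizers and for the values of v-sets.\<close>

abbreviation scons :: "tm \<Rightarrow> (nat \<Rightarrow> tm) \<Rightarrow> nat \<Rightarrow> tm"  (infixr "##" 65) where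
  "t ## \<sigma> \<equiv> case_nat t \<sigma>"

text \<open>Environments are nested \<open>case_nat\<close> terms and must be simplified inside their branches.\<close>

declare nat.case_cong_weak [cong del]

section \<open>Substitution calculus for de Bruijn terms and formulas\<close>

lemma scons_eta: "f 0 ## (\<lambda>i. f (Suc i)) = f"
  by (rule ext) (simp split: nat.split)

lemma scons_numeral [simp]: "(case_nat a f) (numeral k) = f (pred_numeral k)"
  by (simp add: numeral_eq_Suc)

lemma scons_plus_numeral [simp]: "(case_nat a f) (i + numeral k) = f (i + pred_numeral k)"
  by (simp add: numeral_eq_Suc)

lemma Var_numeral [simp]: "Var (numeral k) = Var (Suc (pred_numeral k))"
  "Var (i + numeral k) = Var (Suc (i + pred_numeral k))"
  by (simp_all add: numeral_eq_Suc)

lemma Var_scons [simp]: "Var 0 ## (\<lambda>i. Var (Suc i)) = Var"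
  by (rule scons_eta)

lemma rup_Var: "(\<lambda>i. Var (rup r i)) = tup (\<lambda>i. Var (r i))"
  by (rule ext) (simp add: rup_def tup_def split: nat.split)

text \<open>In the form of the simp rule \<open>lift_eq\<close> this eliminates renamings, so that
  any mixture of liftings, instantiations and substitutions is normalised to one substitution with
  an explicit environment.\<close>

lemma tren_eq_tsub: "tren r t = tsub (\<lambda>i. Var (r i)) t"
  by (induction t arbitrary: r) (simp_all add: rup_Var)

lemma tup_Var [simp]: "tup Var = Var"
  by (rule ext) (simp add: tup_def split: nat.split)

lemma tsub_Var [simp]: "tsub Var t = t"
  by (induction t) simp_all

text \<open>The composition laws build on each other: \<open>tren_tsub\<close> needs
  \<open>tren_tren\<close> in its binder case, and \<open>tsub_tsub\<close> needs both mixed laws to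
  commute with \<open>tup\<close>.\<close>

lemma tsub_tren: "tsub \<sigma> (tren r t) = tsub (\<lambda>i. \<sigma> (r i)) t"
proof (induction t arbitrary: \<sigma> r)
  case (Rec t a b)
  have "(\<lambda>i. tup (tup \<sigma>) (rup (rup r) i)) = tup (tup (\<lambda>i. \<sigma> (r i)))"
    by (rule ext) (simp add: rup_def tup_def split: nat.split)
  then show ?case using Rec by simp
qed simp_all

lemma tren_tren: "tren r (tren q t) = tren (\<lambda>i. r (q i)) t"
  by (simp add: tren_eq_tsub[of r] tsub_tren) (simp add: tren_eq_tsub)

lemma tren_tsub: "tren r (tsub \<sigma> t) = tsub (\<lambda>i. tren r (\<sigma> i)) t"
proof (induction t arbitrary: \<sigma> r)
  case (Rec t a b)
  have "(\<lambda>i. tren (rup (rup r)) (tup (tup \<sigma>) i)) = tup (tup (\<lambda>i. tren r (\<sigma> i)))"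
    by (rule ext) (simp add: rup_def tup_def tren_tren split: nat.split)
  then show ?case using Rec by simp
qed simp_all

lemma tsub_tup_tren: "tsub (tup \<sigma>) (tren Suc t) = tren Suc (tsub \<sigma> t)"
  by (simp add: tsub_tren tren_tsub) (simp add: tup_def)

lemma tup_comp: "(\<lambda>i. tsub (tup \<sigma>) (tup \<tau> i)) = tup (\<lambda>i. tsub \<sigma> (\<tau> i))"
  by (rule ext) (simp add: tup_def tsub_tup_tren[unfolded tup_def] split: nat.split)

lemma tsub_tsub [simp]: "tsub \<sigma> (tsub \<tau> t) = tsub (\<lambda>i. tsub \<sigma> (\<tau> i)) t"
  by (induction t arbitrary: \<sigma> \<tau>) (simp_all add: tup_comp)

lemma fsub_fsub [simp]: "fsub \<sigma> (fsub \<tau> \<phi>) = fsub (\<lambda>i. tsub \<sigma> (\<tau> i)) \<phi>"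
  by (induction \<phi> arbitrary: \<sigma> \<tau>) (simp_all add: tup_comp)

lemma fsub_Var [simp]: "fsub Var \<phi> = \<phi>"
  by (induction \<phi>) simp_all

lemma lift_eq [simp]: "tren r t = tsub (\<lambda>i. Var (r i)) t"
  by (rule tren_eq_tsub)

lemma tup_eq [simp]: "tup \<sigma> = Var 0 ## (\<lambda>k. tsub (\<lambda>i. Var (Suc i)) (\<sigma> k))"
  by (simp add: tup_def)

lemma tsub_case_nat [simp]: "tsub \<sigma> (case_nat a f i) = case_nat (tsub \<sigma> a) (\<lambda>k. tsub \<sigma> (f k)) i"
  by (simp split: nat.split)

lemma fren_eq [simp]: "fren r \<phi> = fsub (\<lambda>i. Var (r i)) \<phi>"
  by (simp add: fren_def)

lemma inst_eq [simp]: "inst t \<phi> = fsub (t ## Var) \<phi>"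
  by (simp add: inst_def)

lemma Var_case_nat [simp]: "Var (case_nat b g i) = case_nat (Var b) (\<lambda>k. Var (g k)) i"
  by (simp split: nat.split)

lemma tsub_args2 [simp]: "tsub \<sigma> (args2 s t i) = args2 (tsub \<sigma> s) (tsub \<sigma> t) i"
  by (simp add: args2_def)

subsection \<open>Substitution commutes with the defined terms\<close>

lemma tsub_num [simp]: "tsub \<sigma> (num_tm k) = num_tm k"
  by (induction k) simp_all

lemma tsub_basic [simp]:
  "tsub \<sigma> (plus_tm s t) = plus_tm (tsub \<sigma> s) (tsub \<sigma> t)"
  "tsub \<sigma> (pred_tm s) = pred_tm (tsub \<sigma> s)"
  "tsub \<sigma> (cond_tm c s t) = cond_tm (tsub \<sigma> c) (tsub \<sigma> s) (tsub \<sigma> t)"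
  by (simp_all add: plus_tm_def pred_tm_def cond_tm_def)

lemma tsub_basic2 [simp]:
  "tsub \<sigma> (times_tm s t) = times_tm (tsub \<sigma> s) (tsub \<sigma> t)"
  "tsub \<sigma> (minus_tm s t) = minus_tm (tsub \<sigma> s) (tsub \<sigma> t)"
  "tsub \<sigma> (tri_tm s) = tri_tm (tsub \<sigma> s)"
  by (simp_all add: times_tm_def minus_tm_def tri_tm_def)

lemma tsub_basic3 [simp]:
  "tsub \<sigma> (dist_tm s t) = dist_tm (tsub \<sigma> s) (tsub \<sigma> t)"
  "tsub \<sigma> (pair_tm s t) = pair_tm (tsub \<sigma> s) (tsub \<sigma> t)"
  by (simp_all add: dist_tm_def pair_tm_def)

lemma tsub_diag [simp]: "tsub \<sigma> (diag_tm s) = diag_tm (tsub \<sigma> s)"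
  by (simp add: diag_tm_def)

lemma tsub_fst [simp]: "tsub \<sigma> (fst_tm s) = fst_tm (tsub \<sigma> s)"
  by (simp add: fst_tm_def)

lemma tsub_snd [simp]: "tsub \<sigma> (snd_tm s) = snd_tm (tsub \<sigma> s)"
  by (simp add: snd_tm_def)

lemma tsub_tree [simp]:
  "tsub \<sigma> (ix_tm s) = ix_tm (tsub \<sigma> s)"
  "tsub \<sigma> (in_tm s) = in_tm (tsub \<sigma> s)"
  "tsub \<sigma> (out_tm s) = out_tm (tsub \<sigma> s)"
  "tsub \<sigma> (sub1_tm s) = sub1_tm (tsub \<sigma> s)"
  "tsub \<sigma> (sub2_tm s) = sub2_tm (tsub \<sigma> s)"
  by (simp_all add: ix_tm_def in_tm_def out_tm_def sub1_tm_def sub2_tm_def)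

lemma tsub_look [simp]: "tsub \<sigma> (look_tm h z w) = look_tm (tsub \<sigma> h) (tsub \<sigma> z) (tsub \<sigma> w)"
  by (simp add: look_tm_def)

lemma tsub_proves [simp]: "tsub \<sigma> (proves_tm h z w e n m) =
    proves_tm (tsub \<sigma> h) (tsub \<sigma> z) (tsub \<sigma> w) (tsub \<sigma> e) (tsub \<sigma> n) (tsub \<sigma> m)"
  by (simp add: proves_tm_def)

lemma tsub_rule [simp]: "tsub \<sigma> (rule_tm h z) = rule_tm (tsub \<sigma> h) (tsub \<sigma> z)"
  by (simp add: rule_tm_def Let_def)

lemma tsub_check [simp]: "tsub \<sigma> (check_tm h z) = check_tm (tsub \<sigma> h) (tsub \<sigma> z)"
  by (simp add: check_tm_def)

lemma tsub_hist [simp]: "tsub \<sigma> (hist_tm z) = hist_tm (tsub \<sigma> z)"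
  by (simp add: hist_tm_def)

lemma tsub_T [simp]: "tsub \<sigma> (T_tm e n z) = T_tm (tsub \<sigma> e) (tsub \<sigma> n) (tsub \<sigma> z)"
  by (simp add: T_tm_def)

lemma tsub_none_below [simp]:
  "tsub \<sigma> (none_below_tm e n z) = none_below_tm (tsub \<sigma> e) (tsub \<sigma> n) (tsub \<sigma> z)"
  by (simp add: none_below_tm_def)

lemma fsub_App [simp]: "fsub \<sigma> (App e n m) = App (tsub \<sigma> e) (tsub \<sigma> n) (tsub \<sigma> m)"
  by (simp add: App_def)

lemma fsub_defd [simp]: "fsub \<sigma> (defd e n) = defd (tsub \<sigma> e) (tsub \<sigma> n)"
  by (simp add: defd_def)

lemma fsub_ap [simp]: "fsub \<sigma> (ap e n \<phi>) = ap (tsub \<sigma> e) (tsub \<sigma> n) (fsub (tup \<sigma>) \<phi>)"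
  by (simp add: ap_def)

lemma fsub_inEL [simp]: "fsub \<sigma> (inEL a x) = inEL (tsub \<sigma> a) (tsub \<sigma> x)"
  by (simp add: inEL_def)

lemma fsub_vstep [simp]: "fsub (tup \<sigma>) (vstep \<phi>) = vstep (fsub (tup \<sigma>) \<phi>)"
  by (simp add: vstep_def)

subsection \<open>Closure of derivability under substitution\<close>

lemma qfree_fsub: "qfree \<phi> \<Longrightarrow> qfree (fsub \<sigma> \<phi>)"
  by (induction rule: qfree.induct) (auto intro: qfree.intros)

lemma sigma1_fsub: "sigma1 \<phi> \<Longrightarrow> sigma1 (fsub \<sigma> \<phi>)"
  by (induction arbitrary: \<sigma> rule: sigma1.induct)
    (auto intro: sigma1.intros qfree_fsub simp del: tup_eq)

lemma almost_negative_fsub: "almost_negative \<phi> \<Longrightarrow> almost_negative (fsub \<sigma> \<phi>)"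
  by (induction arbitrary: \<sigma> rule: almost_negative.induct)
    (auto intro: almost_negative.intros sigma1_fsub simp del: tup_eq)

text \<open>The schemes range over all terms and formulas, and V1, X1 and X2 are closed: in
  \<open>Xi\<close>, \<open>args2\<close> leaves \<xi> no variables apart from its two
  arguments.\<close>

lemma sys_axiom_fsub: "sys_axiom \<xi> \<phi> \<Longrightarrow> sys_axiom \<xi> (fsub \<sigma> \<phi>)"
proof (induction rule: sys_axiom.induct)
  case (Rec_Succ t a b)
  have "sys_axiom \<xi> (Eq (Rec (Sc (tsub \<sigma> t)) (tsub \<sigma> a) (tsub (tup (tup \<sigma>)) b))
     (tsub (Rec (tsub \<sigma> t) (tsub \<sigma> a) (tsub (tup (tup \<sigma>)) b) ## tsub \<sigma> t ## Var) (tsub (tup (tup \<sigma>)) b)))"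
    by (rule sys_axiom.Rec_Succ)
  then show ?case by simp
next
  case (Induction \<phi>)
  show ?case using sys_axiom.Induction[of \<xi> "fsub (tup \<sigma>) \<phi>"] by simp
next
  case V1
  show ?case using sys_axiom.V1[of \<xi>] by (simp add: vstep_def)
next
  case (V2 \<phi>)
  show ?case using sys_axiom.V2[of \<xi> "fsub (tup \<sigma>) \<phi>"] fsub_vstep[of \<sigma> \<phi>] by simp
next
  case X1
  show ?case using sys_axiom.X1[of \<xi>] by simp
next
  case X2
  show ?case using sys_axiom.X2[of \<xi>] by simp
next
  case (ECT \<phi> \<psi>)
  show ?case using sys_axiom.ECT[OF almost_negative_fsub[OF ECT, of "tup \<sigma>"], of \<xi> "fsub (tup (tup \<sigma>)) \<psi>"]
    by simp
qed (auto intro: sys_axiom.intros)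

text \<open>Needed to rename eigenvariables: the forcing rules for the quantifiers speak of
  arbitrary terms, the rules of the calculus of index 0 in a shifted context.\<close>

lemma deriv_fsub:
  assumes "deriv Ax \<Gamma> \<phi>" and ax: "\<And>\<sigma> \<phi>. Ax \<phi> \<Longrightarrow> Ax (fsub \<sigma> \<phi>)"
  shows "deriv Ax (fsub \<sigma> ` \<Gamma>) (fsub \<sigma> \<phi>)"
  using assms(1)
proof (induction arbitrary: \<sigma> rule: deriv.induct)
  case (AxI \<phi> \<Gamma>)
  then show ?case by (simp add: ax deriv.AxI)
next
  case (AllI \<Gamma> \<phi>)
  have "fsub (tup \<sigma>) ` fren Suc ` \<Gamma> = fren Suc ` fsub \<sigma> ` \<Gamma>"
    by (simp add: image_image)
  with AllI.IH[of "tup \<sigma>"] show ?case by (auto intro!: deriv.AllI)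
next
  case (AllE \<Gamma> \<phi> t)
  show ?case using deriv.AllE[OF AllE.IH[of \<sigma>, simplified], of "tsub \<sigma> t"] by simp
next
  case (ExI \<Gamma> t \<phi>)
  show ?case using ExI.IH[of \<sigma>] by (auto intro!: deriv.ExI[of _ _ "tsub \<sigma> t"])
next
  case (ExE \<Gamma> \<phi> \<psi>)
  have "fsub (tup \<sigma>) ` fren Suc ` \<Gamma> = fren Suc ` fsub \<sigma> ` \<Gamma>"
    by (simp add: image_image)
  moreover have "fsub (tup \<sigma>) (fren Suc \<psi>) = fren Suc (fsub \<sigma> \<psi>)"
    by simp
  ultimately show ?case
    using deriv.ExE[OF ExE.IH(1)[of \<sigma>, unfolded fsub.simps], of "fsub \<sigma> \<psi>"] ExE.IH(2)[of "tup \<sigma>"]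
    by (simp only: image_insert)
next
  case (EqE \<Gamma> s t \<phi>)
  show ?case using deriv.EqE[OF EqE.IH(1)[of \<sigma>, unfolded fsub.simps], of "fsub (tup \<sigma>) \<phi>"] EqE.IH(2)[of \<sigma>]
    by simp
qed (auto intro: deriv.intros)

lemma deriv_weaken: "deriv Ax \<Gamma> \<phi> \<Longrightarrow> \<Gamma> \<subseteq> \<Delta> \<Longrightarrow> deriv Ax \<Delta> \<phi>"
proof (induction arbitrary: \<Delta> rule: deriv.induct)
  case (OrE \<Gamma> \<phi> \<psi> \<chi>)
  then show ?case by (meson deriv.OrE insert_mono)
next
  case (ImpI \<phi> \<Gamma> \<psi>)
  then show ?case by (meson deriv.ImpI insert_mono)
next
  case (AllI \<Gamma> \<phi>)
  then show ?case by (meson deriv.AllI image_mono)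
next
  case (ExE \<Gamma> \<phi> \<psi>)
  then show ?case by (meson deriv.ExE image_mono insert_mono)
next
  case (EqE \<Gamma> s t \<phi>)
  then show ?case by (meson deriv.EqE)
qed (auto intro: deriv.intros simp del: inst_eq)

text \<open>Finite support without a notion of free variable: all that freshness requires is that
  changing a substitution from some index on has no effect.\<close>

lemma tsub_bounded: "\<exists>N. \<forall>\<sigma> \<tau>. (\<forall>i<N. \<sigma> i = \<tau> i) \<longrightarrow> tsub \<sigma> t = tsub \<tau> t"
proof (induction t)
  case (Var i)
  show ?case by (rule exI[of _ "Suc i"]) simp
next
  case (Rec t a b)
  then obtain N1 N2 N3 where N: "\<forall>\<sigma> \<tau>. (\<forall>i<N1. \<sigma> i = \<tau> i) \<longrightarrow> tsub \<sigma> t = tsub \<tau> t"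
    "\<forall>\<sigma> \<tau>. (\<forall>i<N2. \<sigma> i = \<tau> i) \<longrightarrow> tsub \<sigma> a = tsub \<tau> a"
    "\<forall>\<sigma> \<tau>. (\<forall>i<N3. \<sigma> i = \<tau> i) \<longrightarrow> tsub \<sigma> b = tsub \<tau> b" by blast
  have "tsub (tup (tup \<sigma>)) b = tsub (tup (tup \<tau>)) b" if "\<forall>i<N3. \<sigma> i = \<tau> i" for \<sigma> \<tau>
    using that by (intro N(3)[rule_format]) (auto split: nat.split)
  then show ?case using N by (intro exI[of _ "N1 + N2 + N3"]) (auto simp del: tup_eq)
qed auto

lemma fsub_bounded: "\<exists>N. \<forall>\<sigma> \<tau>. (\<forall>i<N. \<sigma> i = \<tau> i) \<longrightarrow> fsub \<sigma> \<phi> = fsub \<tau> \<phi>"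
proof -
  \<comment> \<open>Substitutions that agree below N have lifted versions that agree at least that
    far, so the bound for the body serves the quantifier.\<close>
  have 1: "\<exists>N. \<forall>\<sigma> \<tau>. (\<forall>i<N. \<sigma> i = \<tau> i) \<longrightarrow> fsub (tup \<sigma>) \<phi> = fsub (tup \<tau>) \<phi>"
    if "\<exists>N. \<forall>\<sigma> \<tau>. (\<forall>i<N. \<sigma> i = \<tau> i) \<longrightarrow> fsub \<sigma> \<phi> = fsub \<tau> \<phi>" for \<phi>
  proof -
    from that obtain N where N: "\<forall>\<sigma> \<tau>. (\<forall>i<N. \<sigma> i = \<tau> i) \<longrightarrow> fsub \<sigma> \<phi> = fsub \<tau> \<phi>" by blast
    show ?thesis by (rule exI[of _ N]) (auto intro!: N[rule_format] split: nat.split)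
  qed
  have 2: "\<exists>N. \<forall>\<sigma> \<tau>. (\<forall>i<N. \<sigma> i = \<tau> i) \<longrightarrow> P \<sigma> \<tau> \<and> Q \<sigma> \<tau>"
    if "\<exists>N. \<forall>\<sigma> \<tau>. (\<forall>i<N. \<sigma> i = \<tau> i) \<longrightarrow> P \<sigma> \<tau>" "\<exists>N. \<forall>\<sigma> \<tau>. (\<forall>i<N. \<sigma> i = \<tau> i) \<longrightarrow> Q \<sigma> \<tau>"
    for P Q :: "(nat \<Rightarrow> tm) \<Rightarrow> (nat \<Rightarrow> tm) \<Rightarrow> bool"
  proof -
    from that obtain N M where "\<forall>\<sigma> \<tau>. (\<forall>i<N. \<sigma> i = \<tau> i) \<longrightarrow> P \<sigma> \<tau>" "\<forall>\<sigma> \<tau>. (\<forall>i<M. \<sigma> i = \<tau> i) \<longrightarrow> Q \<sigma> \<tau>"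
      by blast
    then show ?thesis by (intro exI[of _ "N + M"]) auto
  qed
  show ?thesis
    by (induction \<phi>) (simp_all add: tsub_bounded 2 1 del: tup_eq)
qed

lemma fsub_bounded_list: "\<exists>N. \<forall>\<phi>\<in>set \<Gamma>. \<forall>\<sigma> \<tau>. (\<forall>i<N. \<sigma> i = \<tau> i) \<longrightarrow> fsub \<sigma> \<phi> = fsub \<tau> \<phi>"
proof (induction \<Gamma>)
  case (Cons \<phi> \<Gamma>)
  then obtain N M where "\<forall>\<phi>\<in>set \<Gamma>. \<forall>\<sigma> \<tau>. (\<forall>i<N. \<sigma> i = \<tau> i) \<longrightarrow> fsub \<sigma> \<phi> = fsub \<tau> \<phi>"
    "\<forall>\<sigma> \<tau>. (\<forall>i<M. \<sigma> i = \<tau> i) \<longrightarrow> fsub \<sigma> \<phi> = fsub \<tau> \<phi>"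
    using fsub_bounded by blast
  then show ?case by (intro exI[of _ "N + M"]) auto
qed simp

subsection \<open>Forcing\<close>

locale vsystem =
  fixes \<xi> :: tm
begin

definition force :: "fm list \<Rightarrow> fm \<Rightarrow> bool"  (infix "\<Vdash>" 45) where
  "\<Gamma> \<Vdash> \<phi> \<longleftrightarrow> deriv (sys_axiom \<xi>) (set \<Gamma>) \<phi>"

definition extends :: "fm list \<Rightarrow> fm list \<Rightarrow> bool"  (infix "\<preceq>" 45) where
  "\<Gamma> \<preceq> \<Delta> \<longleftrightarrow> set \<Gamma> \<subseteq> set \<Delta>"

lemma ext_refl [simp, intro]: "\<Gamma> \<preceq> \<Gamma>"
  by (simp add: extends_def)

lemma ext_trans [trans]: "\<Gamma> \<preceq> \<Delta> \<Longrightarrow> \<Delta> \<preceq> \<Phi> \<Longrightarrow> \<Gamma> \<preceq> \<Phi>"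
  by (auto simp: extends_def)

lemma mono: "\<Gamma> \<Vdash> \<phi> \<Longrightarrow> \<Gamma> \<preceq> \<Delta> \<Longrightarrow> \<Delta> \<Vdash> \<phi>"
  unfolding force_def extends_def by (rule deriv_weaken)

lemma botE: "\<Gamma> \<Vdash> Bot \<Longrightarrow> \<Gamma> \<Vdash> \<phi>"
  unfolding force_def by (rule deriv.BotE)

lemma and_iff [simp]: "\<Gamma> \<Vdash> And A B \<longleftrightarrow> \<Gamma> \<Vdash> A \<and> \<Gamma> \<Vdash> B"
  unfolding force_def by (meson deriv.AndI deriv.AndE1 deriv.AndE2)

lemma orI1: "\<Gamma> \<Vdash> A \<Longrightarrow> \<Gamma> \<Vdash> Or A B" and orI2: "\<Gamma> \<Vdash> B \<Longrightarrow> \<Gamma> \<Vdash> Or A B"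
  unfolding force_def by (auto intro: deriv.intros)

text \<open>Elimination rules take their cases in an arbitrary extension of the context, so that
  they chain like case distinctions in HOL; the extension that is actually used adds a single
  hypothesis.\<close>

lemma orE:
  assumes "\<Gamma> \<Vdash> Or A B" and "\<And>\<Delta>. \<Gamma> \<preceq> \<Delta> \<Longrightarrow> \<Delta> \<Vdash> A \<Longrightarrow> \<Delta> \<Vdash> C"
    and "\<And>\<Delta>. \<Gamma> \<preceq> \<Delta> \<Longrightarrow> \<Delta> \<Vdash> B \<Longrightarrow> \<Delta> \<Vdash> C"
  shows "\<Gamma> \<Vdash> C"
  using assms(1) assms(2)[of "A # \<Gamma>"] assms(3)[of "B # \<Gamma>"] unfolding force_def extends_def
  by (auto intro: deriv.OrE deriv.Hyp)

lemma fm_impI: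
  assumes "\<And>\<Delta>. \<Gamma> \<preceq> \<Delta> \<Longrightarrow> \<Delta> \<Vdash> A \<Longrightarrow> \<Delta> \<Vdash> B"
  shows "\<Gamma> \<Vdash> Imp A B"
  using assms[of "A # \<Gamma>"] unfolding force_def extends_def
  by (auto intro: deriv.ImpI deriv.Hyp)

lemma fm_impE: "\<Gamma> \<Vdash> Imp A B \<Longrightarrow> \<Gamma> \<Vdash> A \<Longrightarrow> \<Gamma> \<Vdash> B"
  unfolding force_def by (rule deriv.ImpE)

lemma imp_iff: "\<Gamma> \<Vdash> Imp A B \<longleftrightarrow> (\<forall>\<Delta>. \<Gamma> \<preceq> \<Delta> \<longrightarrow> \<Delta> \<Vdash> A \<longrightarrow> \<Delta> \<Vdash> B)"
  by (meson fm_impI fm_impE mono)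

text \<open>
  It suffices to consider a variable that occurs neither in the context nor in the formula; this is
  where finiteness of contexts is used.
\<close>

lemma fm_allI:
  assumes "\<And>t. \<Gamma> \<Vdash> inst t \<phi>"
  shows "\<Gamma> \<Vdash> All \<phi>"
proof -
  obtain N where N: "\<forall>\<psi>\<in>set (All \<phi> # \<Gamma>). \<forall>\<sigma> \<tau>. (\<forall>i<N. \<sigma> i = \<tau> i) \<longrightarrow> fsub \<sigma> \<psi> = fsub \<tau> \<psi>"
    using fsub_bounded_list by blast
  \<comment> \<open>The fresh variable N moves to index 0 and all others move up by one. Below N
    this is the ordinary shift, hence it acts as \<open>fren Suc\<close> on the context and on
    \<open>All \<phi>\<close>.\<close>
  define r where "r = (\<lambda>i. Var (if i = N then 0 else Suc i))"
  have ren: "fsub r \<psi> = fren Suc \<psi>" if "\<psi> \<in> set (All \<phi> # \<Gamma>)" for \<psi>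
    using N[rule_format, OF that, of r "\<lambda>i. Var (Suc i)"] by (simp add: r_def)
  have "fsub r (All \<phi>) = fren Suc (All \<phi>)" by (rule ren) simp
  then have \<phi>: "fsub (tup r) \<phi> = fsub (tup (\<lambda>i. Var (Suc i))) \<phi>" by simp
  have "fsub r (inst (Var N) \<phi>) = fsub (Var 0 ## r) \<phi>"
    by (simp add: r_def)
  also have "\<dots> = fsub (Var 0 ## Var) (fsub (tup r) \<phi>)" by simp
  also have "\<dots> = fsub (Var 0 ## Var) (fsub (tup (\<lambda>i. Var (Suc i))) \<phi>)" by (simp only: \<phi>)
  also have "\<dots> = \<phi>" by simp
  finally have inst: "fsub r (inst (Var N) \<phi>) = \<phi>" .
  have "deriv (sys_axiom \<xi>) (fsub r ` set \<Gamma>) (fsub r (inst (Var N) \<phi>))"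
    using assms[of "Var N"] unfolding force_def
    by (rule deriv_fsub) (rule sys_axiom_fsub)
  moreover have "fsub r ` set \<Gamma> = fren Suc ` set \<Gamma>"
    using ren by (intro image_cong) auto
  ultimately have "deriv (sys_axiom \<xi>) (fren Suc ` set \<Gamma>) \<phi>"
    by (simp only: inst)
  then show ?thesis unfolding force_def by (rule deriv.AllI)
qed

lemma fm_allE: "\<Gamma> \<Vdash> All \<phi> \<Longrightarrow> \<Gamma> \<Vdash> inst t \<phi>"
  unfolding force_def by (rule deriv.AllE)

lemma all_iff: "\<Gamma> \<Vdash> All \<phi> \<longleftrightarrow> (\<forall>t. \<Gamma> \<Vdash> fsub (t ## Var) \<phi>)"
  using fm_allI fm_allE by auto

lemma fm_exI: "\<Gamma> \<Vdash> fsub (t ## Var) \<phi> \<Longrightarrow> \<Gamma> \<Vdash> Ex \<phi>"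
  unfolding force_def using deriv.ExI[of _ _ t] by simp

text \<open>The premise concerns all terms in the unshifted context, whereas \<open>ExE\<close>
  wants an eigenvariable. Packing the premise into
  \<open>\<forall>x (\<phi> \<rightarrow> C)\<close> by the universal rule, shifting, and
  instantiating with \<open>Var 0\<close> mediates between the two.\<close>

lemma fm_exE:
  assumes "\<Gamma> \<Vdash> Ex \<phi>" and C: "\<And>\<Delta> t. \<Gamma> \<preceq> \<Delta> \<Longrightarrow> \<Delta> \<Vdash> fsub (t ## Var) \<phi> \<Longrightarrow> \<Delta> \<Vdash> C"
  shows "\<Gamma> \<Vdash> C"
proof -
  have "\<Gamma> \<Vdash> All (Imp \<phi> (fren Suc C))"
    by (auto simp: all_iff intro!: fm_impI C)
  then have "deriv (sys_axiom \<xi>) (fren Suc ` set \<Gamma>) (fren Suc (All (Imp \<phi> (fren Suc C))))"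
    unfolding force_def fren_def by (rule deriv_fsub) (rule sys_axiom_fsub)
  then have "deriv (sys_axiom \<xi>) (fren Suc ` set \<Gamma>) (Imp \<phi> (fren Suc C))"
    by (force dest: deriv.AllE[where t = "Var 0"])
  then have "deriv (sys_axiom \<xi>) (insert \<phi> (fren Suc ` set \<Gamma>)) (fren Suc C)"
    by (meson deriv.Hyp deriv.ImpE deriv_weaken insertI1 subset_insertI)
  then show ?thesis using assms(1) unfolding force_def by (meson deriv.ExE)
qed

lemma axI: "sys_axiom \<xi> \<phi> \<Longrightarrow> \<Gamma> \<Vdash> \<phi>"
  unfolding force_def by (rule deriv.AxI)

lemma eq_refl [simp, intro]: "\<Gamma> \<Vdash> Eq t t"
  unfolding force_def by (rule deriv.EqI)

lemma eq_subst: "\<Gamma> \<Vdash> Eq s t \<Longrightarrow> \<Gamma> \<Vdash> fsub (s ## Var) \<phi> \<Longrightarrow> \<Gamma> \<Vdash> fsub (t ## Var) \<phi>"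
  unfolding force_def using deriv.EqE by fastforce

lemma eq_sym: "\<Gamma> \<Vdash> Eq s t \<Longrightarrow> \<Gamma> \<Vdash> Eq t s"
  using eq_subst[of \<Gamma> s t "Eq (Var 0) (tsub (\<lambda>i. Var (Suc i)) s)"] by simp

lemma eq_trans [trans]: "\<Gamma> \<Vdash> Eq s t \<Longrightarrow> \<Gamma> \<Vdash> Eq t u \<Longrightarrow> \<Gamma> \<Vdash> Eq s u"
  using eq_subst[of \<Gamma> t u "Eq (tsub (\<lambda>i. Var (Suc i)) s) (Var 0)"] by simp

lemma eq_fsub: "\<Gamma> \<Vdash> Eq s t \<Longrightarrow> \<Gamma> \<Vdash> fsub (s ## \<sigma>) \<phi> \<longleftrightarrow> \<Gamma> \<Vdash> fsub (t ## \<sigma>) \<phi>"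
  using eq_subst[of \<Gamma> s t "fsub (tup \<sigma>) \<phi>"] eq_subst[of \<Gamma> t s "fsub (tup \<sigma>) \<phi>"] eq_sym by auto

lemma eq_tsub: "\<Gamma> \<Vdash> Eq s t \<Longrightarrow> \<Gamma> \<Vdash> Eq (tsub (s ## \<sigma>) u) (tsub (t ## \<sigma>) u)"
  using eq_subst[of \<Gamma> s t "Eq (tsub (\<lambda>i. Var (Suc i)) (tsub (s ## \<sigma>) u)) (tsub (tup \<sigma>) u)"] by simp

lemma ind:
  assumes "\<Gamma> \<Vdash> fsub (Zr ## Var) \<phi>"
    and "\<And>\<Delta> t. \<Gamma> \<preceq> \<Delta> \<Longrightarrow> \<Delta> \<Vdash> fsub (t ## Var) \<phi> \<Longrightarrow> \<Delta> \<Vdash> fsub (Sc t ## Var) \<phi>"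
  shows "\<Gamma> \<Vdash> fsub (t ## Var) \<phi>"
proof -
  have "\<Gamma> \<Vdash> All (Imp \<phi> (fsub (Sc (Var 0) ## (\<lambda>k. Var (Suc k))) \<phi>))"
    using assms(2) by (auto simp: all_iff intro!: fm_impI)
  with axI[OF sys_axiom.Induction, of \<Gamma> \<phi>] assms(1) have "\<Gamma> \<Vdash> All \<phi>"
    by (metis fm_impE inst_eq)
  then show ?thesis by (simp add: all_iff)
qed

subsection \<open>Arithmetic\<close>

text \<open>
  Passing to the classes of provably equal terms turns equational reasoning in a context into
  rewriting with HOL equality.
\<close>

definition cl :: "fm list \<Rightarrow> tm \<Rightarrow> tm set" where
  "cl \<Gamma> t = {s. \<Gamma> \<Vdash> Eq t s}"

text \<open>The operations on classes are meaningful only on sets of this kind; \<open>is_cl\<close>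
  is the side condition that makes arithmetical laws usable as rewrite rules on classes.\<close>

definition is_cl :: "fm list \<Rightarrow> tm set \<Rightarrow> bool" where
  "is_cl \<Gamma> X \<longleftrightarrow> (\<exists>t. X = cl \<Gamma> t)"

definition op1 :: "fm list \<Rightarrow> (tm \<Rightarrow> tm) \<Rightarrow> tm set \<Rightarrow> tm set" where
  "op1 \<Gamma> f X = {u. \<exists>s\<in>X. \<Gamma> \<Vdash> Eq (f s) u}"

definition op2 :: "fm list \<Rightarrow> (tm \<Rightarrow> tm \<Rightarrow> tm) \<Rightarrow> tm set \<Rightarrow> tm set \<Rightarrow> tm set" where
  "op2 \<Gamma> f X Y = {u. \<exists>s\<in>X. \<exists>t\<in>Y. \<Gamma> \<Vdash> Eq (f s t) u}"

definition op3 :: "fm list \<Rightarrow> (tm \<Rightarrow> tm \<Rightarrow> tm \<Rightarrow> tm) \<Rightarrow> tm set \<Rightarrow> tm set \<Rightarrow> tm set \<Rightarrow> tm set" where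
  "op3 \<Gamma> f X Y Z = {u. \<exists>s\<in>X. \<exists>t\<in>Y. \<exists>r\<in>Z. \<Gamma> \<Vdash> Eq (f s t r) u}"

lemma eq_cl: "\<Gamma> \<Vdash> Eq s t \<longleftrightarrow> cl \<Gamma> s = cl \<Gamma> t"
proof
  assume "\<Gamma> \<Vdash> Eq s t"
  then show "cl \<Gamma> s = cl \<Gamma> t" unfolding cl_def by (blast intro: eq_trans eq_sym)
next
  assume "cl \<Gamma> s = cl \<Gamma> t"
  then show "\<Gamma> \<Vdash> Eq s t" unfolding cl_def by blast
qed

lemma is_cl_cl [simp]: "is_cl \<Gamma> (cl \<Gamma> t)"
  by (auto simp: is_cl_def)

text \<open>Commuting with substitution means that \<open>f\<close> is given by a term with a hole.
  Replacement of equals then makes \<open>f\<close> a congruence, and the operation on classes is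
  well defined.\<close>

lemma op1_cl:
  assumes "\<And>\<sigma> s. tsub \<sigma> (f s) = f (tsub \<sigma> s)"
  shows "cl \<Gamma> (f s) = op1 \<Gamma> f (cl \<Gamma> s)" "is_cl \<Gamma> X \<Longrightarrow> is_cl \<Gamma> (op1 \<Gamma> f X)"
proof -
  have *: "\<Gamma> \<Vdash> Eq (f s) (f t)" if "\<Gamma> \<Vdash> Eq s t" for s t
    using eq_tsub[OF that, of Var "f (Var 0)"] by (simp add: assms)
  show 1: "cl \<Gamma> (f s) = op1 \<Gamma> f (cl \<Gamma> s)" for s
    unfolding cl_def op1_def by (auto intro: eq_trans *)
  show "is_cl \<Gamma> (op1 \<Gamma> f X)" if "is_cl \<Gamma> X"
    using that unfolding is_cl_def by (auto simp flip: 1)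
qed

lemma op2_cl:
  assumes "\<And>\<sigma> s t. tsub \<sigma> (f s t) = f (tsub \<sigma> s) (tsub \<sigma> t)"
  shows "cl \<Gamma> (f s t) = op2 \<Gamma> f (cl \<Gamma> s) (cl \<Gamma> t)"
    "is_cl \<Gamma> X \<Longrightarrow> is_cl \<Gamma> Y \<Longrightarrow> is_cl \<Gamma> (op2 \<Gamma> f X Y)"
proof -
  have *: "\<Gamma> \<Vdash> Eq (f s t) (f s' t')" if "\<Gamma> \<Vdash> Eq s s'" "\<Gamma> \<Vdash> Eq t t'" for s t s' t'
    using eq_tsub[OF that(1), of "t ## Var" "f (Var 0) (Var 1)"] eq_tsub[OF that(2), of "s' ## Var" "f (Var 1) (Var 0)"]
    by (auto simp: assms intro: eq_trans)
  show 1: "cl \<Gamma> (f s t) = op2 \<Gamma> f (cl \<Gamma> s) (cl \<Gamma> t)" for s t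
    unfolding cl_def op2_def by (auto intro: eq_trans *)
  show "is_cl \<Gamma> (op2 \<Gamma> f X Y)" if "is_cl \<Gamma> X" "is_cl \<Gamma> Y"
    using that unfolding is_cl_def by (auto simp flip: 1)
qed

lemma op3_cl:
  assumes "\<And>\<sigma> s t r. tsub \<sigma> (f s t r) = f (tsub \<sigma> s) (tsub \<sigma> t) (tsub \<sigma> r)"
  shows "cl \<Gamma> (f s t r) = op3 \<Gamma> f (cl \<Gamma> s) (cl \<Gamma> t) (cl \<Gamma> r)"
    "is_cl \<Gamma> X \<Longrightarrow> is_cl \<Gamma> Y \<Longrightarrow> is_cl \<Gamma> Z \<Longrightarrow> is_cl \<Gamma> (op3 \<Gamma> f X Y Z)"
proof -
  have *: "\<Gamma> \<Vdash> Eq (f s t r) (f s' t' r')" if "\<Gamma> \<Vdash> Eq s s'" "\<Gamma> \<Vdash> Eq t t'" "\<Gamma> \<Vdash> Eq r r'" for s t r s' t' r'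
    using eq_tsub[OF that(1), of "t ## r ## Var" "f (Var 0) (Var 1) (Var 2)"]
      eq_tsub[OF that(2), of "s' ## r ## Var" "f (Var 1) (Var 0) (Var 2)"]
      eq_tsub[OF that(3), of "s' ## t' ## Var" "f (Var 1) (Var 2) (Var 0)"]
    by (auto simp: assms intro: eq_trans)
  show 1: "cl \<Gamma> (f s t r) = op3 \<Gamma> f (cl \<Gamma> s) (cl \<Gamma> t) (cl \<Gamma> r)" for s t r
    unfolding cl_def op3_def by (auto intro: eq_trans *)
  show "is_cl \<Gamma> (op3 \<Gamma> f X Y Z)" if "is_cl \<Gamma> X" "is_cl \<Gamma> Y" "is_cl \<Gamma> Z"
    using that unfolding is_cl_def by (auto simp flip: 1)
qed

text \<open>The loop inside \<open>look_tm\<close>, isolated so that lookups in the history can be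
  analysed by induction on the number of tails taken.\<close>

definition it_tm :: "tm \<Rightarrow> tm \<Rightarrow> tm" where
  "it_tm k h = Rec k h (snd_tm (Var 0))"

lemma tsub_it [simp]: "tsub \<sigma> (it_tm k h) = it_tm (tsub \<sigma> k) (tsub \<sigma> h)"
  by (simp add: it_tm_def)

lemmas tsub_ops =
  op1_cl[of Sc, OF tsub.simps(3)] op2_cl[of plus_tm, OF tsub_basic(1)] op1_cl[of pred_tm, OF tsub_basic(2)]
  op3_cl[of cond_tm, OF tsub_basic(3)] op2_cl[of times_tm, OF tsub_basic2(1)] op2_cl[of minus_tm, OF tsub_basic2(2)]
  op1_cl[of tri_tm, OF tsub_basic2(3)] op2_cl[of dist_tm, OF tsub_basic3(1)] op2_cl[of pair_tm, OF tsub_basic3(2)]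
  op1_cl[of diag_tm, OF tsub_diag] op1_cl[of fst_tm, OF tsub_fst] op1_cl[of snd_tm, OF tsub_snd]
  op1_cl[of ix_tm, OF tsub_tree(1)] op1_cl[of in_tm, OF tsub_tree(2)] op1_cl[of out_tm, OF tsub_tree(3)]
  op1_cl[of sub1_tm, OF tsub_tree(4)] op1_cl[of sub2_tm, OF tsub_tree(5)]
  op3_cl[of look_tm, OF tsub_look] op2_cl[of check_tm, OF tsub_check] op2_cl[of rule_tm, OF tsub_rule]
  op1_cl[of hist_tm, OF tsub_hist] op3_cl[of T_tm, OF tsub_T] op3_cl[of none_below_tm, OF tsub_none_below]
  op2_cl[of it_tm, OF tsub_it]

text \<open>The odd entries push \<open>cl\<close> inwards, the even ones discharge
  \<open>is_cl\<close>.\<close>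

lemmas cl_op = tsub_ops(1,3,5,7,9,11,13,15,17,19,21,23,25,27,29,31,33,35,37,39,41,43,45,47)
lemmas is_cl_op [simp] = tsub_ops(2,4,6,8,10,12,14,16,18,20,22,24,26,28,30,32,34,36,38,40,42,44,46,48)

text \<open>\<open>to_cl\<close> translates an equation between terms into one between classes;
  \<open>lift_cl\<close> goes back, replacing arbitrary classes by representing terms.\<close>

lemmas lift_cl = is_cl_def cl_op[symmetric] eq_cl[symmetric]
lemmas to_cl = eq_cl cl_op

section \<open>Addition, cut-off subtraction, order and distance\<close>

lemma suc_inj: "\<Gamma> \<Vdash> Eq (Sc s) (Sc t) \<longleftrightarrow> \<Gamma> \<Vdash> Eq s t"
  using fm_impE[OF axI[OF sys_axiom.Succ_inject]] eq_tsub[of \<Gamma> s t Var "Sc (Var 0)"] by auto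

lemma suc_nz: "\<Gamma> \<Vdash> Eq (Sc t) Zr \<Longrightarrow> \<Gamma> \<Vdash> C"
  using fm_impE[OF axI[OF sys_axiom.Succ_nonzero]] by (blast intro: botE)

text \<open>The induction step never uses its hypothesis. Decidable case distinctions below apply
  this to the value of a characteristic term.\<close>

lemma zcases:
  assumes "\<And>\<Delta>. \<Gamma> \<preceq> \<Delta> \<Longrightarrow> \<Delta> \<Vdash> Eq t Zr \<Longrightarrow> \<Delta> \<Vdash> C"
    and "\<And>\<Delta> k. \<Gamma> \<preceq> \<Delta> \<Longrightarrow> \<Delta> \<Vdash> Eq t (Sc k) \<Longrightarrow> \<Delta> \<Vdash> C"
  shows "\<Gamma> \<Vdash> C"
proof -
  have "\<Gamma> \<Vdash> Or (Eq t Zr) (Ex (Eq (tsub (\<lambda>i. Var (Suc i)) t) (Sc (Var 0))))"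
  proof (rule ind[of \<Gamma> "Or (Eq (Var 0) Zr) (Ex (Eq (Var 1) (Sc (Var 0))))" t, simplified])
    show "\<Delta> \<Vdash> Or (Eq (Sc t) Zr) (Ex (Eq (Sc (tsub (\<lambda>i. Var (Suc i)) t)) (Sc (Var 0))))" for \<Delta> t
      by (rule orI2, rule fm_exI[of _ t]) simp
  qed (simp add: orI1)
  then show ?thesis
  proof (rule orE)
    fix \<Delta> assume 1: "\<Gamma> \<preceq> \<Delta>" and "\<Delta> \<Vdash> Ex (Eq (tsub (\<lambda>i. Var (Suc i)) t) (Sc (Var 0)))"
    from this(2) show "\<Delta> \<Vdash> C" by (rule fm_exE) (auto intro: assms(2) ext_trans[OF 1])
  qed (rule assms(1))
qed

text \<open>Cut-off subtraction recurses on two arguments at once, so the second is generalised. The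
  environment \<open>Var 1 ## Var 0 ## ...\<close> swaps the two indices: the quantifier binds y and
  leaves x free for the outer induction.\<close>

lemma dind:
  assumes "\<And>\<Delta> y. \<Delta> \<Vdash> fsub (Zr ## y ## Var) \<phi>" "\<And>\<Delta> x. \<Delta> \<Vdash> fsub (Sc x ## Zr ## Var) \<phi>"
    and "\<And>\<Delta> x y. \<Delta> \<Vdash> fsub (x ## y ## Var) \<phi> \<Longrightarrow> \<Delta> \<Vdash> fsub (Sc x ## Sc y ## Var) \<phi>"
  shows "\<Gamma> \<Vdash> fsub (x ## y ## Var) \<phi>"
proof -
  have "\<Gamma> \<Vdash> fsub (x ## Var) (All (fsub (Var 1 ## Var 0 ## (\<lambda>k. Var (k + 2))) \<phi>))"
  proof (rule ind)
    fix \<Delta> t assume "\<Delta> \<Vdash> fsub (t ## Var) (All (fsub (Var 1 ## Var 0 ## (\<lambda>k. Var (k + 2))) \<phi>))"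
    then have IH: "\<Delta> \<Vdash> fsub (t ## y ## Var) \<phi>" for y by (simp add: all_iff)
    have "\<Delta> \<Vdash> fsub (Sc t ## y ## Var) \<phi>" for y
    proof (rule zcases[of \<Delta> y])
      fix \<Phi> assume "\<Phi> \<Vdash> Eq y Zr"
      from eq_fsub[OF this, of "Sc t ## Var" "fsub (Var 1 ## Var 0 ## (\<lambda>k. Var (k + 2))) \<phi>"]
      show "\<Phi> \<Vdash> fsub (Sc t ## y ## Var) \<phi>" by (simp add: assms)
    next
      fix \<Phi> k assume \<Phi>: "\<Delta> \<preceq> \<Phi>" and "\<Phi> \<Vdash> Eq y (Sc k)"
      from eq_fsub[OF this(2), of "Sc t ## Var" "fsub (Var 1 ## Var 0 ## (\<lambda>k. Var (k + 2))) \<phi>"]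
      show "\<Phi> \<Vdash> fsub (Sc t ## y ## Var) \<phi>" by (simp add: assms(3) mono[OF IH \<Phi>])
    qed
    then show "\<Delta> \<Vdash> fsub (Sc t ## Var) (All (fsub (Var 1 ## Var 0 ## (\<lambda>k. Var (k + 2))) \<phi>))"
      by (simp add: all_iff)
  qed (simp add: all_iff assms)
  then show ?thesis by (simp add: all_iff)
qed

lemmas recS = axI[OF sys_axiom.Rec_Succ] and rec0 = axI[OF sys_axiom.Rec_Zero]

lemma rec_tm:
  "\<Gamma> \<Vdash> Eq (plus_tm s Zr) s" "\<Gamma> \<Vdash> Eq (plus_tm s (Sc t)) (Sc (plus_tm s t))"
  "\<Gamma> \<Vdash> Eq (times_tm s Zr) Zr" "\<Gamma> \<Vdash> Eq (times_tm s (Sc t)) (plus_tm (times_tm s t) s)"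
  "\<Gamma> \<Vdash> Eq (pred_tm Zr) Zr" "\<Gamma> \<Vdash> Eq (pred_tm (Sc t)) t"
  "\<Gamma> \<Vdash> Eq (minus_tm s Zr) s" "\<Gamma> \<Vdash> Eq (minus_tm s (Sc t)) (pred_tm (minus_tm s t))"
  "\<Gamma> \<Vdash> Eq (cond_tm Zr s t) s" "\<Gamma> \<Vdash> Eq (cond_tm (Sc r) s t) t"
  "\<Gamma> \<Vdash> Eq (tri_tm Zr) Zr" "\<Gamma> \<Vdash> Eq (tri_tm (Sc t)) (plus_tm (tri_tm t) (Sc t))"
  "\<Gamma> \<Vdash> Eq (diag_tm Zr) Zr"
  "\<Gamma> \<Vdash> Eq (diag_tm (Sc t)) (cond_tm (dist_tm (tri_tm (Sc (diag_tm t))) (Sc t)) (Sc (diag_tm t)) (diag_tm t))"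
  "\<Gamma> \<Vdash> Eq (hist_tm Zr) Zr" "\<Gamma> \<Vdash> Eq (hist_tm (Sc t)) (pair_tm (check_tm (hist_tm t) t) (hist_tm t))"
  "\<Gamma> \<Vdash> Eq (it_tm Zr t) t" "\<Gamma> \<Vdash> Eq (it_tm (Sc s) t) (snd_tm (it_tm s t))"
  "\<Gamma> \<Vdash> Eq (none_below_tm e n Zr) Zr"
  "\<Gamma> \<Vdash> Eq (none_below_tm e n (Sc t)) (cond_tm (T_tm e n t) (Sc Zr) (none_below_tm e n t))"
  unfolding plus_tm_def using rec0[of \<Gamma> s "Sc (Var 0)"] apply simp
  using recS[of \<Gamma> t s "Sc (Var 0)"] apply simp
  unfolding times_tm_def using rec0 apply simp
  using recS[of \<Gamma> t Zr "plus_tm (Var 0) (lift2_tm s)"] apply (simp add: plus_tm_def)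
  unfolding pred_tm_def using rec0 apply simp
  using recS[of \<Gamma> t Zr "Var 1"] apply simp
  unfolding minus_tm_def using rec0 apply simp
  using recS[of \<Gamma> t s "pred_tm (Var 0)"] apply (simp add: pred_tm_def)
  unfolding cond_tm_def using rec0 apply simp
  using recS[of \<Gamma> r s "lift2_tm t"] apply simp
  unfolding tri_tm_def using rec0 apply simp
  using recS[of \<Gamma> t Zr "plus_tm (Var 0) (Sc (Var 1))"] apply (simp add: plus_tm_def)
  unfolding diag_tm_def using rec0 apply simp
  using recS[of \<Gamma> t Zr "(cond_tm (dist_tm (tri_tm (Sc (Var 0))) (Sc (Var 1))) (Sc (Var 0)) (Var 0))"]
       apply (simp add: cond_tm_def tri_tm_def plus_tm_def)
  unfolding hist_tm_def using rec0 apply simp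
  using recS[of \<Gamma> t Zr "(pair_tm (check_tm (Var 0) (Var 1)) (Var 0))"] apply simp
  unfolding it_tm_def using rec0 apply simp
  using recS[of \<Gamma> s t "snd_tm (Var 0)"] apply simp
  unfolding none_below_tm_def using rec0 apply simp
  using recS[of \<Gamma> t Zr "cond_tm (T_tm (lift2_tm e) (lift2_tm n) (Var 1)) (Sc Zr) (Var 0)"] apply (simp add: cond_tm_def)
  done

lemma rec_cl [simp]:
  "is_cl \<Gamma> X \<Longrightarrow> op2 \<Gamma> plus_tm X (cl \<Gamma> Zr) = X"
  "is_cl \<Gamma> X \<Longrightarrow> is_cl \<Gamma> Y \<Longrightarrow> op2 \<Gamma> plus_tm X (op1 \<Gamma> Sc Y) = op1 \<Gamma> Sc (op2 \<Gamma> plus_tm X Y)"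
  "is_cl \<Gamma> X \<Longrightarrow> op2 \<Gamma> times_tm X (cl \<Gamma> Zr) = cl \<Gamma> Zr"
  "is_cl \<Gamma> X \<Longrightarrow> is_cl \<Gamma> Y \<Longrightarrow> op2 \<Gamma> times_tm X (op1 \<Gamma> Sc Y) = op2 \<Gamma> plus_tm (op2 \<Gamma> times_tm X Y) X"
  "op1 \<Gamma> pred_tm (cl \<Gamma> Zr) = cl \<Gamma> Zr"
  "is_cl \<Gamma> X \<Longrightarrow> op1 \<Gamma> pred_tm (op1 \<Gamma> Sc X) = X"
  "is_cl \<Gamma> X \<Longrightarrow> op2 \<Gamma> minus_tm X (cl \<Gamma> Zr) = X"
  "is_cl \<Gamma> X \<Longrightarrow> is_cl \<Gamma> Y \<Longrightarrow> op2 \<Gamma> minus_tm X (op1 \<Gamma> Sc Y) = op1 \<Gamma> pred_tm (op2 \<Gamma> minus_tm X Y)"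
  "is_cl \<Gamma> X \<Longrightarrow> is_cl \<Gamma> Y \<Longrightarrow> op3 \<Gamma> cond_tm (cl \<Gamma> Zr) X Y = X"
  "is_cl \<Gamma> X \<Longrightarrow> is_cl \<Gamma> Y \<Longrightarrow> is_cl \<Gamma> Z \<Longrightarrow> op3 \<Gamma> cond_tm (op1 \<Gamma> Sc Z) X Y = Y"
  "op1 \<Gamma> tri_tm (cl \<Gamma> Zr) = cl \<Gamma> Zr"
  "is_cl \<Gamma> X \<Longrightarrow> op1 \<Gamma> tri_tm (op1 \<Gamma> Sc X) = op1 \<Gamma> Sc (op2 \<Gamma> plus_tm (op1 \<Gamma> tri_tm X) X)"
  "op1 \<Gamma> diag_tm (cl \<Gamma> Zr) = cl \<Gamma> Zr"
  "is_cl \<Gamma> X \<Longrightarrow> op2 \<Gamma> it_tm (cl \<Gamma> Zr) X = X"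
  "is_cl \<Gamma> X \<Longrightarrow> is_cl \<Gamma> Y \<Longrightarrow> op2 \<Gamma> it_tm (op1 \<Gamma> Sc Y) X = op1 \<Gamma> snd_tm (op2 \<Gamma> it_tm Y X)"
  by (auto simp: lift_cl rec_tm intro: eq_trans[OF rec_tm(12) rec_tm(2)] del: equalityI)

lemma suc_cl [simp]: "is_cl \<Gamma> X \<Longrightarrow> is_cl \<Gamma> Y \<Longrightarrow> op1 \<Gamma> Sc X = op1 \<Gamma> Sc Y \<longleftrightarrow> X = Y"
  by (auto simp: lift_cl suc_inj del: equalityI)

lemma diag_cl: "is_cl \<Gamma> X \<Longrightarrow> op1 \<Gamma> diag_tm (op1 \<Gamma> Sc X) =
   op3 \<Gamma> cond_tm (op2 \<Gamma> dist_tm (op1 \<Gamma> tri_tm (op1 \<Gamma> Sc (op1 \<Gamma> diag_tm X))) (op1 \<Gamma> Sc X))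
      (op1 \<Gamma> Sc (op1 \<Gamma> diag_tm X)) (op1 \<Gamma> diag_tm X)"
  by (auto simp: lift_cl rec_tm del: equalityI)

lemma hist_cl: "is_cl \<Gamma> X \<Longrightarrow> op1 \<Gamma> hist_tm (op1 \<Gamma> Sc X) =
   op2 \<Gamma> pair_tm (op2 \<Gamma> check_tm (op1 \<Gamma> hist_tm X) X) (op1 \<Gamma> hist_tm X)"
  by (auto simp: lift_cl rec_tm del: equalityI)

lemma plus_0l: "\<Gamma> \<Vdash> Eq (plus_tm Zr x) x"
  by (rule ind[of \<Gamma> "Eq (plus_tm Zr (Var 0)) (Var 0)", simplified]) (simp_all add: to_cl)

lemma plus_Sl: "\<Gamma> \<Vdash> Eq (plus_tm (Sc x) y) (Sc (plus_tm x y))"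
  by (rule ind[of \<Gamma> "Eq (plus_tm (Sc (lift_tm x)) (Var 0)) (Sc (plus_tm (lift_tm x) (Var 0)))", simplified])
    (simp_all add: to_cl)

lemma plus_l_cl [simp]:
  "is_cl \<Gamma> X \<Longrightarrow> op2 \<Gamma> plus_tm (cl \<Gamma> Zr) X = X"
  "is_cl \<Gamma> X \<Longrightarrow> is_cl \<Gamma> Y \<Longrightarrow> op2 \<Gamma> plus_tm (op1 \<Gamma> Sc X) Y = op1 \<Gamma> Sc (op2 \<Gamma> plus_tm X Y)"
  by (auto simp: lift_cl plus_0l plus_Sl del: equalityI)

lemma plus_assoc: "\<Gamma> \<Vdash> Eq (plus_tm (plus_tm x y) z) (plus_tm x (plus_tm y z))"
  by (rule ind[of \<Gamma> "Eq (plus_tm (plus_tm (lift_tm x) (lift_tm y)) (Var 0)) (plus_tm (lift_tm x) (plus_tm (lift_tm y) (Var 0)))", simplified])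
    (simp_all add: to_cl)

lemma minus_SS: "\<Gamma> \<Vdash> Eq (minus_tm (Sc x) (Sc y)) (minus_tm x y)"
  by (rule ind[of \<Gamma> "Eq (minus_tm (Sc (lift_tm x)) (Sc (Var 0))) (minus_tm (lift_tm x) (Var 0))", simplified])
    (simp_all add: to_cl)

lemma minus_0l: "\<Gamma> \<Vdash> Eq (minus_tm Zr y) Zr"
  by (rule ind[of \<Gamma> "Eq (minus_tm Zr (Var 0)) Zr", simplified])
    (simp_all add: to_cl)

lemma minus_cl1:
  "is_cl \<Gamma> X \<Longrightarrow> is_cl \<Gamma> Y \<Longrightarrow> op2 \<Gamma> minus_tm (op1 \<Gamma> Sc X) (op1 \<Gamma> Sc Y) = op2 \<Gamma> minus_tm X Y"
  by (auto simp: lift_cl minus_SS del: equalityI)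

lemma minus_cl2 [simp]: "is_cl \<Gamma> X \<Longrightarrow> op2 \<Gamma> minus_tm (cl \<Gamma> Zr) X = cl \<Gamma> Zr"
  by (auto simp: lift_cl minus_0l del: equalityI)

text \<open>Rewriting \<open>x - (y + 1)\<close> to a predecessor would keep differences of two
  successors from cancelling. Cancellation gets precedence, and the recursion equation is supplied
  by hand where it is wanted.\<close>

declare rec_cl(8) [simp del] minus_cl1 [simp]

lemma minus_self: "\<Gamma> \<Vdash> Eq (minus_tm x x) Zr"
  by (rule ind[of \<Gamma> "Eq (minus_tm (Var 0) (Var 0)) Zr", simplified]) (simp_all add: to_cl)

lemma plus_minus: "\<Gamma> \<Vdash> Eq (minus_tm (plus_tm x y) x) y"
  by (rule ind[of \<Gamma> "Eq (minus_tm (plus_tm (Var 0) (lift_tm y)) (Var 0)) (lift_tm y)", simplified]) (simp_all add: to_cl)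

lemma minus_plus: "\<Gamma> \<Vdash> Eq (minus_tm x (plus_tm x y)) Zr"
  by (rule ind[of \<Gamma> "Eq (minus_tm (Var 0) (plus_tm (Var 0) (lift_tm y))) Zr", simplified]) (simp_all add: to_cl)

text \<open>Both sides are the maximum of x and y. Antisymmetry of the order, and with it
  \<open>dist_zero_iff\<close> and \<open>leD\<close>, is read off from this one identity.\<close>

lemma max_tm: "\<Gamma> \<Vdash> Eq (plus_tm x (minus_tm y x)) (plus_tm y (minus_tm x y))"
  by (rule dind[where \<phi> = "Eq (plus_tm (Var 0) (minus_tm (Var 1) (Var 0))) (plus_tm (Var 1) (minus_tm (Var 0) (Var 1)))", simplified])
    (simp_all add: to_cl)

lemma minus_or: "\<Gamma> \<Vdash> Or (Eq (minus_tm x y) Zr) (Eq (minus_tm y x) Zr)"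
proof (rule dind[where \<phi> = "Or (Eq (minus_tm (Var 0) (Var 1)) Zr) (Eq (minus_tm (Var 1) (Var 0)) Zr)", simplified])
  show "\<Delta> \<Vdash> Or (Eq (minus_tm (Sc x) (Sc y)) Zr) (Eq (minus_tm (Sc y) (Sc x)) Zr)"
    if "\<Delta> \<Vdash> Or (Eq (minus_tm x y) Zr) (Eq (minus_tm y x) Zr)" for \<Delta> x y
    using that by (rule orE) (auto intro: orI1 orI2 eq_trans minus_SS)
qed (auto intro: orI1 orI2 minus_0l)

lemma plus_zero_iff: "\<Gamma> \<Vdash> Eq (plus_tm a b) Zr \<longleftrightarrow> \<Gamma> \<Vdash> Eq a Zr \<and> \<Gamma> \<Vdash> Eq b Zr"
proof
  assume A: "\<Gamma> \<Vdash> Eq (plus_tm a b) Zr"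
  have b: "\<Gamma> \<Vdash> Eq b Zr"
  proof (rule zcases[of \<Gamma> b])
    fix \<Delta> k assume \<Delta>: "\<Gamma> \<preceq> \<Delta>" "\<Delta> \<Vdash> Eq b (Sc k)"
    then have "\<Delta> \<Vdash> Eq (Sc (plus_tm a k)) Zr" using mono[OF A \<Delta>(1)] by (simp add: to_cl)
    then show "\<Delta> \<Vdash> Eq b Zr" by (rule suc_nz)
  qed
  with A show "\<Gamma> \<Vdash> Eq a Zr \<and> \<Gamma> \<Vdash> Eq b Zr" by (simp add: to_cl)
qed (simp add: to_cl)

lemma times_zeroI2: "\<Gamma> \<Vdash> Eq b Zr \<Longrightarrow> \<Gamma> \<Vdash> Eq (times_tm a b) Zr"
  by (simp add: to_cl)

lemma times_zeroI1:
  assumes "\<Gamma> \<Vdash> Eq a Zr"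
  shows "\<Gamma> \<Vdash> Eq (times_tm a b) Zr"
proof -
  have "\<Gamma> \<Vdash> Eq (times_tm Zr b) Zr"
    by (rule ind[of \<Gamma> "Eq (times_tm Zr (Var 0)) Zr", simplified]) (simp_all add: to_cl)
  with assms show ?thesis by (simp add: to_cl)
qed

lemma times_zeroE:
  assumes A: "\<Gamma> \<Vdash> Eq (times_tm a b) Zr" and "\<And>\<Delta>. \<Gamma> \<preceq> \<Delta> \<Longrightarrow> \<Delta> \<Vdash> Eq a Zr \<Longrightarrow> \<Delta> \<Vdash> C"
    and "\<And>\<Delta>. \<Gamma> \<preceq> \<Delta> \<Longrightarrow> \<Delta> \<Vdash> Eq b Zr \<Longrightarrow> \<Delta> \<Vdash> C"
  shows "\<Gamma> \<Vdash> C"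
proof (rule zcases[of \<Gamma> b])
  fix \<Delta> k assume \<Delta>: "\<Gamma> \<preceq> \<Delta>" "\<Delta> \<Vdash> Eq b (Sc k)"
  then have "\<Delta> \<Vdash> Eq (plus_tm (times_tm a k) a) Zr" using mono[OF A \<Delta>(1)] by (simp add: to_cl)
  then have "\<Delta> \<Vdash> Eq a Zr" by (simp add: plus_zero_iff)
  then show "\<Delta> \<Vdash> C" by (rule assms(2)[OF \<Delta>(1)])
qed (rule assms(3))

lemma dist_zero_iff: "\<Gamma> \<Vdash> Eq (dist_tm s t) Zr \<longleftrightarrow> \<Gamma> \<Vdash> Eq s t"
proof
  assume "\<Gamma> \<Vdash> Eq (dist_tm s t) Zr"
  then show "\<Gamma> \<Vdash> Eq s t"
    using max_tm[of \<Gamma> s t] unfolding dist_tm_def plus_zero_iff by (simp add: to_cl)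
next
  assume "\<Gamma> \<Vdash> Eq s t"
  then show "\<Gamma> \<Vdash> Eq (dist_tm s t) Zr"
    using minus_self[of \<Gamma> t] unfolding dist_tm_def plus_zero_iff by (simp add: to_cl)
qed

section \<open>Correctness of Cantor pairing\<close>

lemma plus_cancel: "\<Gamma> \<Vdash> Eq (plus_tm x y) (plus_tm x z) \<Longrightarrow> \<Gamma> \<Vdash> Eq y z"
  using plus_minus[of \<Gamma> x y] plus_minus[of \<Gamma> x z] by (simp add: to_cl)

text \<open>\<open>diag_tm\<close> must stay at s on the whole row from \<open>tri_tm s\<close> to
  \<open>tri_tm s + s\<close>. The induction is on the position k, with the remaining distance j
  quantified. In the step, \<open>s = k + (j + 1)\<close> rules out \<open>s = k\<close>, the only
  position at which the test for the next triangular number succeeds.\<close>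

lemma diag_row:
  assumes A: "\<Gamma> \<Vdash> Eq (diag_tm (tri_tm s)) s" and s: "\<Gamma> \<Vdash> Eq s (plus_tm k j)"
  shows "\<Gamma> \<Vdash> Eq (diag_tm (plus_tm (tri_tm s) k)) s"
proof -
  let ?l = "lift_tm"
  have "\<Gamma> \<Vdash> fsub (k ## Var) (All (Imp (Eq (?l (?l s)) (plus_tm (Var 1) (Var 0)))
          (Eq (diag_tm (plus_tm (tri_tm (?l (?l s))) (Var 1))) (?l (?l s)))))"
  proof (rule ind)
    have "\<Delta> \<Vdash> Eq (diag_tm (plus_tm (tri_tm s) Zr)) s" if "\<Gamma> \<preceq> \<Delta>" for \<Delta>
      using mono[OF A that] by (simp add: to_cl)
    then show "\<Gamma> \<Vdash> fsub (Zr ## Var) (All (Imp (Eq (?l (?l s)) (plus_tm (Var 1) (Var 0)))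
          (Eq (diag_tm (plus_tm (tri_tm (?l (?l s))) (Var 1))) (?l (?l s)))))"
      by (simp add: all_iff imp_iff)
  next
    fix \<Delta> k assume \<Delta>: "\<Gamma> \<preceq> \<Delta>" and IH: "\<Delta> \<Vdash> fsub (k ## Var) (All (Imp (Eq (?l (?l s)) (plus_tm (Var 1) (Var 0)))
          (Eq (diag_tm (plus_tm (tri_tm (?l (?l s))) (Var 1))) (?l (?l s)))))"
    have "\<Phi> \<Vdash> Eq (diag_tm (plus_tm (tri_tm s) (Sc k))) s"
      if \<Phi>: "\<Delta> \<preceq> \<Phi>" and j: "\<Phi> \<Vdash> Eq s (plus_tm (Sc k) j)" for \<Phi> j
    proof -
      have "\<Phi> \<Vdash> Eq s (plus_tm k (Sc j))" using j by (simp add: to_cl)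
      then have d: "\<Phi> \<Vdash> Eq (diag_tm (plus_tm (tri_tm s) k)) s"
        using mono[OF IH \<Phi>] by (simp add: all_iff imp_iff)
      let ?d = "dist_tm (tri_tm (Sc s)) (Sc (plus_tm (tri_tm s) k))"
      show ?thesis
      proof (rule zcases[of \<Phi> ?d])
        fix \<Psi> assume l: "\<Phi> \<preceq> \<Psi>" and "\<Psi> \<Vdash> Eq ?d Zr"
        then have "\<Psi> \<Vdash> Eq (plus_tm (tri_tm s) s) (plus_tm (tri_tm s) k)"
          unfolding dist_zero_iff by (simp add: to_cl)
        then have "\<Psi> \<Vdash> Eq s k" by (rule plus_cancel)
        then have "\<Psi> \<Vdash> Eq (plus_tm k (Sc j)) (plus_tm k Zr)" using mono[OF j l] by (simp add: to_cl)
        then have "\<Psi> \<Vdash> Eq (Sc j) Zr" by (rule plus_cancel)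
        then show "\<Psi> \<Vdash> Eq (diag_tm (plus_tm (tri_tm s) (Sc k))) s" by (rule suc_nz)
      next
        fix \<Psi> i assume l: "\<Phi> \<preceq> \<Psi>" and "\<Psi> \<Vdash> Eq ?d (Sc i)"
        with mono[OF d l] show "\<Psi> \<Vdash> Eq (diag_tm (plus_tm (tri_tm s) (Sc k))) s"
          by (simp add: to_cl diag_cl)
      qed
    qed
    then show "\<Delta> \<Vdash> fsub (Sc k ## Var) (All (Imp (Eq (?l (?l s)) (plus_tm (Var 1) (Var 0)))
          (Eq (diag_tm (plus_tm (tri_tm (?l (?l s))) (Var 1))) (?l (?l s)))))"
      by (simp add: all_iff imp_iff)
  qed
  with s show ?thesis by (simp add: all_iff imp_iff)
qed

text \<open>The successor of the last number in row t is the triangular number of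
  \<open>t + 1\<close>; there the test succeeds and the counter advances.\<close>

lemma diag_tri: "\<Gamma> \<Vdash> Eq (diag_tm (tri_tm s)) s"
proof (rule ind[of \<Gamma> "Eq (diag_tm (tri_tm (Var 0))) (Var 0)", simplified])
  fix \<Delta> t assume A: "\<Delta> \<Vdash> Eq (diag_tm (tri_tm t)) t"
  have "\<Delta> \<Vdash> Eq (diag_tm (plus_tm (tri_tm t) t)) t" by (rule diag_row[OF A, of _ Zr]) (simp add: to_cl)
  moreover have "\<Delta> \<Vdash> Eq (dist_tm (Sc (plus_tm (tri_tm t) t)) (Sc (plus_tm (tri_tm t) t))) Zr"
    by (simp add: dist_zero_iff)
  ultimately show "\<Delta> \<Vdash> Eq (diag_tm (tri_tm (Sc t))) (Sc t)" by (simp add: to_cl diag_cl)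
qed (simp add: to_cl)

lemma diag_pair: "\<Gamma> \<Vdash> Eq (diag_tm (pair_tm x y)) (plus_tm x y)"
  unfolding pair_tm_def by (rule diag_row[OF diag_tri eq_refl])

lemma fst_pair: "\<Gamma> \<Vdash> Eq (fst_tm (pair_tm x y)) x"
  using diag_pair[of \<Gamma> x y] plus_minus[of \<Gamma> "tri_tm (plus_tm x y)" x]
  unfolding pair_tm_def fst_tm_def by (simp add: to_cl)

lemma snd_pair: "\<Gamma> \<Vdash> Eq (snd_tm (pair_tm x y)) y"
  using diag_pair[of \<Gamma> x y] fst_pair[of \<Gamma> x y] plus_minus[of \<Gamma> x y]
  unfolding snd_tm_def by (simp add: to_cl)

lemma pair_cl [simp]:
  "is_cl \<Gamma> X \<Longrightarrow> is_cl \<Gamma> Y \<Longrightarrow> op1 \<Gamma> fst_tm (op2 \<Gamma> pair_tm X Y) = X"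
  "is_cl \<Gamma> X \<Longrightarrow> is_cl \<Gamma> Y \<Longrightarrow> op1 \<Gamma> snd_tm (op2 \<Gamma> pair_tm X Y) = Y"
  by (auto simp: lift_cl fst_pair snd_pair del: equalityI)

section \<open>Size of codes, and lookup in the history of validity values\<close>

abbreviation le :: "tm \<Rightarrow> tm \<Rightarrow> fm" where
  "le s t \<equiv> Eq (minus_tm s t) Zr"

lemma leD: "\<Gamma> \<Vdash> le s t \<Longrightarrow> \<Gamma> \<Vdash> Eq (minus_tm t s) k \<Longrightarrow> \<Gamma> \<Vdash> Eq t (plus_tm s k)"
  using max_tm[of \<Gamma> s t] by (simp add: to_cl)

lemma le_trans:
  assumes "\<Gamma> \<Vdash> le s t" "\<Gamma> \<Vdash> le t u"
  shows "\<Gamma> \<Vdash> le s u"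
proof -
  obtain k l where "\<Gamma> \<Vdash> Eq t (plus_tm s k)" "\<Gamma> \<Vdash> Eq u (plus_tm t l)"
    using leD[OF assms(1) eq_refl] leD[OF assms(2) eq_refl] by blast
  then show ?thesis
    using plus_assoc[of \<Gamma> s k l] minus_plus[of \<Gamma> s "plus_tm k l"] by (simp add: to_cl)
qed

lemma pred_le: "\<Gamma> \<Vdash> le (pred_tm a) a"
proof (rule zcases[of \<Gamma> a])
  fix \<Delta> k assume "\<Delta> \<Vdash> Eq a (Sc k)"
  then show "\<Delta> \<Vdash> le (pred_tm a) a" using minus_self[of \<Delta> k] by (simp add: to_cl rec_cl(8))
qed (simp add: to_cl)

lemma minus_le: "\<Gamma> \<Vdash> le (minus_tm u v) u"
proof (rule ind[of \<Gamma> "le (minus_tm (lift_tm u) (Var 0)) (lift_tm u)", simplified])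
  show "\<Gamma> \<Vdash> le (minus_tm u Zr) u" using minus_self[of \<Gamma> u] by (simp add: to_cl)
next
  fix \<Delta> t assume "\<Delta> \<Vdash> le (minus_tm u t) u"
  with pred_le[of \<Delta> "minus_tm u t"] have "\<Delta> \<Vdash> le (pred_tm (minus_tm u t)) u" by (rule le_trans)
  then show "\<Delta> \<Vdash> le (minus_tm u (Sc t)) u" by (simp add: to_cl rec_cl(8))
qed

lemma diag_le: "\<Gamma> \<Vdash> le (diag_tm z) z"
proof (rule ind[of \<Gamma> "le (diag_tm (Var 0)) (Var 0)", simplified])
  fix \<Delta> t assume A: "\<Delta> \<Vdash> le (diag_tm t) t"
  let ?d = "dist_tm (tri_tm (Sc (diag_tm t))) (Sc t)"
  show "\<Delta> \<Vdash> le (diag_tm (Sc t)) (Sc t)"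
  proof (rule zcases[of \<Delta> ?d])
    fix \<Psi> assume l: "\<Delta> \<preceq> \<Psi>" and "\<Psi> \<Vdash> Eq ?d Zr"
    with mono[OF A l] show "\<Psi> \<Vdash> le (diag_tm (Sc t)) (Sc t)" by (simp add: to_cl diag_cl)
  next
    fix \<Psi> i assume l: "\<Delta> \<preceq> \<Psi>" and "\<Psi> \<Vdash> Eq ?d (Sc i)"
    with mono[OF A l] show "\<Psi> \<Vdash> le (diag_tm (Sc t)) (Sc t)" by (simp add: to_cl diag_cl rec_cl(8))
  qed
qed (simp add: to_cl)

lemma fst_le: "\<Gamma> \<Vdash> le (fst_tm u) u"
  unfolding fst_tm_def by (rule minus_le)

lemma snd_le: "\<Gamma> \<Vdash> le (snd_tm u) u"
  unfolding snd_tm_def by (rule le_trans[OF minus_le diag_le])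

text \<open>The projections give only \<le>. Strictness comes from the successor in the code of a
  tree, and it is what allows the validity of a subtree to be looked up in the history.\<close>

lemma sub_less:
  assumes "\<Gamma> \<Vdash> Eq z (Sc u)"
  shows "\<Gamma> \<Vdash> le (Sc (sub1_tm z)) z" "\<Gamma> \<Vdash> le (Sc (sub2_tm z)) z"
proof -
  have "\<Gamma> \<Vdash> le (fst_tm (snd_tm u)) u" "\<Gamma> \<Vdash> le (snd_tm (snd_tm u)) u"
    by (rule le_trans[OF fst_le snd_le] le_trans[OF snd_le snd_le])+
  with assms show "\<Gamma> \<Vdash> le (Sc (sub1_tm z)) z" "\<Gamma> \<Vdash> le (Sc (sub2_tm z)) z"
    unfolding sub1_tm_def sub2_tm_def by (simp_all add: to_cl)
qed

lemma it_comm: "\<Gamma> \<Vdash> Eq (it_tm (Sc k) h) (it_tm k (snd_tm h))"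
  by (rule ind[of \<Gamma> "Eq (it_tm (Sc (Var 0)) (lift_tm h)) (it_tm (Var 0) (snd_tm (lift_tm h)))", simplified])
    (simp_all add: to_cl)

text \<open>A tail removes the entry added last; \<open>it_comm\<close> moves one tail inside the
  iteration, where it meets that entry.\<close>

lemma it_hist: "\<Gamma> \<Vdash> Eq (it_tm k (hist_tm (plus_tm w k))) (hist_tm w)"
proof (rule ind[of \<Gamma> "Eq (it_tm (Var 0) (hist_tm (plus_tm (lift_tm w) (Var 0)))) (hist_tm (lift_tm w))", simplified])
  fix \<Delta> t assume A: "\<Delta> \<Vdash> Eq (it_tm t (hist_tm (plus_tm w t))) (hist_tm w)"
  have "\<Delta> \<Vdash> Eq (it_tm t (snd_tm (hist_tm (plus_tm w (Sc t))))) (hist_tm w)"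
    using A by (simp add: to_cl hist_cl)
  with it_comm[of \<Delta> t "hist_tm (plus_tm w (Sc t))"]
  show "\<Delta> \<Vdash> Eq (it_tm (Sc t) (hist_tm (plus_tm w (Sc t)))) (hist_tm w)" by (rule eq_trans)
qed (simp add: to_cl)

text \<open>Here \<open>z = (w + 1) + k\<close>, where k is the number of tails taken. What remains
  is the history up to and including w, with the value at w as its head.\<close>

lemma look_hist:
  assumes "\<Gamma> \<Vdash> le (Sc w) z"
  shows "\<Gamma> \<Vdash> Eq (look_tm (hist_tm z) z w) (check_tm (hist_tm w) w)"
proof -
  obtain k where k: "\<Gamma> \<Vdash> Eq (minus_tm z (Sc w)) k" "\<Gamma> \<Vdash> Eq z (plus_tm (Sc w) k)"
    using leD[OF assms eq_refl] by blast
  have "\<Gamma> \<Vdash> Eq (it_tm k (hist_tm z)) (hist_tm (Sc w))"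
    using it_hist[of \<Gamma> k "Sc w"] k(2) by (simp add: to_cl)
  with k(1) have "\<Gamma> \<Vdash> Eq (it_tm (minus_tm z (Sc w)) (hist_tm z)) (hist_tm (Sc w))"
    by (simp add: to_cl)
  then show ?thesis unfolding look_tm_def it_tm_def[symmetric] by (simp add: to_cl hist_cl)
qed

section \<open>Least computation trees\<close>

lemma none_below_mono:
  assumes "\<Gamma> \<Vdash> Eq (none_below_tm e n (plus_tm (Sc k) j)) Zr" "\<Gamma> \<Vdash> Eq (T_tm e n k) Zr"
  shows "\<Gamma> \<Vdash> C"
proof -
  let ?l = "lift_tm"
  have "\<Gamma> \<Vdash> fsub (j ## Var) (Imp (Eq (none_below_tm (?l e) (?l n) (plus_tm (Sc (?l k)) (Var 0))) Zr) Bot)"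
  proof (rule ind)
    have "\<Delta> \<Vdash> Bot" if "\<Gamma> \<preceq> \<Delta>" and *: "\<Delta> \<Vdash> Eq (none_below_tm e n (plus_tm (Sc k) Zr)) Zr" for \<Delta>
    proof -
      have "\<Delta> \<Vdash> Eq (none_below_tm e n (plus_tm (Sc k) Zr)) (Sc Zr)"
        using rec_tm(20)[of \<Delta> e n k] mono[OF assms(2) that(1)] by (simp add: to_cl)
      from eq_trans[OF eq_sym[OF this] *] show ?thesis by (rule suc_nz)
    qed
    then show "\<Gamma> \<Vdash> fsub (Zr ## Var) (Imp (Eq (none_below_tm (?l e) (?l n) (plus_tm (Sc (?l k)) (Var 0))) Zr) Bot)"
      by (simp add: imp_iff)
  next
    fix \<Delta> t assume IH: "\<Delta> \<Vdash> fsub (t ## Var) (Imp (Eq (none_below_tm (?l e) (?l n) (plus_tm (Sc (?l k)) (Var 0))) Zr) Bot)"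
    have "\<Phi> \<Vdash> Bot" if \<Phi>: "\<Delta> \<preceq> \<Phi>" and *: "\<Phi> \<Vdash> Eq (none_below_tm e n (plus_tm (Sc k) (Sc t))) Zr" for \<Phi>
    proof (rule zcases[of \<Phi> "T_tm e n (plus_tm (Sc k) t)"])
      fix \<Psi> assume l: "\<Phi> \<preceq> \<Psi>" "\<Psi> \<Vdash> Eq (T_tm e n (plus_tm (Sc k) t)) Zr"
      have "\<Psi> \<Vdash> Eq (none_below_tm e n (plus_tm (Sc k) (Sc t))) (Sc Zr)"
        using l(2) rec_tm(20)[of \<Psi> e n "plus_tm (Sc k) t"] by (simp add: to_cl)
      from eq_trans[OF eq_sym[OF this] mono[OF * l(1)]] show "\<Psi> \<Vdash> Bot" by (rule suc_nz)
    next
      fix \<Psi> i assume l: "\<Phi> \<preceq> \<Psi>" "\<Psi> \<Vdash> Eq (T_tm e n (plus_tm (Sc k) t)) (Sc i)"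
      have "\<Psi> \<Vdash> Eq (none_below_tm e n (plus_tm (Sc k) t)) Zr"
        using l(2) mono[OF * l(1)] rec_tm(20)[of \<Psi> e n "plus_tm (Sc k) t"] by (simp add: to_cl)
      with IH ext_trans[OF \<Phi> l(1)] show "\<Psi> \<Vdash> Bot" by (simp add: imp_iff)
    qed
    then show "\<Delta> \<Vdash> fsub (Sc t ## Var) (Imp (Eq (none_below_tm (?l e) (?l n) (plus_tm (Sc (?l k)) (Var 0))) Zr) Bot)"
      by (simp add: imp_iff)
  qed
  with assms(1) have "\<Gamma> \<Vdash> Bot" by (simp add: imp_iff)
  then show ?thesis by (rule botE)
qed

abbreviation least_tree :: "tm \<Rightarrow> tm \<Rightarrow> tm \<Rightarrow> fm" where
  "least_tree e n z \<equiv> And (Eq (T_tm e n z) Zr) (Eq (none_below_tm e n z) Zr)"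

text \<open>Were \<open>z = w + (k + 1)\<close>, the tree w would lie below z, against the
  minimality of z. \<open>minus_or\<close> supplies the \<open>w \<le> z\<close> that
  \<open>leD\<close> asks for.\<close>

lemma least_tree_unique_aux:
  assumes "\<Gamma> \<Vdash> least_tree e n z" "\<Gamma> \<Vdash> least_tree e n w"
  shows "\<Gamma> \<Vdash> le z w"
proof (rule zcases[of \<Gamma> "minus_tm z w"])
  fix \<Delta> k assume \<Delta>: "\<Gamma> \<preceq> \<Delta>" and k: "\<Delta> \<Vdash> Eq (minus_tm z w) (Sc k)"
  have "\<Delta> \<Vdash> le w z"
    using minus_or
  proof (rule orE)
    fix \<Phi> assume \<Phi>: "\<Delta> \<preceq> \<Phi>" "\<Phi> \<Vdash> le z w"
    from eq_trans[OF eq_sym[OF mono[OF k \<Phi>(1)]] \<Phi>(2)] show "\<Phi> \<Vdash> le w z" by (rule suc_nz)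
  qed
  then have "\<Delta> \<Vdash> Eq z (plus_tm w (Sc k))" using k by (rule leD)
  then have "\<Delta> \<Vdash> Eq (none_below_tm e n (plus_tm (Sc w) k)) Zr"
    using mono[OF assms(1) \<Delta>] by (simp add: to_cl)
  then show "\<Delta> \<Vdash> le z w" by (rule none_below_mono) (use mono[OF assms(2) \<Delta>] in simp)
qed

lemma least_tree_unique:
  assumes "\<Gamma> \<Vdash> least_tree e n z" "\<Gamma> \<Vdash> least_tree e n w"
  shows "\<Gamma> \<Vdash> Eq z w"
  using max_tm[of \<Gamma> z w] least_tree_unique_aux[OF assms] least_tree_unique_aux[OF assms(2,1)]
  by (simp add: to_cl)

lemma AppE:
  assumes "\<Gamma> \<Vdash> App e n m" and "\<And>\<Delta> z. \<Gamma> \<preceq> \<Delta> \<Longrightarrow> \<Delta> \<Vdash> least_tree e n z \<Longrightarrow> \<Delta> \<Vdash> Eq (out_tm z) m \<Longrightarrow> \<Delta> \<Vdash> C"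
  shows "\<Gamma> \<Vdash> C"
  using assms(1) unfolding App_def by (rule fm_exE) (auto intro: assms(2))

lemma AppI: "\<Gamma> \<Vdash> least_tree e n z \<Longrightarrow> \<Gamma> \<Vdash> Eq (out_tm z) m \<Longrightarrow> \<Gamma> \<Vdash> App e n m"
  unfolding App_def by (rule fm_exI[of _ z]) simp

text \<open>Uniqueness of the result rests on the minimality in the normal form alone: there is only
  one least tree, so nothing has to be known about how trees are built.\<close>

lemma App_unique:
  assumes "\<Gamma> \<Vdash> App e n m" "\<Gamma> \<Vdash> App e n m'"
  shows "\<Gamma> \<Vdash> Eq m m'"
  using assms(1)
proof (rule AppE)
  fix \<Delta> z assume \<Delta>: "\<Gamma> \<preceq> \<Delta>" "\<Delta> \<Vdash> least_tree e n z" "\<Delta> \<Vdash> Eq (out_tm z) m"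
  from mono[OF assms(2) \<Delta>(1)] show "\<Delta> \<Vdash> Eq m m'"
  proof (rule AppE)
    fix \<Phi> w assume \<Phi>: "\<Delta> \<preceq> \<Phi>" "\<Phi> \<Vdash> least_tree e n w" "\<Phi> \<Vdash> Eq (out_tm w) m'"
    with least_tree_unique[OF mono[OF \<Delta>(2) \<Phi>(1)] \<Phi>(2)] mono[OF \<Delta>(3) \<Phi>(1)]
    show "\<Phi> \<Vdash> Eq m m'" by (simp add: to_cl)
  qed
qed

text \<open>The least number principle, available intuitionistically because T is decidable: by
  induction on z, either no tree lies below z or a least one exists.\<close>

lemma least_tree_ex:
  assumes "\<Gamma> \<Vdash> Eq (T_tm e n z) Zr" and C: "\<And>\<Delta> z. \<Gamma> \<preceq> \<Delta> \<Longrightarrow> \<Delta> \<Vdash> least_tree e n z \<Longrightarrow> \<Delta> \<Vdash> C"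
  shows "\<Gamma> \<Vdash> C"
proof -
  let ?l = "lift_tm"
  let ?L = "Ex (least_tree (?l (?l e)) (?l (?l n)) (Var 0))"
  have "\<Gamma> \<Vdash> fsub (z ## Var) (Or (Eq (none_below_tm (?l e) (?l n) (Var 0)) Zr) ?L)"
  proof (rule ind)
    show "\<Gamma> \<Vdash> fsub (Zr ## Var) (Or (Eq (none_below_tm (?l e) (?l n) (Var 0)) Zr) ?L)"
      using rec_tm(19) by (simp add: orI1)
  next
    fix \<Delta> t assume IH: "\<Delta> \<Vdash> fsub (t ## Var) (Or (Eq (none_below_tm (?l e) (?l n) (Var 0)) Zr) ?L)"
    have "\<Delta> \<Vdash> Or (Eq (none_below_tm e n (Sc t)) Zr) (Ex (least_tree (?l e) (?l n) (Var 0)))" (is "_ \<Vdash> ?goal")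
    proof (rule zcases[of \<Delta> "T_tm e n t"])
      fix \<Phi> assume t: "\<Delta> \<preceq> \<Phi>" "\<Phi> \<Vdash> Eq (T_tm e n t) Zr"
      from mono[OF IH t(1)] have "\<Phi> \<Vdash> Or (Eq (none_below_tm e n t) Zr) (Ex (least_tree (?l e) (?l n) (Var 0)))" by simp
      then show "\<Phi> \<Vdash> ?goal"
      proof (rule orE)
        fix \<Psi> assume "\<Phi> \<preceq> \<Psi>" "\<Psi> \<Vdash> Eq (none_below_tm e n t) Zr"
        with mono[OF t(2)] show "\<Psi> \<Vdash> ?goal" by (intro orI2 fm_exI[of _ t]) simp
      qed (rule orI2)
    next
      fix \<Phi> i assume t: "\<Delta> \<preceq> \<Phi>" "\<Phi> \<Vdash> Eq (T_tm e n t) (Sc i)"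
      from mono[OF IH t(1)] have "\<Phi> \<Vdash> Or (Eq (none_below_tm e n t) Zr) (Ex (least_tree (?l e) (?l n) (Var 0)))" by simp
      then show "\<Phi> \<Vdash> ?goal"
      proof (rule orE)
        fix \<Psi> assume l: "\<Phi> \<preceq> \<Psi>" "\<Psi> \<Vdash> Eq (none_below_tm e n t) Zr"
        with mono[OF t(2) l(1)] rec_tm(20)[of \<Psi> e n t] show "\<Psi> \<Vdash> ?goal" by (intro orI1) (simp add: to_cl)
      qed (rule orI2)
    qed
    then show "\<Delta> \<Vdash> fsub (Sc t ## Var) (Or (Eq (none_below_tm (?l e) (?l n) (Var 0)) Zr) ?L)" by simp
  qed
  then have "\<Gamma> \<Vdash> Or (Eq (none_below_tm e n z) Zr) (Ex (least_tree (?l e) (?l n) (Var 0)))" by simp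
  then show ?thesis
  proof (rule orE)
    fix \<Delta> assume "\<Gamma> \<preceq> \<Delta>" "\<Delta> \<Vdash> Eq (none_below_tm e n z) Zr"
    with mono[OF assms(1)] show "\<Delta> \<Vdash> C" by (intro C) auto
  next
    fix \<Delta> assume \<Delta>: "\<Gamma> \<preceq> \<Delta>" "\<Delta> \<Vdash> Ex (least_tree (?l e) (?l n) (Var 0))"
    from \<Delta>(2) show "\<Delta> \<Vdash> C" by (rule fm_exE) (use ext_trans[OF \<Delta>(1)] C in auto)
  qed
qed

subsection \<open>Kleene application\<close>

abbreviation vld :: "tm \<Rightarrow> tm" where
  "vld z \<equiv> check_tm (hist_tm z) z"

lemma T_zero_iff:
  "\<Gamma> \<Vdash> Eq (T_tm e n z) Zr \<longleftrightarrow> \<Gamma> \<Vdash> Eq (vld z) Zr \<and> \<Gamma> \<Vdash> Eq (ix_tm z) e \<and> \<Gamma> \<Vdash> Eq (in_tm z) n"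
  by (simp add: T_tm_def plus_zero_iff dist_zero_iff)

lemma proves_zero_iff:
  "\<Gamma> \<Vdash> Eq (proves_tm h z w e n m) Zr \<longleftrightarrow>
    \<Gamma> \<Vdash> Eq (look_tm h z w) Zr \<and> \<Gamma> \<Vdash> Eq (ix_tm w) e \<and> \<Gamma> \<Vdash> Eq (in_tm w) n \<and> \<Gamma> \<Vdash> Eq (out_tm w) m"
  by (simp add: proves_tm_def plus_zero_iff dist_zero_iff)

text \<open>\<open>check_tm\<close> gives 0 the value 1, so a valid code is a successor and its
  validity comes from a rule.\<close>

lemma vldE:
  assumes A: "\<Gamma> \<Vdash> Eq (vld z) Zr"
    and C: "\<And>\<Delta> u. \<Gamma> \<preceq> \<Delta> \<Longrightarrow> \<Delta> \<Vdash> Eq z (Sc u) \<Longrightarrow> \<Delta> \<Vdash> Eq (rule_tm (hist_tm z) z) Zr \<Longrightarrow> \<Delta> \<Vdash> C"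
  shows "\<Gamma> \<Vdash> C"
proof (rule zcases[of \<Gamma> z])
  fix \<Delta> assume \<Delta>: "\<Gamma> \<preceq> \<Delta>" "\<Delta> \<Vdash> Eq z Zr"
  have "\<Delta> \<Vdash> Eq (vld z) (Sc Zr)" unfolding check_tm_def using \<Delta>(2) by (simp add: to_cl)
  from eq_trans[OF eq_sym[OF this] mono[OF A \<Delta>(1)]] show "\<Delta> \<Vdash> C" by (rule suc_nz)
next
  fix \<Delta> k assume \<Delta>: "\<Gamma> \<preceq> \<Delta>" "\<Delta> \<Vdash> Eq z (Sc k)"
  have "\<Delta> \<Vdash> Eq (vld z) (rule_tm (hist_tm z) z)" unfolding check_tm_def using \<Delta>(2) by (simp add: to_cl)
  from eq_trans[OF eq_sym[OF this] mono[OF A \<Delta>(1)]] show "\<Delta> \<Vdash> C" by (rule C[OF \<Delta>])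
qed

lemma vldI: "\<Gamma> \<Vdash> Eq (rule_tm (hist_tm (Sc u)) (Sc u)) Zr \<Longrightarrow> \<Gamma> \<Vdash> Eq (vld (Sc u)) Zr"
  unfolding check_tm_def by (simp add: to_cl)

section \<open>Inversion and introduction for single computation rules\<close>

lemma num_neq: "i \<noteq> j \<Longrightarrow> \<Gamma> \<Vdash> Eq (num_tm i) (num_tm j) \<Longrightarrow> \<Gamma> \<Vdash> C"
proof (induction i arbitrary: j)
  case 0
  then show ?case by (cases j) (auto intro: suc_nz eq_sym)
next
  case (Suc i)
  then show ?case by (cases j) (auto simp: suc_inj intro: suc_nz)
qed

abbreviation tag_fact :: "tm \<Rightarrow> nat \<Rightarrow> tm \<Rightarrow> tm" where
  "tag_fact e j t \<equiv> plus_tm (dist_tm (fst_tm e) (num_tm j)) t"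

lemma tag_neq:
  assumes "\<Gamma> \<Vdash> Eq (fst_tm e) (num_tm i)" "i \<noteq> j" "\<Gamma> \<Vdash> Eq (tag_fact e j t) Zr"
  shows "\<Gamma> \<Vdash> C"
proof -
  have "\<Gamma> \<Vdash> Eq (fst_tm e) (num_tm j)" using assms(3) by (simp add: plus_zero_iff dist_zero_iff)
  from eq_trans[OF eq_sym[OF assms(1)] this] show ?thesis by (rule num_neq[OF assms(2)])
qed

lemma tag_skip:
  assumes "\<Gamma> \<Vdash> Eq (fst_tm e) (num_tm i)" "i \<noteq> j" "\<Gamma> \<Vdash> Eq (times_tm (tag_fact e j t) b) Zr"
  shows "\<Gamma> \<Vdash> Eq b Zr"
  using assms(3) by (rule times_zeroE) (auto intro: tag_neq[OF mono[OF assms(1)] assms(2)])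

lemma tag_hit:
  assumes "\<Gamma> \<Vdash> Eq (times_tm (tag_fact e i t) b) Zr"
    and "\<And>\<Delta>. \<Gamma> \<preceq> \<Delta> \<Longrightarrow> \<Delta> \<Vdash> Eq b Zr \<Longrightarrow> \<Delta> \<Vdash> Eq t Zr"
  shows "\<Gamma> \<Vdash> Eq t Zr"
  using assms(1) by (rule times_zeroE) (auto simp: plus_zero_iff intro: assms(2))

text \<open>8 is the least tag that no rule mentions. This is why \<open>empty_ix\<close> carries
  it.\<close>

lemma rule_tag8:
  assumes "\<Gamma> \<Vdash> Eq (rule_tm h z) Zr" and e: "\<Gamma> \<Vdash> Eq (fst_tm (ix_tm z)) (num_tm 8)"
  shows "\<Gamma> \<Vdash> C"
  by (rule tag_neq[OF e _ tag_skip[OF e _ tag_skip[OF e _ tag_skip[OF e _ tag_skip[OF e _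
    tag_skip[OF e _ tag_skip[OF e _ tag_skip[OF e _ assms(1)[unfolded rule_tm_def Let_def]]]]]]]]]) simp_all

lemma rule_tag0:
  assumes "\<Gamma> \<Vdash> Eq (rule_tm h z) Zr" and e: "\<Gamma> \<Vdash> Eq (fst_tm (ix_tm z)) (num_tm 0)"
  shows "\<Gamma> \<Vdash> Eq (out_tm z) (fst_tm (snd_tm (ix_tm z)))"
proof -
  have "\<Gamma> \<Vdash> Eq (dist_tm (out_tm z) (fst_tm (snd_tm (ix_tm z)))) Zr"
    using assms(1)[unfolded rule_tm_def Let_def]
  proof (rule tag_hit)
    fix \<Delta> assume "\<Gamma> \<preceq> \<Delta>"
    then have e: "\<Delta> \<Vdash> Eq (fst_tm (ix_tm z)) (num_tm 0)" by (rule mono[OF e])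
    \<comment> \<open>The remaining alternatives demand tags 1 to 7 and are refuted one after the
      other; their contents \<open>a1\<close> to \<open>a7\<close> do not matter.\<close>
    show "\<Delta> \<Vdash> C" if a: "\<Delta> \<Vdash> Eq (times_tm (tag_fact (ix_tm z) 1 a1) (times_tm (tag_fact (ix_tm z) 2 a2)
      (times_tm (tag_fact (ix_tm z) 3 a3) (times_tm (tag_fact (ix_tm z) 4 a4) (times_tm (tag_fact (ix_tm z) 5 a5)
      (times_tm (tag_fact (ix_tm z) 6 a6) (tag_fact (ix_tm z) 7 a7))))))) Zr" for a1 a2 a3 a4 a5 a6 a7 C
      by (rule tag_neq[OF e _ tag_skip[OF e _ tag_skip[OF e _ tag_skip[OF e _
        tag_skip[OF e _ tag_skip[OF e _ tag_skip[OF e _ a]]]]]]]) simp_all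
  qed
  then show ?thesis by (simp add: dist_zero_iff)
qed

lemma rule_tag5:
  fixes z
  defines "e \<equiv> ix_tm z"
  assumes "\<Gamma> \<Vdash> Eq (rule_tm h z) Zr" and e: "\<Gamma> \<Vdash> Eq (fst_tm e) (num_tm 5)"
  shows "\<Gamma> \<Vdash> Eq (proves_tm h z (sub1_tm z) (snd_tm (snd_tm e)) (in_tm z) (out_tm (sub1_tm z))) Zr"
    and "\<Gamma> \<Vdash> Eq (proves_tm h z (sub2_tm z) (fst_tm (snd_tm e)) (out_tm (sub1_tm z)) (out_tm z)) Zr"
proof -
  have "\<Gamma> \<Vdash> Eq (plus_tm (proves_tm h z (sub1_tm z) (snd_tm (snd_tm e)) (in_tm z) (out_tm (sub1_tm z)))
      (proves_tm h z (sub2_tm z) (fst_tm (snd_tm e)) (out_tm (sub1_tm z)) (out_tm z))) Zr"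
  proof (rule tag_hit)
    \<comment> \<open>This is what is left of the rule disjunction once tags 0 to 4 are discarded.
      It is spelled out so that rule 5 stands at its head.\<close>
    show "\<Gamma> \<Vdash> Eq (times_tm (tag_fact e 5 (plus_tm (proves_tm h z (sub1_tm z) (snd_tm (snd_tm e)) (in_tm z) (out_tm (sub1_tm z)))
      (proves_tm h z (sub2_tm z) (fst_tm (snd_tm e)) (out_tm (sub1_tm z)) (out_tm z))))
       (times_tm (tag_fact e 6 (cond_tm (snd_tm (in_tm z))
                    (proves_tm h z (sub1_tm z) (fst_tm (snd_tm e)) (fst_tm (in_tm z)) (out_tm z))
                    (plus_tm (proves_tm h z (sub1_tm z) e (pair_tm (fst_tm (in_tm z)) (pred_tm (snd_tm (in_tm z)))) (out_tm (sub1_tm z)))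
                      (proves_tm h z (sub2_tm z) (snd_tm (snd_tm e)) (pair_tm (pair_tm (fst_tm (in_tm z)) (pred_tm (snd_tm (in_tm z)))) (out_tm (sub1_tm z))) (out_tm z)))))
                 (tag_fact e 7 (plus_tm (proves_tm h z (sub1_tm z) (fst_tm (snd_tm e)) (in_tm z) (out_tm (sub1_tm z)))
                    (cond_tm (out_tm (sub1_tm z))
                      (dist_tm (out_tm z) (snd_tm (in_tm z)))
                      (proves_tm h z (sub2_tm z) e (pair_tm (fst_tm (in_tm z)) (Sc (snd_tm (in_tm z)))) (out_tm z))))))) Zr"
      by (rule tag_skip[OF e _ tag_skip[OF e _ tag_skip[OF e _ tag_skip[OF e _
        tag_skip[OF e _ assms(2)[unfolded rule_tm_def Let_def, folded e_def]]]]]]) simp_all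
  next
    fix \<Delta> assume "\<Gamma> \<preceq> \<Delta>"
    then have e: "\<Delta> \<Vdash> Eq (fst_tm e) (num_tm 5)" by (rule mono[OF e])
    show "\<Delta> \<Vdash> C" if a: "\<Delta> \<Vdash> Eq (times_tm (tag_fact e 6 a6) (tag_fact e 7 a7)) Zr" for a6 a7 C
      by (rule tag_neq[OF e _ tag_skip[OF e _ a]]) simp_all
  qed
  then show "\<Gamma> \<Vdash> Eq (proves_tm h z (sub1_tm z) (snd_tm (snd_tm e)) (in_tm z) (out_tm (sub1_tm z))) Zr"
    and "\<Gamma> \<Vdash> Eq (proves_tm h z (sub2_tm z) (fst_tm (snd_tm e)) (out_tm (sub1_tm z)) (out_tm z)) Zr"
    by (simp_all add: plus_zero_iff)
qed

lemma rule_tag0I: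
  assumes "\<Gamma> \<Vdash> Eq (fst_tm (ix_tm z)) (num_tm 0)" "\<Gamma> \<Vdash> Eq (out_tm z) (fst_tm (snd_tm (ix_tm z)))"
  shows "\<Gamma> \<Vdash> Eq (rule_tm h z) Zr"
  unfolding rule_tm_def Let_def
  by (rule times_zeroI1) (use assms in \<open>simp add: plus_zero_iff dist_zero_iff\<close>)

lemma rule_tag5I:
  fixes z
  defines "e \<equiv> ix_tm z"
  assumes "\<Gamma> \<Vdash> Eq (fst_tm e) (num_tm 5)"
    and "\<Gamma> \<Vdash> Eq (proves_tm h z (sub1_tm z) (snd_tm (snd_tm e)) (in_tm z) (out_tm (sub1_tm z))) Zr"
    and "\<Gamma> \<Vdash> Eq (proves_tm h z (sub2_tm z) (fst_tm (snd_tm e)) (out_tm (sub1_tm z)) (out_tm z)) Zr"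
  shows "\<Gamma> \<Vdash> Eq (rule_tm h z) Zr"
  unfolding rule_tm_def Let_def e_def[symmetric]
  by (rule times_zeroI2, rule times_zeroI2, rule times_zeroI2, rule times_zeroI2, rule times_zeroI2, rule times_zeroI1)
    (use assms(2-) in \<open>simp add: plus_zero_iff dist_zero_iff\<close>)

definition tree_tm :: "tm \<Rightarrow> tm \<Rightarrow> tm \<Rightarrow> tm \<Rightarrow> tm \<Rightarrow> tm" where
  "tree_tm e n m w1 w2 = Sc (pair_tm (pair_tm e (pair_tm n m)) (pair_tm w1 w2))"

lemma tree_sel:
  "\<Gamma> \<Vdash> Eq (ix_tm (tree_tm e n m w1 w2)) e"
  "\<Gamma> \<Vdash> Eq (in_tm (tree_tm e n m w1 w2)) n"
  "\<Gamma> \<Vdash> Eq (out_tm (tree_tm e n m w1 w2)) m"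
  "\<Gamma> \<Vdash> Eq (sub1_tm (tree_tm e n m w1 w2)) w1"
  "\<Gamma> \<Vdash> Eq (sub2_tm (tree_tm e n m w1 w2)) w2"
  unfolding ix_tm_def in_tm_def out_tm_def sub1_tm_def sub2_tm_def tree_tm_def
  by (simp_all add: to_cl)

lemma tree_vldI: "\<Gamma> \<Vdash> Eq (rule_tm (hist_tm (tree_tm e n m w1 w2)) (tree_tm e n m w1 w2)) Zr
    \<Longrightarrow> \<Gamma> \<Vdash> Eq (vld (tree_tm e n m w1 w2)) Zr"
  unfolding tree_tm_def by (rule vldI)

lemma tree_look:
  "\<Gamma> \<Vdash> Eq (look_tm (hist_tm (tree_tm e n m w1 w2)) (tree_tm e n m w1 w2) (sub1_tm (tree_tm e n m w1 w2))) (vld w1)"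
  "\<Gamma> \<Vdash> Eq (look_tm (hist_tm (tree_tm e n m w1 w2)) (tree_tm e n m w1 w2) (sub2_tm (tree_tm e n m w1 w2))) (vld w2)"
proof -
  let ?z = "tree_tm e n m w1 w2"
  have z: "\<Gamma> \<Vdash> Eq ?z (Sc (pair_tm (pair_tm e (pair_tm n m)) (pair_tm w1 w2)))"
    unfolding tree_tm_def by simp
  have "\<Gamma> \<Vdash> Eq (vld (sub1_tm ?z)) (vld w1)" "\<Gamma> \<Vdash> Eq (vld (sub2_tm ?z)) (vld w2)"
    using tree_sel(4,5)[of \<Gamma> e n m w1 w2] by (simp_all add: to_cl)
  then show "\<Gamma> \<Vdash> Eq (look_tm (hist_tm ?z) ?z (sub1_tm ?z)) (vld w1)" "\<Gamma> \<Vdash> Eq (look_tm (hist_tm ?z) ?z (sub2_tm ?z)) (vld w2)"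
    using look_hist[OF sub_less(1)[OF z]] look_hist[OF sub_less(2)[OF z]] by (blast intro: eq_trans)+
qed

text \<open>
  \<open>ECT\<close> yields indices with prescribed values but never controls where they are undefined. The index
  \<open>dom_ix b c\<close>, computing \<open>c\<close> exactly on the domain of \<open>b\<close>, and the index of the empty function have to
  be exhibited. Taking \<open>c\<close> constant makes all computation trees of \<open>dom_ix b c\<close> agree in their result,
  which spares a proof that computations are deterministic.
\<close>

definition const_ix :: "tm \<Rightarrow> tm" where
  "const_ix c = pair_tm Zr (pair_tm c Zr)"

definition dom_ix :: "tm \<Rightarrow> tm \<Rightarrow> tm" where
  "dom_ix b c = pair_tm (num_tm 5) (pair_tm (const_ix c) b)"

definition empty_ix :: tm where
  "empty_ix = pair_tm (num_tm 8) Zr"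

lemma tsub_ix [simp]: "tsub \<sigma> (const_ix c) = const_ix (tsub \<sigma> c)"
  "tsub \<sigma> (dom_ix b c) = dom_ix (tsub \<sigma> b) (tsub \<sigma> c)" "tsub \<sigma> empty_ix = empty_ix"
  by (simp_all add: const_ix_def dom_ix_def empty_ix_def del: num_tm.simps)

lemma ix_sel:
  "\<Gamma> \<Vdash> Eq i (const_ix c) \<Longrightarrow> \<Gamma> \<Vdash> Eq (fst_tm i) (num_tm 0)"
  "\<Gamma> \<Vdash> Eq i (const_ix c) \<Longrightarrow> \<Gamma> \<Vdash> Eq (fst_tm (snd_tm i)) c"
  "\<Gamma> \<Vdash> Eq i (dom_ix b c) \<Longrightarrow> \<Gamma> \<Vdash> Eq (fst_tm i) (num_tm 5)"
  "\<Gamma> \<Vdash> Eq i (dom_ix b c) \<Longrightarrow> \<Gamma> \<Vdash> Eq (fst_tm (snd_tm i)) (const_ix c)"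
  "\<Gamma> \<Vdash> Eq i (dom_ix b c) \<Longrightarrow> \<Gamma> \<Vdash> Eq (snd_tm (snd_tm i)) b"
  "\<Gamma> \<Vdash> Eq i empty_ix \<Longrightarrow> \<Gamma> \<Vdash> Eq (fst_tm i) (num_tm 8)"
  unfolding const_ix_def dom_ix_def empty_ix_def by (simp_all add: to_cl)

lemma const_out:
  assumes "\<Gamma> \<Vdash> Eq (vld z) Zr" "\<Gamma> \<Vdash> Eq (ix_tm z) (const_ix c)"
  shows "\<Gamma> \<Vdash> Eq (out_tm z) c"
  using assms(1)
proof (rule vldE)
  fix \<Delta> u assume \<Delta>: "\<Gamma> \<preceq> \<Delta>" "\<Delta> \<Vdash> Eq (rule_tm (hist_tm z) z) Zr"
  note i = mono[OF assms(2) \<Delta>(1)]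
  show "\<Delta> \<Vdash> Eq (out_tm z) c"
    by (rule eq_trans[OF rule_tag0[OF \<Delta>(2) ix_sel(1)[OF i]] ix_sel(2)[OF i]])
qed

text \<open>Rule 0 has no premises, so both subtrees are the dummy 0.\<close>

lemma const_tree: "\<Gamma> \<Vdash> Eq (T_tm (const_ix c) n (tree_tm (const_ix c) n c Zr Zr)) Zr"
proof -
  let ?z = "tree_tm (const_ix c) n c Zr Zr"
  note i = tree_sel(1)[of \<Gamma> "const_ix c" n c Zr Zr]
  have "\<Gamma> \<Vdash> Eq (vld ?z) Zr"
    by (intro tree_vldI rule_tag0I ix_sel(1)[OF i] eq_trans[OF tree_sel(3) eq_sym[OF ix_sel(2)[OF i]]])
  then show ?thesis by (simp add: T_zero_iff tree_sel)
qed

lemma const_App: "\<Gamma> \<Vdash> App (const_ix c) n c"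
  using const_tree
proof (rule least_tree_ex)
  fix \<Delta> z assume *: "\<Delta> \<Vdash> least_tree (const_ix c) n z"
  \<comment> \<open>The least tree need not be the one exhibited, but \<open>const_out\<close>
    determines the result of every valid tree.\<close>
  show "\<Delta> \<Vdash> App (const_ix c) n c"
    using * by (rule AppI) (use * in \<open>auto simp: T_zero_iff intro: const_out\<close>)
qed

lemma empty_App:
  assumes "\<Gamma> \<Vdash> App empty_ix n m"
  shows "\<Gamma> \<Vdash> C"
  using assms
proof (rule AppE)
  fix \<Delta> z assume "\<Delta> \<Vdash> least_tree empty_ix n z"
  then have *: "\<Delta> \<Vdash> Eq (vld z) Zr" "\<Delta> \<Vdash> Eq (ix_tm z) empty_ix" by (auto simp: T_zero_iff)
  from *(1) show "\<Delta> \<Vdash> C"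
    by (rule vldE) (auto intro: rule_tag8 ix_sel(6) mono[OF *(2)])
qed

text \<open>In rule 5 the first subtree computes \<open>bn\<close> and the second applies the
  constant function to its result. The first contributes the definedness of b, the second the value
  c.\<close>

lemma dom_T:
  assumes "\<Gamma> \<Vdash> Eq (T_tm (dom_ix b c) n z) Zr"
  shows "\<Gamma> \<Vdash> And (Eq (out_tm z) c) (Eq (T_tm b n (sub1_tm z)) Zr)"
proof -
  have *: "\<Gamma> \<Vdash> Eq (vld z) Zr" "\<Gamma> \<Vdash> Eq (ix_tm z) (dom_ix b c)" "\<Gamma> \<Vdash> Eq (in_tm z) n"
    using assms by (auto simp: T_zero_iff)
  from *(1) show ?thesis
  proof (rule vldE)
    fix \<Delta> u assume \<Delta>: "\<Gamma> \<preceq> \<Delta>" "\<Delta> \<Vdash> Eq z (Sc u)" "\<Delta> \<Vdash> Eq (rule_tm (hist_tm z) z) Zr"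
    note i = *(2,3)[THEN mono, OF \<Delta>(1)]
    note p = rule_tag5[OF \<Delta>(3) ix_sel(3)[OF i(1)], unfolded proves_zero_iff]
    note l = look_hist[OF sub_less(1)[OF \<Delta>(2)]] look_hist[OF sub_less(2)[OF \<Delta>(2)]]
    have "\<Delta> \<Vdash> Eq (vld (sub1_tm z)) Zr" "\<Delta> \<Vdash> Eq (vld (sub2_tm z)) Zr"
      using p l by (blast intro: eq_trans eq_sym)+
    moreover have "\<Delta> \<Vdash> Eq (ix_tm (sub2_tm z)) (const_ix c)"
      using p(2) ix_sel(4)[OF i(1)] by (blast intro: eq_trans)
    ultimately have "\<Delta> \<Vdash> Eq (out_tm (sub2_tm z)) c" by (intro const_out)
    with p(2) have "\<Delta> \<Vdash> Eq (out_tm z) c" by (blast intro: eq_trans eq_sym)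
    moreover have "\<Delta> \<Vdash> Eq (ix_tm (sub1_tm z)) b" "\<Delta> \<Vdash> Eq (in_tm (sub1_tm z)) n"
      using p(1) ix_sel(5)[OF i(1)] i(2) by (blast intro: eq_trans)+
    ultimately show "\<Delta> \<Vdash> And (Eq (out_tm z) c) (Eq (T_tm b n (sub1_tm z)) Zr)"
      using \<open>\<Delta> \<Vdash> Eq (vld (sub1_tm z)) Zr\<close> by (simp add: T_zero_iff)
  qed
qed

lemma dom_tree:
  assumes "\<Gamma> \<Vdash> Eq (T_tm b n w) Zr"
  shows "\<Gamma> \<Vdash> Eq (T_tm (dom_ix b c) n (tree_tm (dom_ix b c) n c w (tree_tm (const_ix c) (out_tm w) c Zr Zr))) Zr"
proof -
  let ?v = "tree_tm (const_ix c) (out_tm w) c Zr Zr"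
  let ?z = "tree_tm (dom_ix b c) n c w ?v"
  have w: "\<Gamma> \<Vdash> Eq (vld w) Zr" "\<Gamma> \<Vdash> Eq (ix_tm w) b" "\<Gamma> \<Vdash> Eq (in_tm w) n"
    using assms by (auto simp: T_zero_iff)
  have v: "\<Gamma> \<Vdash> Eq (vld ?v) Zr"
    using const_tree[of \<Gamma> c "out_tm w"] by (simp add: T_zero_iff)
  note i = tree_sel(1)[of \<Gamma> "dom_ix b c" n c w ?v]
  note s = tree_sel[of \<Gamma> "dom_ix b c" n c w ?v]
  note sv = tree_sel[of \<Gamma> "const_ix c" "out_tm w" c Zr Zr]
  \<comment> \<open>The subtrees read off from \<open>?z\<close> are only provably equal to
    \<open>w\<close> and \<open>?v\<close>, so the equality has to be carried through each
    selector.\<close>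
  have *: "\<Gamma> \<Vdash> Eq (f (sub1_tm ?z)) (f w)" "\<Gamma> \<Vdash> Eq (f (sub2_tm ?z)) (f ?v)"
    if "\<And>\<sigma> s. tsub \<sigma> (f s) = f (tsub \<sigma> s)" for f
    using s(4,5) op1_cl(1)[OF that] by (simp_all add: eq_cl)
  note ** = *[of ix_tm, OF tsub_tree(1)] *[of in_tm, OF tsub_tree(2)] *[of out_tm, OF tsub_tree(3)]
  have "\<Gamma> \<Vdash> Eq (vld ?z) Zr"
  proof (intro tree_vldI rule_tag5I ix_sel(3)[OF i])
    show "\<Gamma> \<Vdash> Eq (proves_tm (hist_tm ?z) ?z (sub1_tm ?z) (snd_tm (snd_tm (ix_tm ?z))) (in_tm ?z) (out_tm (sub1_tm ?z))) Zr"
      unfolding proves_zero_iff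
      by (intro conjI eq_trans[OF tree_look(1) w(1)] eq_trans[OF **(1) eq_trans[OF w(2) eq_sym[OF ix_sel(5)[OF i]]]]
          eq_trans[OF **(3) eq_trans[OF w(3) eq_sym[OF s(2)]]] eq_refl)
    show "\<Gamma> \<Vdash> Eq (proves_tm (hist_tm ?z) ?z (sub2_tm ?z) (fst_tm (snd_tm (ix_tm ?z))) (out_tm (sub1_tm ?z)) (out_tm ?z)) Zr"
      unfolding proves_zero_iff
      by (intro conjI eq_trans[OF tree_look(2) v] eq_trans[OF **(2) eq_trans[OF sv(1) eq_sym[OF ix_sel(4)[OF i]]]]
          eq_trans[OF **(4) eq_trans[OF sv(2) eq_sym[OF **(5)]]] eq_trans[OF **(6) eq_trans[OF sv(3) eq_sym[OF s(3)]]])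
  qed
  then show ?thesis by (simp add: T_zero_iff tree_sel)
qed

lemma defdI: "\<Gamma> \<Vdash> App e n m \<Longrightarrow> \<Gamma> \<Vdash> defd e n"
  unfolding defd_def by (rule fm_exI[of _ m]) simp

lemma defdE:
  assumes "\<Gamma> \<Vdash> defd e n" and "\<And>\<Delta> m. \<Gamma> \<preceq> \<Delta> \<Longrightarrow> \<Delta> \<Vdash> App e n m \<Longrightarrow> \<Delta> \<Vdash> C"
  shows "\<Gamma> \<Vdash> C"
  using assms(1) unfolding defd_def by (rule fm_exE) (auto intro: assms(2))

text \<open>Definedness passes through the existence of some tree in each direction, the value
  through \<open>dom_T\<close>; the least trees of the two indices need not correspond.\<close>

lemma dom_App_iff: "\<Gamma> \<Vdash> App (dom_ix b c) n m \<longleftrightarrow> \<Gamma> \<Vdash> Eq m c \<and> \<Gamma> \<Vdash> defd b n"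
proof
  assume "\<Gamma> \<Vdash> App (dom_ix b c) n m"
  then have "\<Gamma> \<Vdash> And (Eq m c) (defd b n)"
  proof (rule AppE)
    fix \<Delta> z assume \<Delta>: "\<Delta> \<Vdash> least_tree (dom_ix b c) n z" "\<Delta> \<Vdash> Eq (out_tm z) m"
    then have T: "\<Delta> \<Vdash> And (Eq (out_tm z) c) (Eq (T_tm b n (sub1_tm z)) Zr)" by (intro dom_T) simp
    then have "\<Delta> \<Vdash> Eq (T_tm b n (sub1_tm z)) Zr" by simp
    then have "\<Delta> \<Vdash> defd b n"
      by (rule least_tree_ex) (auto intro!: defdI AppI)
    moreover from T \<Delta>(2) have "\<Delta> \<Vdash> Eq m c" by (auto intro: eq_trans eq_sym)
    ultimately show "\<Delta> \<Vdash> And (Eq m c) (defd b n)" by simp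
  qed
  then show "\<Gamma> \<Vdash> Eq m c \<and> \<Gamma> \<Vdash> defd b n" by simp
next
  assume A: "\<Gamma> \<Vdash> Eq m c \<and> \<Gamma> \<Vdash> defd b n"
  then have "\<Gamma> \<Vdash> defd b n" by simp
  then show "\<Gamma> \<Vdash> App (dom_ix b c) n m"
  proof (rule defdE)
    fix \<Delta> k assume \<Delta>: "\<Gamma> \<preceq> \<Delta>" "\<Delta> \<Vdash> App b n k"
    have m: "\<Delta> \<Vdash> Eq m c" using A \<Delta>(1) by (auto intro: mono)
    from \<Delta>(2) show "\<Delta> \<Vdash> App (dom_ix b c) n m"
    proof (rule AppE)
      fix \<Phi> w assume \<Phi>: "\<Delta> \<preceq> \<Phi>" "\<Phi> \<Vdash> least_tree b n w"
      then have "\<Phi> \<Vdash> Eq (T_tm b n w) Zr" by simp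
      from dom_tree[OF this] show "\<Phi> \<Vdash> App (dom_ix b c) n m"
      proof (rule least_tree_ex)
        fix \<Psi> z assume l: "\<Phi> \<preceq> \<Psi>" "\<Psi> \<Vdash> least_tree (dom_ix b c) n z"
        then have "\<Psi> \<Vdash> And (Eq (out_tm z) c) (Eq (T_tm b n (sub1_tm z)) Zr)" by (intro dom_T) simp
        then have "\<Psi> \<Vdash> Eq (out_tm z) m"
          using mono[OF mono[OF m \<Phi>(1)] l(1)] by (auto intro: eq_trans eq_sym)
        with l(2) show "\<Psi> \<Vdash> App (dom_ix b c) n m" by (rule AppI)
      qed
    qed
  qed
qed

subsection \<open>Meaningful conditions\<close>

text \<open>The T predicate, minimality and result extraction are all terms, so \<open>App\<close>
  is a single \<exists> in front of equations.\<close>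

lemma almost_negative_App: "almost_negative (App e n m)"
  unfolding App_def by (intro almost_negative.intros(1) sigma1.intros qfree.intros)

lemma apE:
  assumes "\<Gamma> \<Vdash> ap e n A" and "\<And>\<Delta> m. \<Gamma> \<preceq> \<Delta> \<Longrightarrow> \<Delta> \<Vdash> App e n m \<Longrightarrow> \<Delta> \<Vdash> fsub (m ## Var) A \<Longrightarrow> \<Delta> \<Vdash> C"
  shows "\<Gamma> \<Vdash> C"
  using assms(1) unfolding ap_def by (rule fm_exE) (auto intro: assms(2))

lemma ap_iff:
  assumes "\<Gamma> \<Vdash> App e n m"
  shows "\<Gamma> \<Vdash> ap e n A \<longleftrightarrow> \<Gamma> \<Vdash> fsub (m ## Var) A"
proof
  assume "\<Gamma> \<Vdash> ap e n A"
  then show "\<Gamma> \<Vdash> fsub (m ## Var) A"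
  proof (rule apE)
    fix \<Delta> k assume \<Delta>: "\<Gamma> \<preceq> \<Delta>" "\<Delta> \<Vdash> App e n k" "\<Delta> \<Vdash> fsub (k ## Var) A"
    from App_unique[OF \<Delta>(2) mono[OF assms \<Delta>(1)]] \<Delta>(3) show "\<Delta> \<Vdash> fsub (m ## Var) A"
      by (simp add: eq_fsub)
  qed
next
  assume "\<Gamma> \<Vdash> fsub (m ## Var) A"
  with assms show "\<Gamma> \<Vdash> ap e n A" unfolding ap_def by (intro fm_exI[of _ m]) simp
qed

lemma defd_of_ap: "\<Gamma> \<Vdash> ap e n A \<Longrightarrow> \<Gamma> \<Vdash> defd e n"
  by (erule apE) (rule defdI)

text \<open>The matrix that \<open>Ex\<close> and \<open>ap\<close> need for a relation \<psi>(n, m)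
  at a fixed n: the bound m stays at index 0.\<close>

abbreviation under :: "tm \<Rightarrow> fm \<Rightarrow> fm" where
  "under n \<psi> \<equiv> fsub (Var 0 ## tsub (\<lambda>i. Var (Suc i)) n ## (\<lambda>i. Var (Suc i))) \<psi>"

lemma ect:
  assumes "almost_negative \<phi>"
    and "\<And>\<Delta> n. \<Gamma> \<preceq> \<Delta> \<Longrightarrow> \<Delta> \<Vdash> fsub (n ## Var) \<phi> \<Longrightarrow> \<Delta> \<Vdash> Ex (under n \<psi>)"
    and C: "\<And>\<Delta> e. \<Gamma> \<preceq> \<Delta> \<Longrightarrow> (\<And>\<Phi> n. \<Delta> \<preceq> \<Phi> \<Longrightarrow> \<Phi> \<Vdash> fsub (n ## Var) \<phi> \<Longrightarrow> \<Phi> \<Vdash> ap e n (under n \<psi>)) \<Longrightarrow> \<Delta> \<Vdash> C"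
  shows "\<Gamma> \<Vdash> C"
proof -
  have "\<Gamma> \<Vdash> All (Imp \<phi> (Ex \<psi>))"
    using assms(2) by (auto simp: all_iff intro!: fm_impI)
  from fm_impE[OF axI[OF sys_axiom.ECT[OF assms(1)]] this]
  show ?thesis
    by (rule fm_exE) (auto simp: all_iff imp_iff intro!: C)
qed

lemma ect_total:
  assumes "\<And>n. \<Gamma> \<Vdash> Ex (under n \<psi>)"
    and C: "\<And>\<Delta> e. \<Gamma> \<preceq> \<Delta> \<Longrightarrow> (\<And>n. \<Delta> \<Vdash> ap e n (under n \<psi>)) \<Longrightarrow> \<Delta> \<Vdash> C"
  shows "\<Gamma> \<Vdash> C"
proof (rule ect[where \<phi> = "Eq Zr Zr" and \<psi> = \<psi>])
  show "almost_negative (Eq Zr Zr)" by (intro almost_negative.intros(1) sigma1.intros qfree.intros)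
qed (auto intro: C mono[OF assms(1)])

text \<open>An opaque copy of \<open>Xi\<close>: simplification treats the coding as a binary
  operation instead of composing substitutions into the unknown term \<xi>.\<close>

definition XI :: "tm \<Rightarrow> tm \<Rightarrow> tm" where
  "XI f g = Xi \<xi> f g"

lemma tsub_XI [simp]: "tsub \<sigma> (XI f g) = XI (tsub \<sigma> f) (tsub \<sigma> g)"
  by (simp add: XI_def)

text \<open>The function g may be partial. X2 asks for meaning only where \<open>gn\<close> is
  defined, while X1 makes \<open>\<Xi>(f,g)\<close> fail if some \<open>fn\<close> is true and
  \<open>gn\<close> is undefined. This gap is what codes falsity and definedness.\<close>

lemma MM_XI:
  assumes "\<And>\<Delta> n. \<Gamma> \<preceq> \<Delta> \<Longrightarrow> \<Delta> \<Vdash> defd f n \<Longrightarrow> \<Delta> \<Vdash> ap f n (MM (Var 0))"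
    and "\<And>\<Delta> n. \<Gamma> \<preceq> \<Delta> \<Longrightarrow> \<Delta> \<Vdash> defd g n \<Longrightarrow> \<Delta> \<Vdash> ap f n (TT (Var 0)) \<Longrightarrow> \<Delta> \<Vdash> ap g n (MM (Var 0))"
  shows "\<Gamma> \<Vdash> MM (XI f g)"
proof -
  let ?A = "All (Imp (defd (lift_tm f) (Var 0)) (ap (lift_tm f) (Var 0) (MM (Var 0))))"
  let ?B = "All (Imp (And (And (defd (lift_tm f) (Var 0)) (defd (lift_tm g) (Var 0)))
      (ap (lift_tm f) (Var 0) (TT (Var 0)))) (ap (lift_tm g) (Var 0) (MM (Var 0))))"
  have "\<Gamma> \<Vdash> Imp ?A (Imp ?B (MM (XI f g)))"
    using axI[OF sys_axiom.X2, of \<Gamma>] unfolding XI_def[symmetric] by (simp add: all_iff)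
  moreover have "\<Gamma> \<Vdash> ?A" "\<Gamma> \<Vdash> ?B" using assms by (auto simp: all_iff imp_iff)
  ultimately show ?thesis by (blast intro: fm_impE)
qed

lemma TT_XI:
  assumes "\<Gamma> \<Vdash> MM (XI f g)"
  shows "\<Gamma> \<Vdash> TT (XI f g) \<longleftrightarrow> (\<forall>n \<Delta>. \<Gamma> \<preceq> \<Delta> \<longrightarrow> \<Delta> \<Vdash> ap f n (TT (Var 0)) \<longrightarrow> \<Delta> \<Vdash> ap g n (TT (Var 0)))"
proof -
  have "\<Gamma> \<Vdash> Imp (MM (XI f g)) (Iff (TT (XI f g))
       (All (Imp (ap (lift_tm f) (Var 0) (TT (Var 0))) (ap (lift_tm g) (Var 0) (TT (Var 0))))))"
    using axI[OF sys_axiom.X1, of \<Gamma>] unfolding XI_def[symmetric] by (simp add: all_iff)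
  from fm_impE[OF this assms] show ?thesis by (auto simp: all_iff imp_iff)
qed

definition cond :: "fm \<Rightarrow> fm" where
  "cond A = Ex (And (MM (Var 0)) (Iff (TT (Var 0)) (fren Suc A)))"

lemma fsub_cond [simp]: "fsub \<sigma> (cond A) = cond (fsub \<sigma> A)"
  by (simp add: cond_def)

lemma iff_iff: "\<Gamma> \<Vdash> Imp A B \<and> \<Gamma> \<Vdash> Imp B A \<longleftrightarrow> (\<forall>\<Delta>. \<Gamma> \<preceq> \<Delta> \<longrightarrow> (\<Delta> \<Vdash> A \<longleftrightarrow> \<Delta> \<Vdash> B))"
  by (auto simp: imp_iff)

lemma condI:
  assumes "\<Gamma> \<Vdash> MM c" "\<And>\<Delta>. \<Gamma> \<preceq> \<Delta> \<Longrightarrow> \<Delta> \<Vdash> TT c \<longleftrightarrow> \<Delta> \<Vdash> A"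
  shows "\<Gamma> \<Vdash> cond A"
  unfolding cond_def by (rule fm_exI[of _ c]) (use assms in \<open>simp add: iff_iff\<close>)

lemma condE:
  assumes "\<Gamma> \<Vdash> cond A"
    and "\<And>\<Delta> c. \<Gamma> \<preceq> \<Delta> \<Longrightarrow> \<Delta> \<Vdash> MM c \<Longrightarrow> (\<And>\<Phi>. \<Delta> \<preceq> \<Phi> \<Longrightarrow> \<Phi> \<Vdash> TT c \<longleftrightarrow> \<Phi> \<Vdash> A) \<Longrightarrow> \<Delta> \<Vdash> C"
  shows "\<Gamma> \<Vdash> C"
  using assms(1) unfolding cond_def
  by (rule fm_exE) (auto simp: iff_iff intro!: assms(2))

lemma cond_cong:
  assumes "\<Gamma> \<Vdash> cond A" "\<And>\<Delta>. \<Gamma> \<preceq> \<Delta> \<Longrightarrow> \<Delta> \<Vdash> A \<longleftrightarrow> \<Delta> \<Vdash> B"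
  shows "\<Gamma> \<Vdash> cond B"
  using assms(1)
proof (rule condE)
  fix \<Delta> c assume \<Delta>: "\<Gamma> \<preceq> \<Delta>" "\<Delta> \<Vdash> MM c" "\<And>\<Phi>. \<Delta> \<preceq> \<Phi> \<Longrightarrow> \<Phi> \<Vdash> TT c \<longleftrightarrow> \<Phi> \<Vdash> A"
  show "\<Delta> \<Vdash> cond B"
    by (rule condI[OF \<Delta>(2)]) (simp add: \<Delta>(3) assms(2) ext_trans[OF \<Delta>(1)])
qed

abbreviation code_fm :: "fm \<Rightarrow> fm" where
  "code_fm A \<equiv> And (MM (Var 0)) (Iff (TT (Var 0)) (fren Suc A))"

text \<open>ECT with a trivially true premise turns the existence of a code for each instance into
  one total index of codes.\<close>

lemma cond_choice:
  assumes "\<And>n. \<Gamma> \<Vdash> cond (fsub (n ## Var) P)"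
    and C: "\<And>\<Delta> f. \<Gamma> \<preceq> \<Delta> \<Longrightarrow> (\<And>n. \<Delta> \<Vdash> ap f n (code_fm (fsub (n ## Var) P))) \<Longrightarrow> \<Delta> \<Vdash> C"
  shows "\<Gamma> \<Vdash> C"
proof (rule ect_total[where \<psi> = "code_fm P"])
  show "\<Gamma> \<Vdash> Ex (under n (code_fm P))" for n
    using assms(1)[of n] by (simp add: cond_def)
  show "\<Delta> \<Vdash> C" if "\<Gamma> \<preceq> \<Delta>" "\<And>n. \<Delta> \<Vdash> ap e n (under n (code_fm P))" for \<Delta> e
    using that by (intro C[of \<Delta> e]) auto
qed

lemma ap_code:
  assumes "\<Gamma> \<Vdash> ap f n (code_fm A)"
  shows "\<Gamma> \<Vdash> ap f n (MM (Var 0))" "\<Gamma> \<Vdash> ap f n (TT (Var 0)) \<longleftrightarrow> \<Gamma> \<Vdash> A"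
proof -
  have "\<Gamma> \<Vdash> And (ap f n (MM (Var 0))) (Iff (ap f n (TT (Var 0))) A)"
    using assms
  proof (rule apE)
    fix \<Delta> m assume m: "\<Delta> \<Vdash> App f n m" and "\<Delta> \<Vdash> fsub (m ## Var) (code_fm A)"
    then have c: "\<Delta> \<Vdash> MM m" "\<And>\<Phi>. \<Delta> \<preceq> \<Phi> \<Longrightarrow> \<Phi> \<Vdash> TT m \<longleftrightarrow> \<Phi> \<Vdash> A" by (auto simp: iff_iff)
    have "\<Phi> \<Vdash> ap f n (TT (Var 0)) \<longleftrightarrow> \<Phi> \<Vdash> A" if "\<Delta> \<preceq> \<Phi>" for \<Phi>
      using ap_iff[OF mono[OF m that], of "TT (Var 0)"] c(2)[OF that] by simp
    with c(1) show "\<Delta> \<Vdash> And (ap f n (MM (Var 0))) (Iff (ap f n (TT (Var 0))) A)"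
      by (simp add: ap_iff[OF m] iff_iff)
  qed
  then show "\<Gamma> \<Vdash> ap f n (MM (Var 0))" "\<Gamma> \<Vdash> ap f n (TT (Var 0)) \<longleftrightarrow> \<Gamma> \<Vdash> A"
    by (auto intro: fm_impE)
qed

lemma ap_codeI:
  assumes "\<Gamma> \<Vdash> ap f n (MM (Var 0))"
  shows "\<Gamma> \<Vdash> cond (ap f n (TT (Var 0)))"
  using assms
proof (rule apE)
  fix \<Delta> m assume \<Delta>: "\<Delta> \<Vdash> App f n m" "\<Delta> \<Vdash> fsub (m ## Var) (MM (Var 0))"
  show "\<Delta> \<Vdash> cond (ap f n (TT (Var 0)))"
    by (rule condI[of _ m]) (use \<Delta> ap_iff[OF mono[OF \<Delta>(1)]] in simp_all)
qed

text \<open>A condition \<open>\<T>(fn)\<close> with \<open>f\<close> total is equivalent to the almost negative \<open>\<forall>m (fn \<simeq> m \<rightarrow> \<T>(m))\<close>.\<close>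

lemma ect_cond:
  assumes c: "\<And>n. \<Gamma> \<Vdash> cond (fsub (n ## Var) P)"
    and h: "\<And>\<Delta> n. \<Gamma> \<preceq> \<Delta> \<Longrightarrow> \<Delta> \<Vdash> fsub (n ## Var) P \<Longrightarrow> \<Delta> \<Vdash> Ex (under n \<psi>)"
    and C: "\<And>\<Delta> e. \<Gamma> \<preceq> \<Delta> \<Longrightarrow> (\<And>\<Phi> n. \<Delta> \<preceq> \<Phi> \<Longrightarrow> \<Phi> \<Vdash> fsub (n ## Var) P \<Longrightarrow> \<Phi> \<Vdash> ap e n (under n \<psi>)) \<Longrightarrow> \<Delta> \<Vdash> C"
  shows "\<Gamma> \<Vdash> C"
proof (rule cond_choice[OF c])
  fix \<Delta> f assume \<Delta>: "\<Gamma> \<preceq> \<Delta>" and f: "\<And>n. \<Delta> \<Vdash> ap f n (code_fm (fsub (n ## Var) P))"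
  define \<phi> where "\<phi> = All (Imp (App (lift2_tm f) (Var 1) (Var 0)) (TT (Var 0)))"
  have an: "almost_negative \<phi>"
    unfolding \<phi>_def by (intro almost_negative.intros(4,6,7) almost_negative_App)
  \<comment> \<open>Passing from \<phi> back to P needs f to be total: \<phi> says nothing at
    arguments where \<open>fn\<close> has no value.\<close>
  have P: "\<Phi> \<Vdash> fsub (n ## Var) \<phi> \<longleftrightarrow> \<Phi> \<Vdash> fsub (n ## Var) P" if \<Phi>: "\<Delta> \<preceq> \<Phi>" for \<Phi> n
  proof -
    note f' = ap_code(2)[OF mono[OF f[of n]]] and d = defd_of_ap[OF mono[OF f[of n]]]
    have "\<Phi> \<Vdash> fsub (n ## Var) \<phi> \<longleftrightarrow> \<Phi> \<Vdash> ap f n (TT (Var 0))"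
    proof
      assume A: "\<Phi> \<Vdash> fsub (n ## Var) \<phi>"
      from d[OF \<Phi>] show "\<Phi> \<Vdash> ap f n (TT (Var 0))"
      proof (rule defdE)
        fix \<Psi> m assume l: "\<Phi> \<preceq> \<Psi>" "\<Psi> \<Vdash> App f n m"
        with mono[OF A l(1)] show "\<Psi> \<Vdash> ap f n (TT (Var 0))"
          by (auto simp: \<phi>_def all_iff ap_iff intro: fm_impE)
      qed
    next
      assume A: "\<Phi> \<Vdash> ap f n (TT (Var 0))"
      have "\<Psi> \<Vdash> TT m" if "\<Phi> \<preceq> \<Psi>" "\<Psi> \<Vdash> App f n m" for \<Psi> m
        using mono[OF A that(1)] ap_iff[OF that(2)] by simp
      then show "\<Phi> \<Vdash> fsub (n ## Var) \<phi>" by (simp add: \<phi>_def all_iff imp_iff)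
    qed
    also have "\<dots> \<longleftrightarrow> \<Phi> \<Vdash> fsub (n ## Var) P" by (rule f'[OF \<Phi>])
    finally show ?thesis .
  qed
  show "\<Delta> \<Vdash> C"
  proof (rule ect[OF an, where \<psi> = \<psi>])
    show "\<Phi> \<Vdash> Ex (under n \<psi>)" if "\<Delta> \<preceq> \<Phi>" "\<Phi> \<Vdash> fsub (n ## Var) \<phi>" for \<Phi> n
      using that by (intro h ext_trans[OF \<Delta>]) (simp_all add: P)
    fix \<Phi> e assume \<Phi>: "\<Delta> \<preceq> \<Phi>"
      "\<And>\<Psi> n. \<Phi> \<preceq> \<Psi> \<Longrightarrow> \<Psi> \<Vdash> fsub (n ## Var) \<phi> \<Longrightarrow> \<Psi> \<Vdash> ap e n (under n \<psi>)"
    show "\<Phi> \<Vdash> C"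
      by (rule C[OF ext_trans[OF \<Delta> \<Phi>(1)], of e]) (simp add: P \<Phi> ext_trans[OF \<Phi>(1)])
  qed
qed

text \<open>The code is \<open>\<Xi>(f,g)\<close>, with f a total index of codes of P and g given by
  ECT only where P holds. Elsewhere nothing is known about g, and X2 asks for nothing there.\<close>

lemma cond_allimp:
  assumes c: "\<And>n. \<Gamma> \<Vdash> cond (fsub (n ## Var) P)"
    and h: "\<And>\<Delta> n. \<Gamma> \<preceq> \<Delta> \<Longrightarrow> \<Delta> \<Vdash> fsub (n ## Var) P \<Longrightarrow> \<Delta> \<Vdash> cond (fsub (n ## Var) B)"
  shows "\<Gamma> \<Vdash> cond (All (Imp P B))"
proof (rule cond_choice[OF c])
  fix \<Delta> f assume \<Delta>: "\<Gamma> \<preceq> \<Delta>" and f: "\<And>n. \<Delta> \<Vdash> ap f n (code_fm (fsub (n ## Var) P))"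
  show "\<Delta> \<Vdash> cond (All (Imp P B))"
  proof (rule ect_cond[where P = P and \<psi> = "code_fm B"])
    show "\<Delta> \<Vdash> cond (fsub (n ## Var) P)" for n by (rule mono[OF c \<Delta>])
    show "\<Phi> \<Vdash> Ex (under n (code_fm B))" if "\<Delta> \<preceq> \<Phi>" "\<Phi> \<Vdash> fsub (n ## Var) P" for \<Phi> n
      using h[OF ext_trans[OF \<Delta> that(1)] that(2)] by (simp add: cond_def)
    fix \<Phi> g assume \<Phi>: "\<Delta> \<preceq> \<Phi>"
      and g: "\<And>\<Psi> n. \<Phi> \<preceq> \<Psi> \<Longrightarrow> \<Psi> \<Vdash> fsub (n ## Var) P \<Longrightarrow> \<Psi> \<Vdash> ap g n (under n (code_fm B))"
    have f': "\<Psi> \<Vdash> ap f n (MM (Var 0))" "\<Psi> \<Vdash> ap f n (TT (Var 0)) \<longleftrightarrow> \<Psi> \<Vdash> fsub (n ## Var) P"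
      if "\<Phi> \<preceq> \<Psi>" for \<Psi> n
      using ap_code[OF mono[OF f[of n] ext_trans[OF \<Phi> that]]] by blast+
    have g': "\<Psi> \<Vdash> ap g n (MM (Var 0))" "\<Psi> \<Vdash> ap g n (TT (Var 0)) \<longleftrightarrow> \<Psi> \<Vdash> fsub (n ## Var) B"
      if "\<Phi> \<preceq> \<Psi>" "\<Psi> \<Vdash> fsub (n ## Var) P" for \<Psi> n
      using g[OF that] ap_code[of \<Psi> g n "fsub (n ## Var) B"] by auto
    have M: "\<Phi> \<Vdash> MM (XI f g)"
      by (rule MM_XI) (auto simp: f' g')
    then show "\<Phi> \<Vdash> cond (All (Imp P B))"
    proof (rule condI)
      fix \<Psi> assume l: "\<Phi> \<preceq> \<Psi>"
      show "\<Psi> \<Vdash> TT (XI f g) \<longleftrightarrow> \<Psi> \<Vdash> All (Imp P B)"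
        unfolding TT_XI[OF mono[OF M l]] using f'(2)[OF ext_trans[OF l]] g'(2)[OF ext_trans[OF l]]
        by (auto simp: all_iff imp_iff)
    qed
  qed
qed

text \<open>For the empty function the hypotheses of X2 and the right-hand side of X1 hold
  vacuously.\<close>

lemma top_code: "\<Gamma> \<Vdash> MM (XI empty_ix empty_ix)" "\<Gamma> \<Vdash> TT (XI empty_ix empty_ix)"
proof -
  have e: "\<Gamma> \<Vdash> C" if "\<Gamma> \<Vdash> defd empty_ix n" for \<Gamma> n C
    using that by (rule defdE) (erule empty_App)
  show M: "\<Gamma> \<Vdash> MM (XI empty_ix empty_ix)"
    by (rule MM_XI) (erule e)+
  show "\<Gamma> \<Vdash> TT (XI empty_ix empty_ix)"
    unfolding TT_XI[OF M] by (blast intro: e defd_of_ap)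
qed

lemma cond_true: "\<Gamma> \<Vdash> A \<Longrightarrow> \<Gamma> \<Vdash> cond A"
  by (rule condI[of _ "XI empty_ix empty_ix"]) (auto intro: top_code mono)

lemma cond_false:
  assumes "\<And>\<Delta>. \<Gamma> \<preceq> \<Delta> \<Longrightarrow> \<Delta> \<Vdash> A \<Longrightarrow> \<Delta> \<Vdash> Bot"
  shows "\<Gamma> \<Vdash> cond A"
proof -
  \<comment> \<open>With an always true f and an empty g, the code claims a value of a function that
    has none.\<close>
  let ?f = "const_ix (XI empty_ix empty_ix)"
  have f: "\<Gamma> \<Vdash> ap ?f n (MM (Var 0))" "\<Gamma> \<Vdash> ap ?f n (TT (Var 0))" for \<Gamma> n
    by (simp_all add: ap_iff[OF const_App] top_code)
  have e: "\<Gamma> \<Vdash> C" if "\<Gamma> \<Vdash> defd empty_ix n" for \<Gamma> n C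
    using that by (rule defdE) (erule empty_App)
  have M: "\<Gamma> \<Vdash> MM (XI ?f empty_ix)" for \<Gamma>
    by (rule MM_XI) (simp add: f, erule e)
  have T: "\<Gamma> \<Vdash> C" if "\<Gamma> \<Vdash> TT (XI ?f empty_ix)" for \<Gamma> C
    using that unfolding TT_XI[OF M] by (meson f(2) ext_refl e defd_of_ap)
  show ?thesis
    by (rule condI[OF M]) (blast intro: T botE assms)
qed

lemma cond_imp:
  assumes "\<Gamma> \<Vdash> cond A" "\<And>\<Delta>. \<Gamma> \<preceq> \<Delta> \<Longrightarrow> \<Delta> \<Vdash> A \<Longrightarrow> \<Delta> \<Vdash> cond B"
  shows "\<Gamma> \<Vdash> cond (Imp A B)"
  by (rule cond_cong[OF cond_allimp[of \<Gamma> "fren Suc A" "fren Suc B"]]) (use assms in \<open>auto simp: all_iff\<close>)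

lemma true_imp: "\<Gamma> \<Vdash> Imp (Eq t t) A \<longleftrightarrow> \<Gamma> \<Vdash> A"
  using fm_impE[OF _ eq_refl] fm_impI mono by blast

lemma cond_all:
  assumes "\<And>n. \<Gamma> \<Vdash> cond (fsub (n ## Var) A)"
  shows "\<Gamma> \<Vdash> cond (All A)"
  by (rule cond_cong[OF cond_allimp[of \<Gamma> "Eq Zr Zr" A]])
    (auto intro: cond_true mono[OF assms] simp: all_iff true_imp)

lemma eq_dec:
  assumes "\<And>\<Delta>. \<Gamma> \<preceq> \<Delta> \<Longrightarrow> \<Delta> \<Vdash> Eq s t \<Longrightarrow> \<Delta> \<Vdash> C"
    and "\<And>\<Delta>. \<Gamma> \<preceq> \<Delta> \<Longrightarrow> (\<And>\<Phi> D. \<Delta> \<preceq> \<Phi> \<Longrightarrow> \<Phi> \<Vdash> Eq s t \<Longrightarrow> \<Phi> \<Vdash> D) \<Longrightarrow> \<Delta> \<Vdash> C"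
  shows "\<Gamma> \<Vdash> C"
proof (rule zcases[of \<Gamma> "dist_tm s t"])
  fix \<Delta> k assume \<Delta>: "\<Gamma> \<preceq> \<Delta>" "\<Delta> \<Vdash> Eq (dist_tm s t) (Sc k)"
  show "\<Delta> \<Vdash> C"
  proof (rule assms(2)[OF \<Delta>(1)])
    fix \<Phi> D assume \<Phi>: "\<Delta> \<preceq> \<Phi>" "\<Phi> \<Vdash> Eq s t"
    then have "\<Phi> \<Vdash> Eq (dist_tm s t) Zr" by (simp add: dist_zero_iff)
    from eq_trans[OF eq_sym[OF mono[OF \<Delta>(2) \<Phi>(1)]] this] show "\<Phi> \<Vdash> D" by (rule suc_nz)
  qed
qed (auto simp: dist_zero_iff intro: assms(1))

lemma cond_eq: "\<Gamma> \<Vdash> cond (Eq s t)"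
  by (rule eq_dec[of \<Gamma> s t]) (auto intro: cond_true cond_false)

text \<open>
  Only the implication tolerates a conclusion that is meaningful relative to the premise, so
  \<open>A \<and> B\<close> is coded as \<open>A \<and> (A \<rightarrow> B)\<close>, and the latter as a numerical \<open>\<forall>\<close> with these two instances.
\<close>

lemma cond_and:
  assumes "\<Gamma> \<Vdash> cond A" "\<And>\<Delta>. \<Gamma> \<preceq> \<Delta> \<Longrightarrow> \<Delta> \<Vdash> A \<Longrightarrow> \<Delta> \<Vdash> cond B"
  shows "\<Gamma> \<Vdash> cond (And A B)"
proof (rule cond_cong)
  let ?Q = "And (Imp (Eq (Var 0) Zr) (fren Suc A)) (Imp (Imp (Eq (Var 0) Zr) Bot) (fren Suc (Imp A B)))"
  show "\<Gamma> \<Vdash> cond (All ?Q)"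
  proof (rule cond_all)
    fix n
    have "\<Gamma> \<Vdash> cond (And (Imp (Eq n Zr) A) (Imp (Imp (Eq n Zr) Bot) (Imp A B)))"
    \<comment> \<open>Deciding \<open>n = 0\<close> makes this instance equivalent either to A or to
      \<open>A \<rightarrow> B\<close>, both of which have codes; the conjunction in
      \<open>?Q\<close> itself is never coded.\<close>
    proof (rule eq_dec[of \<Gamma> n Zr])
      fix \<Delta> assume \<Delta>: "\<Gamma> \<preceq> \<Delta>" "\<Delta> \<Vdash> Eq n Zr"
      show "\<Delta> \<Vdash> cond (And (Imp (Eq n Zr) A) (Imp (Imp (Eq n Zr) Bot) (Imp A B)))"
      proof (rule cond_cong[OF mono[OF assms(1) \<Delta>(1)]])
        fix \<Phi> assume \<Phi>: "\<Delta> \<preceq> \<Phi>"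
        note n = mono[OF \<Delta>(2) \<Phi>]
        have "\<Phi> \<Vdash> Imp (Eq n Zr) A \<longleftrightarrow> \<Phi> \<Vdash> A" by (auto intro: fm_impE[OF _ n] fm_impI mono)
        moreover have "\<Phi> \<Vdash> Imp (Imp (Eq n Zr) Bot) (Imp A B)"
          by (rule fm_impI) (blast intro: botE fm_impE mono[OF n])
        ultimately show "\<Phi> \<Vdash> A \<longleftrightarrow> \<Phi> \<Vdash> And (Imp (Eq n Zr) A) (Imp (Imp (Eq n Zr) Bot) (Imp A B))"
          by simp
      qed
    next
      fix \<Delta> assume \<Delta>: "\<Gamma> \<preceq> \<Delta>" "\<And>\<Phi> D. \<Delta> \<preceq> \<Phi> \<Longrightarrow> \<Phi> \<Vdash> Eq n Zr \<Longrightarrow> \<Phi> \<Vdash> D"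
      have "\<Delta> \<Vdash> cond (Imp A B)"
        using assms \<Delta>(1) by (blast intro: cond_imp mono ext_trans)
      then show "\<Delta> \<Vdash> cond (And (Imp (Eq n Zr) A) (Imp (Imp (Eq n Zr) Bot) (Imp A B)))"
      proof (rule cond_cong)
        fix \<Phi> assume \<Phi>: "\<Delta> \<preceq> \<Phi>"
        have 1: "\<Phi> \<Vdash> Imp (Eq n Zr) D" for D
          by (rule fm_impI) (blast intro: \<Delta>(2) ext_trans \<Phi>)
        then have "\<Phi> \<Vdash> Imp (Imp (Eq n Zr) Bot) (Imp A B) \<longleftrightarrow> \<Phi> \<Vdash> Imp A B"
          by (auto intro: fm_impE[OF _ 1] fm_impI mono)
        with 1 show "\<Phi> \<Vdash> Imp A B \<longleftrightarrow> \<Phi> \<Vdash> And (Imp (Eq n Zr) A) (Imp (Imp (Eq n Zr) Bot) (Imp A B))"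
          by simp
      qed
    qed
    then show "\<Gamma> \<Vdash> cond (fsub (n ## Var) ?Q)" by simp
  qed
  fix \<Delta>
  have nz: "\<Delta> \<Vdash> Imp (Eq (Sc Zr) Zr) Bot" by (rule fm_impI) (erule suc_nz)
  show "\<Delta> \<Vdash> All ?Q \<longleftrightarrow> \<Delta> \<Vdash> And A B"
  proof
    assume "\<Delta> \<Vdash> All ?Q"
    then have Q: "\<Delta> \<Vdash> And (Imp (Eq n Zr) A) (Imp (Imp (Eq n Zr) Bot) (Imp A B))" for n
      by (simp add: all_iff)
    have "\<Delta> \<Vdash> A" using Q[of Zr] by (auto intro: fm_impE[OF _ eq_refl])
    moreover have "\<Delta> \<Vdash> Imp A B" using Q[of "Sc Zr"] fm_impE[OF _ nz] by auto
    ultimately show "\<Delta> \<Vdash> And A B" by (auto intro: fm_impE)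
  next
    assume "\<Delta> \<Vdash> And A B"
    then show "\<Delta> \<Vdash> All ?Q" by (auto simp: all_iff intro!: fm_impI intro: mono)
  qed
qed

text \<open>The code is \<open>\<Xi>(f, dom_ix r \<top>)\<close>, where \<open>fk\<close> is a code of \<open>k = n\<close>.\<close>

lemma cond_defd: "\<Gamma> \<Vdash> cond (defd r n)"
proof (rule cond_choice[of \<Gamma> "Eq (Var 0) (lift_tm n)"])
  fix \<Delta> f assume "\<And>k. \<Delta> \<Vdash> ap f k (code_fm (fsub (k ## Var) (Eq (Var 0) (lift_tm n))))"
  then have f: "\<Delta> \<Vdash> ap f k (code_fm (Eq k n))" for k by simp
  have f': "\<Psi> \<Vdash> ap f k (MM (Var 0))" "\<Psi> \<Vdash> ap f k (TT (Var 0)) \<longleftrightarrow> \<Psi> \<Vdash> Eq k n" if "\<Delta> \<preceq> \<Psi>" for \<Psi> k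
    using ap_code[OF mono[OF f[of k] that]] by blast+
  let ?t = "XI empty_ix empty_ix"
  let ?g = "dom_ix r ?t"
  have g: "\<Psi> \<Vdash> defd ?g k \<longleftrightarrow> \<Psi> \<Vdash> defd r k" for \<Psi> k
  proof
    assume "\<Psi> \<Vdash> defd ?g k"
    then show "\<Psi> \<Vdash> defd r k" by (rule defdE) (simp add: dom_App_iff)
  qed (auto intro!: defdI simp: dom_App_iff)
  have g': "\<Psi> \<Vdash> ap ?g k A \<longleftrightarrow> \<Psi> \<Vdash> fsub (?t ## Var) A" if "\<Psi> \<Vdash> defd r k" for \<Psi> k A
    by (rule ap_iff) (simp add: dom_App_iff that)
  have M: "\<Delta> \<Vdash> MM (XI f ?g)"
    by (rule MM_XI) (simp_all add: f' g g' top_code)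
  then show "\<Delta> \<Vdash> cond (defd r n)"
  proof (rule condI)
    fix \<Phi> assume \<Phi>: "\<Delta> \<preceq> \<Phi>"
    show "\<Phi> \<Vdash> TT (XI f ?g) \<longleftrightarrow> \<Phi> \<Vdash> defd r n"
      unfolding TT_XI[OF mono[OF M \<Phi>]]
    proof (intro iffI HOL.allI HOL.impI)
      assume "\<forall>k \<Psi>. \<Phi> \<preceq> \<Psi> \<longrightarrow> \<Psi> \<Vdash> ap f k (TT (Var 0)) \<longrightarrow> \<Psi> \<Vdash> ap ?g k (TT (Var 0))"
      then have "\<Phi> \<Vdash> ap ?g n (TT (Var 0))" using f'(2)[OF \<Phi>, of n] by auto
      then show "\<Phi> \<Vdash> defd r n" using defd_of_ap g by blast
    next
      fix k \<Psi> assume A: "\<Phi> \<Vdash> defd r n" and l: "\<Phi> \<preceq> \<Psi>" "\<Psi> \<Vdash> ap f k (TT (Var 0))"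
      have "\<Psi> \<Vdash> Eq k n" using l f'(2)[OF ext_trans[OF \<Phi> l(1)]] by simp
      then have "\<Psi> \<Vdash> defd r k"
        using mono[OF A l(1)] eq_fsub[of \<Psi> k n Var "defd (lift_tm r) (Var 0)"] by simp
      then show "\<Psi> \<Vdash> ap ?g k (TT (Var 0))" by (simp add: g' top_code)
    qed
  qed
qed (simp add: cond_eq)

text \<open>The statement is rewritten as \<open>en\<down>\<close> together with a universal claim
  about all least trees of \<open>en\<close>. Being a least tree is a conjunction of equations and
  hence a condition, whereas \<open>App\<close> is existential; definedness is handled by
  \<open>cond_defd\<close>.\<close>

lemma cond_ap:
  assumes "\<And>t. \<Gamma> \<Vdash> cond (fsub (t ## Var) A)"
  shows "\<Gamma> \<Vdash> cond (ap e n A)"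
proof (rule cond_cong)
  let ?B = "All (Imp (least_tree (lift_tm e) (lift_tm n) (Var 0)) (fsub (out_tm (Var 0) ## (\<lambda>i. Var (Suc i))) A))"
  have "\<Gamma> \<Vdash> cond ?B"
    by (rule cond_allimp) (auto intro!: cond_and cond_eq mono[OF assms])
  then show "\<Gamma> \<Vdash> cond (And (defd e n) ?B)"
    by (intro cond_and cond_defd) (rule mono)
  fix \<Delta>
  show "\<Delta> \<Vdash> And (defd e n) ?B \<longleftrightarrow> \<Delta> \<Vdash> ap e n A"
  proof
    assume A: "\<Delta> \<Vdash> And (defd e n) ?B"
    then have "\<Delta> \<Vdash> defd e n" by simp
    then show "\<Delta> \<Vdash> ap e n A"
    proof (rule defdE)
      fix \<Phi> m assume \<Phi>: "\<Delta> \<preceq> \<Phi>" "\<Phi> \<Vdash> App e n m"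
      from \<Phi>(2) show "\<Phi> \<Vdash> ap e n A"
      proof (rule AppE)
        fix \<Psi> z assume l: "\<Phi> \<preceq> \<Psi>" "\<Psi> \<Vdash> least_tree e n z"
        then have "\<Psi> \<Vdash> fsub (out_tm z ## Var) A"
          using A ext_trans[OF \<Phi>(1) l(1)] by (auto simp: all_iff imp_iff)
        then show "\<Psi> \<Vdash> ap e n A" using ap_iff[OF AppI[OF l(2) eq_refl]] by simp
      qed
    qed
  next
    assume A: "\<Delta> \<Vdash> ap e n A"
    have "\<Phi> \<Vdash> fsub (out_tm z ## Var) A" if "\<Delta> \<preceq> \<Phi>" "\<Phi> \<Vdash> least_tree e n z" for \<Phi> z
      using mono[OF A that(1)] ap_iff[OF AppI[OF that(2) eq_refl]] by simp
    then have "\<Delta> \<Vdash> ?B" by (simp add: all_iff imp_iff)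
    with defd_of_ap[OF A] show "\<Delta> \<Vdash> And (defd e n) ?B" by simp
  qed
qed

subsection \<open>Families of conditions\<close>

lemma ex_mono:
  assumes "\<Gamma> \<Vdash> Ex A" "\<And>\<Delta> t. \<Gamma> \<preceq> \<Delta> \<Longrightarrow> \<Delta> \<Vdash> fsub (t ## Var) A \<Longrightarrow> \<Delta> \<Vdash> fsub (t ## Var) B"
  shows "\<Gamma> \<Vdash> Ex B"
  using assms(1) by (rule fm_exE) (blast intro: fm_exI assms(2))

lemma ex_cong:
  assumes "\<And>\<Delta> t. \<Gamma> \<preceq> \<Delta> \<Longrightarrow> \<Delta> \<Vdash> fsub (t ## Var) A \<longleftrightarrow> \<Delta> \<Vdash> fsub (t ## Var) B"
  shows "\<Gamma> \<Vdash> Ex A \<longleftrightarrow> \<Gamma> \<Vdash> Ex B"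
  using assms by (blast intro: ex_mono)

abbreviation rep_fm :: "fm \<Rightarrow> fm" where
  "rep_fm A \<equiv> And (All (ap (Var 1) (Var 0) (MM (Var 0)))) (Iff (fren Suc A) (Ex (ap (Var 1) (Var 0) (TT (Var 0)))))"

text \<open>The index h is required to be total with meaningful values: every number r yields a
  condition, also when it realizes nothing.\<close>

definition rep :: "fm \<Rightarrow> fm" where
  "rep A = Ex (rep_fm A)"

lemma fsub_rep [simp]: "fsub \<sigma> (rep A) = rep (fsub \<sigma> A)"
  by (simp add: rep_def)

lemma repI:
  assumes c: "\<And>r. \<Gamma> \<Vdash> cond (fsub (r ## Var) R)"
    and A: "\<And>\<Delta>. \<Gamma> \<preceq> \<Delta> \<Longrightarrow> \<Delta> \<Vdash> A \<longleftrightarrow> \<Delta> \<Vdash> Ex R"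
  shows "\<Gamma> \<Vdash> rep A"
proof (rule cond_choice[OF c])
  fix \<Delta> h assume \<Delta>: "\<Gamma> \<preceq> \<Delta>" and h: "\<And>r. \<Delta> \<Vdash> ap h r (code_fm (fsub (r ## Var) R))"
  have "\<Phi> \<Vdash> A \<longleftrightarrow> \<Phi> \<Vdash> Ex (ap (lift_tm h) (Var 0) (TT (Var 0)))" if \<Phi>: "\<Delta> \<preceq> \<Phi>" for \<Phi>
    unfolding A[OF ext_trans[OF \<Delta> \<Phi>]]
  proof (rule ex_cong)
    fix \<Psi> t assume "\<Phi> \<preceq> \<Psi>"
    from ap_code(2)[OF mono[OF h ext_trans[OF \<Phi> this]], of t]
    show "\<Psi> \<Vdash> fsub (t ## Var) R \<longleftrightarrow> \<Psi> \<Vdash> fsub (t ## Var) (ap (lift_tm h) (Var 0) (TT (Var 0)))" by simp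
  qed
  then show "\<Delta> \<Vdash> rep A"
    unfolding rep_def using ap_code(1)[OF h] by (intro fm_exI[of _ h]) (simp add: all_iff iff_iff)
qed

text \<open>R(r) is \<open>\<T>(hr)\<close> for the index h hidden in \<open>rep\<close>, so that
  later arguments work with a formula and can forget h.\<close>

lemma repE:
  assumes "\<Gamma> \<Vdash> rep A"
    and C: "\<And>\<Delta> R. \<Gamma> \<preceq> \<Delta> \<Longrightarrow> (\<And>r. \<Delta> \<Vdash> cond (fsub (r ## Var) R)) \<Longrightarrow>
      (\<And>\<Phi>. \<Delta> \<preceq> \<Phi> \<Longrightarrow> \<Phi> \<Vdash> A \<longleftrightarrow> \<Phi> \<Vdash> Ex R) \<Longrightarrow> \<Delta> \<Vdash> C"
  shows "\<Gamma> \<Vdash> C"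
  using assms(1) unfolding rep_def
proof (rule fm_exE)
  fix \<Delta> h assume \<Delta>: "\<Gamma> \<preceq> \<Delta>" "\<Delta> \<Vdash> fsub (h ## Var) (rep_fm A)"
  show "\<Delta> \<Vdash> C"
    by (rule C[OF \<Delta>(1), of "ap (lift_tm h) (Var 0) (TT (Var 0))"])
      (use \<Delta>(2) in \<open>auto simp: all_iff iff_iff intro: ap_codeI\<close>)
qed

lemma rep_ap:
  assumes "\<Gamma> \<Vdash> ap q n (rep_fm B)"
  shows "\<Gamma> \<Vdash> cond (ap q n (ap (Var 0) (lift_tm r) (TT (Var 0))))"
    and "\<Gamma> \<Vdash> B \<longleftrightarrow> \<Gamma> \<Vdash> Ex (ap (lift_tm q) (lift_tm n) (ap (Var 0) (Var 1) (TT (Var 0))))"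
proof -
  show "\<Gamma> \<Vdash> cond (ap q n (ap (Var 0) (lift_tm r) (TT (Var 0))))"
    using assms
  proof (rule apE)
    fix \<Delta> h assume h: "\<Delta> \<Vdash> App q n h" and "\<Delta> \<Vdash> fsub (h ## Var) (rep_fm B)"
    then have "\<Delta> \<Vdash> ap h r (MM (Var 0))" by (simp add: all_iff)
    from ap_codeI[OF this] show "\<Delta> \<Vdash> cond (ap q n (ap (Var 0) (lift_tm r) (TT (Var 0))))"
      by (rule cond_cong) (simp add: ap_iff[OF mono[OF h]])
  qed
  have "\<Gamma> \<Vdash> Iff B (Ex (ap (lift_tm q) (lift_tm n) (ap (Var 0) (Var 1) (TT (Var 0)))))"
    using assms
  proof (rule apE)
    fix \<Delta> h assume h: "\<Delta> \<Vdash> App q n h" and "\<Delta> \<Vdash> fsub (h ## Var) (rep_fm B)"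
    then have B: "\<And>\<Phi>. \<Delta> \<preceq> \<Phi> \<Longrightarrow> \<Phi> \<Vdash> B \<longleftrightarrow> \<Phi> \<Vdash> Ex (ap (lift_tm h) (Var 0) (TT (Var 0)))"
      by (simp add: iff_iff)
    have "\<Phi> \<Vdash> B \<longleftrightarrow> \<Phi> \<Vdash> Ex (ap (lift_tm q) (lift_tm n) (ap (Var 0) (Var 1) (TT (Var 0))))" if "\<Delta> \<preceq> \<Phi>" for \<Phi>
      unfolding B[OF that]
      by (rule ex_cong) (simp add: ap_iff[OF mono[OF h ext_trans[OF that]]])
    then show "\<Delta> \<Vdash> Iff B (Ex (ap (lift_tm q) (lift_tm n) (ap (Var 0) (Var 1) (TT (Var 0)))))"
      unfolding and_iff iff_iff by blast
  qed
  then show "\<Gamma> \<Vdash> B \<longleftrightarrow> \<Gamma> \<Vdash> Ex (ap (lift_tm q) (lift_tm n) (ap (Var 0) (Var 1) (TT (Var 0))))"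
    unfolding and_iff iff_iff by blast
qed

text \<open>ECT is applied to the relation that m is an index of a representing family for B(n). The
  resulting q gives the family \<open>qn\<close> wherever P(n) holds, and Q(r, n) is
  \<open>\<T>((qn)r)\<close>.\<close>

lemma rep_family:
  assumes c: "\<And>n. \<Gamma> \<Vdash> cond (fsub (n ## Var) P)"
    and h: "\<And>\<Delta> n. \<Gamma> \<preceq> \<Delta> \<Longrightarrow> \<Delta> \<Vdash> fsub (n ## Var) P \<Longrightarrow> \<Delta> \<Vdash> rep (fsub (n ## Var) B)"
    and C: "\<And>\<Delta> Q. \<Gamma> \<preceq> \<Delta> \<Longrightarrow>
      (\<And>\<Phi> n r. \<Delta> \<preceq> \<Phi> \<Longrightarrow> \<Phi> \<Vdash> fsub (n ## Var) P \<Longrightarrow> \<Phi> \<Vdash> cond (fsub (r ## n ## Var) Q)) \<Longrightarrow>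
      (\<And>\<Phi> n. \<Delta> \<preceq> \<Phi> \<Longrightarrow> \<Phi> \<Vdash> fsub (n ## Var) P \<Longrightarrow> \<Phi> \<Vdash> fsub (n ## Var) B \<longleftrightarrow> \<Phi> \<Vdash> Ex (under n Q)) \<Longrightarrow> \<Delta> \<Vdash> C"
  shows "\<Gamma> \<Vdash> C"
proof (rule ect_cond[where P = P and \<psi> = "rep_fm B", OF c])
  show "\<Delta> \<Vdash> Ex (under n (rep_fm B))" if "\<Gamma> \<preceq> \<Delta>" "\<Delta> \<Vdash> fsub (n ## Var) P" for \<Delta> n
    using h[OF that] by (simp add: rep_def)
  fix \<Delta> q assume \<Delta>: "\<Gamma> \<preceq> \<Delta>"
    and q: "\<And>\<Phi> n. \<Delta> \<preceq> \<Phi> \<Longrightarrow> \<Phi> \<Vdash> fsub (n ## Var) P \<Longrightarrow> \<Phi> \<Vdash> ap q n (under n (rep_fm B))"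
  have q': "\<Phi> \<Vdash> ap q n (rep_fm (fsub (n ## Var) B))" if "\<Delta> \<preceq> \<Phi>" "\<Phi> \<Vdash> fsub (n ## Var) P" for \<Phi> n
    using q[OF that] by simp
  show "\<Delta> \<Vdash> C"
  proof (rule C[OF \<Delta>, of "ap (lift2_tm q) (Var 1) (ap (Var 0) (Var 1) (TT (Var 0)))"])
    fix \<Phi> n assume *: "\<Delta> \<preceq> \<Phi>" "\<Phi> \<Vdash> fsub (n ## Var) P"
    show "\<Phi> \<Vdash> cond (fsub (r ## n ## Var) (ap (lift2_tm q) (Var 1) (ap (Var 0) (Var 1) (TT (Var 0)))))" for r
      using rep_ap(1)[OF q'[OF *], of r] by simp
    show "\<Phi> \<Vdash> fsub (n ## Var) B \<longleftrightarrow> \<Phi> \<Vdash> Ex (under n (ap (lift2_tm q) (Var 1) (ap (Var 0) (Var 1) (TT (Var 0)))))"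
      using rep_ap(2)[OF q'[OF *]] by simp
  qed
qed

lemma pair_fsub:
  "\<Gamma> \<Vdash> fsub (fst_tm (pair_tm n r) ## \<sigma>) P \<longleftrightarrow> \<Gamma> \<Vdash> fsub (n ## \<sigma>) P"
  "\<Gamma> \<Vdash> fsub (snd_tm (pair_tm n r) ## fst_tm (pair_tm n r) ## \<sigma>) Q \<longleftrightarrow> \<Gamma> \<Vdash> fsub (r ## n ## \<sigma>) Q"
proof -
  show "\<Gamma> \<Vdash> fsub (fst_tm (pair_tm n r) ## \<sigma>) P \<longleftrightarrow> \<Gamma> \<Vdash> fsub (n ## \<sigma>) P"
    by (rule eq_fsub[OF fst_pair])
  have "\<Gamma> \<Vdash> fsub (snd_tm (pair_tm n r) ## fst_tm (pair_tm n r) ## \<sigma>) Q \<longleftrightarrow>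
      \<Gamma> \<Vdash> fsub (r ## fst_tm (pair_tm n r) ## \<sigma>) Q"
    by (rule eq_fsub[OF snd_pair])
  also have "\<dots> \<longleftrightarrow> \<Gamma> \<Vdash> fsub (r ## n ## \<sigma>) Q"
    using eq_fsub[OF fst_pair, of \<Gamma> n r "r ## \<sigma>" "fsub (Var 1 ## Var 0 ## (\<lambda>i. Var (i + 2))) Q"] by simp
  finally show "\<Gamma> \<Vdash> fsub (snd_tm (pair_tm n r) ## fst_tm (pair_tm n r) ## \<sigma>) Q \<longleftrightarrow> \<Gamma> \<Vdash> fsub (r ## n ## \<sigma>) Q" .
qed

text \<open>A realizer is a pair of a witness n and a realizer of B(n). That such a pair is correct
  is a condition by the dependent conjunction, since Q(r, n) is known to be one only under
  P(n).\<close>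

lemma rep_exand:
  assumes c: "\<And>n. \<Gamma> \<Vdash> cond (fsub (n ## Var) P)"
    and h: "\<And>\<Delta> n. \<Gamma> \<preceq> \<Delta> \<Longrightarrow> \<Delta> \<Vdash> fsub (n ## Var) P \<Longrightarrow> \<Delta> \<Vdash> rep (fsub (n ## Var) B)"
  shows "\<Gamma> \<Vdash> rep (Ex (And P B))"
proof (rule rep_family[OF c h])
  fix \<Delta> Q assume \<Delta>: "\<Gamma> \<preceq> \<Delta>"
    and Q1: "\<And>\<Phi> n r. \<Delta> \<preceq> \<Phi> \<Longrightarrow> \<Phi> \<Vdash> fsub (n ## Var) P \<Longrightarrow> \<Phi> \<Vdash> cond (fsub (r ## n ## Var) Q)"
    and Q2: "\<And>\<Phi> n. \<Delta> \<preceq> \<Phi> \<Longrightarrow> \<Phi> \<Vdash> fsub (n ## Var) P \<Longrightarrow> \<Phi> \<Vdash> fsub (n ## Var) B \<longleftrightarrow> \<Phi> \<Vdash> Ex (under n Q)"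
  let ?R = "And (fsub (fst_tm (Var 0) ## (\<lambda>i. Var (Suc i))) P)
     (fsub (snd_tm (Var 0) ## fst_tm (Var 0) ## (\<lambda>i. Var (Suc i))) Q)"
  show "\<Delta> \<Vdash> rep (Ex (And P B))"
  proof (rule repI[of _ ?R])
    show "\<Delta> \<Vdash> cond (fsub (k ## Var) ?R)" for k
      by simp (intro cond_and mono[OF c \<Delta>] Q1)
    fix \<Phi> assume \<Phi>: "\<Delta> \<preceq> \<Phi>"
    show "\<Phi> \<Vdash> Ex (And P B) \<longleftrightarrow> \<Phi> \<Vdash> Ex ?R"
    proof
      assume "\<Phi> \<Vdash> Ex (And P B)"
      then show "\<Phi> \<Vdash> Ex ?R"
      proof (rule fm_exE)
        fix \<Psi> n assume l: "\<Phi> \<preceq> \<Psi>" "\<Psi> \<Vdash> fsub (n ## Var) (And P B)"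
        then have "\<Psi> \<Vdash> Ex (under n Q)" using Q2[OF ext_trans[OF \<Phi> l(1)], of n] by simp
        then show "\<Psi> \<Vdash> Ex ?R"
        proof (rule fm_exE)
          fix \<Psi>' r assume l': "\<Psi> \<preceq> \<Psi>'" "\<Psi>' \<Vdash> fsub (r ## Var) (under n Q)"
          then show "\<Psi>' \<Vdash> Ex ?R"
            using mono[OF l(2) l'(1)] by (intro fm_exI[of _ "pair_tm n r"]) (simp add: pair_fsub)
        qed
      qed
    next
      assume "\<Phi> \<Vdash> Ex ?R"
      then show "\<Phi> \<Vdash> Ex (And P B)"
      proof (rule fm_exE)
        fix \<Psi> k assume l: "\<Phi> \<preceq> \<Psi>" "\<Psi> \<Vdash> fsub (k ## Var) ?R"
        then have P: "\<Psi> \<Vdash> fsub (fst_tm k ## Var) P" by simp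
        moreover have "\<Psi> \<Vdash> Ex (under (fst_tm k) Q)" using l(2) by (intro fm_exI[of _ "snd_tm k"]) simp
        ultimately show "\<Psi> \<Vdash> Ex (And P B)"
          using Q2[OF ext_trans[OF \<Phi> l(1)] P] by (intro fm_exI[of _ "fst_tm k"]) simp
      qed
    qed
  qed
qed

text \<open>A realizer is an index e that sends each n with P(n) to a realizer of B(n). ECT produces
  e from the truth of the statement, and \<open>cond_allimp\<close> with \<open>cond_ap\<close>
  makes the correctness of e a condition.\<close>

lemma rep_allimp:
  assumes c: "\<And>n. \<Gamma> \<Vdash> cond (fsub (n ## Var) P)"
    and h: "\<And>\<Delta> n. \<Gamma> \<preceq> \<Delta> \<Longrightarrow> \<Delta> \<Vdash> fsub (n ## Var) P \<Longrightarrow> \<Delta> \<Vdash> rep (fsub (n ## Var) B)"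
  shows "\<Gamma> \<Vdash> rep (All (Imp P B))"
proof (rule rep_family[OF c h])
  fix \<Delta> Q assume \<Delta>: "\<Gamma> \<preceq> \<Delta>"
    and Q1: "\<And>\<Phi> n r. \<Delta> \<preceq> \<Phi> \<Longrightarrow> \<Phi> \<Vdash> fsub (n ## Var) P \<Longrightarrow> \<Phi> \<Vdash> cond (fsub (r ## n ## Var) Q)"
    and Q2: "\<And>\<Phi> n. \<Delta> \<preceq> \<Phi> \<Longrightarrow> \<Phi> \<Vdash> fsub (n ## Var) P \<Longrightarrow> \<Phi> \<Vdash> fsub (n ## Var) B \<longleftrightarrow> \<Phi> \<Vdash> Ex (under n Q)"
  let ?R = "All (Imp (fsub (Var 0 ## (\<lambda>i. Var (i + 2))) P)
     (ap (Var 1) (Var 0) (fsub (Var 0 ## Var 1 ## (\<lambda>i. Var (i + 3))) Q)))"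
  have R: "fsub (e ## Var) ?R = All (Imp P (ap (lift_tm e) (Var 0) (fsub (Var 0 ## Var 1 ## (\<lambda>i. Var (i + 2))) Q)))" for e
    by simp
  have ex_of_ap: "\<Gamma> \<Vdash> Ex A" if "\<Gamma> \<Vdash> ap e n A" for \<Gamma> e n A
    using that by (rule apE) (rule fm_exI)
  show "\<Delta> \<Vdash> rep (All (Imp P B))"
  proof (rule repI[of _ ?R])
    show "\<Delta> \<Vdash> cond (fsub (e ## Var) ?R)" for e
      unfolding R by (rule cond_allimp[OF mono[OF c \<Delta>]]) (auto intro!: cond_ap Q1)
    fix \<Phi> assume \<Phi>: "\<Delta> \<preceq> \<Phi>"
    have R': "\<Phi>' \<Vdash> fsub (e ## Var) ?R \<longleftrightarrow> (\<forall>n \<Psi>. \<Phi>' \<preceq> \<Psi> \<longrightarrow> \<Psi> \<Vdash> fsub (n ## Var) P \<longrightarrow> \<Psi> \<Vdash> ap e n (under n Q))" for e \<Phi>'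
      unfolding R by (simp add: all_iff imp_iff)
    show "\<Phi> \<Vdash> All (Imp P B) \<longleftrightarrow> \<Phi> \<Vdash> Ex ?R"
    proof
      assume A: "\<Phi> \<Vdash> All (Imp P B)"
      show "\<Phi> \<Vdash> Ex ?R"
      proof (rule ect_cond[where P = P and \<psi> = Q])
        show "\<Phi> \<Vdash> cond (fsub (n ## Var) P)" for n by (rule mono[OF c ext_trans[OF \<Delta> \<Phi>]])
        show "\<Psi> \<Vdash> Ex (under n Q)" if l: "\<Phi> \<preceq> \<Psi>" "\<Psi> \<Vdash> fsub (n ## Var) P" for \<Psi> n
          using A l Q2[OF ext_trans[OF \<Phi> l(1)] l(2)] by (simp add: all_iff imp_iff)
        show "\<Psi> \<Vdash> Ex ?R" if "\<And>\<Psi>' n. \<Psi> \<preceq> \<Psi>' \<Longrightarrow> \<Psi>' \<Vdash> fsub (n ## Var) P \<Longrightarrow> \<Psi>' \<Vdash> ap e n (under n Q)" for \<Psi> e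
          by (rule fm_exI[of _ e]) (use that R' in blast)
      qed
    next
      assume "\<Phi> \<Vdash> Ex ?R"
      then show "\<Phi> \<Vdash> All (Imp P B)"
      proof (rule fm_exE)
        fix \<Psi> e assume l: "\<Phi> \<preceq> \<Psi>" and "\<Psi> \<Vdash> fsub (e ## Var) ?R"
        then have *: "\<Psi>' \<Vdash> ap e n (under n Q)" if "\<Psi> \<preceq> \<Psi>'" "\<Psi>' \<Vdash> fsub (n ## Var) P" for \<Psi>' n
          using that R' by blast
        have "\<Psi>' \<Vdash> fsub (n ## Var) B" if l': "\<Psi> \<preceq> \<Psi>'" "\<Psi>' \<Vdash> fsub (n ## Var) P" for \<Psi>' n
          using ex_of_ap[OF *[OF l']] Q2[OF ext_trans[OF \<Phi> ext_trans[OF l l'(1)]] l'(2)] by blast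
        then show "\<Psi> \<Vdash> All (Imp P B)" by (simp add: all_iff imp_iff)
      qed
    qed
  qed
qed

lemma rep_cong:
  assumes "\<Gamma> \<Vdash> rep A" "\<And>\<Delta>. \<Gamma> \<preceq> \<Delta> \<Longrightarrow> \<Delta> \<Vdash> A \<longleftrightarrow> \<Delta> \<Vdash> B"
  shows "\<Gamma> \<Vdash> rep B"
  using assms(1)
proof (rule repE)
  fix \<Delta> R assume \<Delta>: "\<Gamma> \<preceq> \<Delta>" "\<And>r. \<Delta> \<Vdash> cond (fsub (r ## Var) R)" "\<And>\<Phi>. \<Delta> \<preceq> \<Phi> \<Longrightarrow> \<Phi> \<Vdash> A \<longleftrightarrow> \<Phi> \<Vdash> Ex R"
  show "\<Delta> \<Vdash> rep B"
    by (rule repI[OF \<Delta>(2)]) (use \<Delta>(3) assms(2)[OF ext_trans[OF \<Delta>(1)]] in blast)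
qed

lemma ex_lift: "\<Gamma> \<Vdash> Ex (fren Suc A) \<longleftrightarrow> \<Gamma> \<Vdash> A"
proof
  assume "\<Gamma> \<Vdash> Ex (fren Suc A)"
  then show "\<Gamma> \<Vdash> A" by (rule fm_exE) simp
qed (rule fm_exI[of _ Zr], simp)

lemma rep_of_cond: "\<Gamma> \<Vdash> cond A \<Longrightarrow> \<Gamma> \<Vdash> rep A"
  by (rule repI[of _ "fren Suc A"]) (simp, simp only: ex_lift)

lemma rep_bot: "\<Gamma> \<Vdash> rep Bot"
  by (intro rep_of_cond cond_false)

text \<open>With A replaced by \<open>\<exists>r R(r)\<close>, this is \<open>rep_exand\<close> for
  a B that does not depend on r. Implication reduces to \<open>rep_allimp\<close> in the same
  way.\<close>

lemma rep_and:
  assumes "\<Gamma> \<Vdash> rep A" "\<Gamma> \<Vdash> rep B"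
  shows "\<Gamma> \<Vdash> rep (And A B)"
  using assms(1)
proof (rule repE)
  fix \<Delta> R assume \<Delta>: "\<Gamma> \<preceq> \<Delta>" "\<And>r. \<Delta> \<Vdash> cond (fsub (r ## Var) R)" "\<And>\<Phi>. \<Delta> \<preceq> \<Phi> \<Longrightarrow> \<Phi> \<Vdash> A \<longleftrightarrow> \<Phi> \<Vdash> Ex R"
  have "\<Delta> \<Vdash> rep (Ex (And R (fren Suc B)))"
    by (rule rep_exand[OF \<Delta>(2)]) (use mono[OF assms(2) ext_trans[OF \<Delta>(1)]] in simp)
  then show "\<Delta> \<Vdash> rep (And A B)"
  proof (rule rep_cong)
    fix \<Phi> assume \<Phi>: "\<Delta> \<preceq> \<Phi>"
    show "\<Phi> \<Vdash> Ex (And R (fren Suc B)) \<longleftrightarrow> \<Phi> \<Vdash> And A B"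
    proof
      assume E: "\<Phi> \<Vdash> Ex (And R (fren Suc B))"
      then have "\<Phi> \<Vdash> Ex R" by (rule ex_mono) simp
      moreover from E have "\<Phi> \<Vdash> Ex (fren Suc B)" by (rule ex_mono) simp
      ultimately show "\<Phi> \<Vdash> And A B" by (simp add: \<Delta>(3)[OF \<Phi>] ex_lift del: fren_eq)
    next
      assume A: "\<Phi> \<Vdash> And A B"
      then have "\<Phi> \<Vdash> Ex R" by (simp add: \<Delta>(3)[OF \<Phi>])
      then show "\<Phi> \<Vdash> Ex (And R (fren Suc B))" by (rule ex_mono) (use mono[OF A] in simp)
    qed
  qed
qed

lemma rep_imp:
  assumes "\<Gamma> \<Vdash> rep A" "\<Gamma> \<Vdash> rep B"
  shows "\<Gamma> \<Vdash> rep (Imp A B)"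
  using assms(1)
proof (rule repE)
  fix \<Delta> R assume \<Delta>: "\<Gamma> \<preceq> \<Delta>" "\<And>r. \<Delta> \<Vdash> cond (fsub (r ## Var) R)" "\<And>\<Phi>. \<Delta> \<preceq> \<Phi> \<Longrightarrow> \<Phi> \<Vdash> A \<longleftrightarrow> \<Phi> \<Vdash> Ex R"
  have "\<Delta> \<Vdash> rep (All (Imp R (fren Suc B)))"
    by (rule rep_allimp[OF \<Delta>(2)]) (use mono[OF assms(2) ext_trans[OF \<Delta>(1)]] in simp)
  then show "\<Delta> \<Vdash> rep (Imp A B)"
  proof (rule rep_cong)
    fix \<Phi> assume \<Phi>: "\<Delta> \<preceq> \<Phi>"
    show "\<Phi> \<Vdash> All (Imp R (fren Suc B)) \<longleftrightarrow> \<Phi> \<Vdash> Imp A B"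
    proof
      assume "\<Phi> \<Vdash> All (Imp R (fren Suc B))"
      then have *: "\<Psi> \<Vdash> B" if "\<Phi> \<preceq> \<Psi>" "\<Psi> \<Vdash> fsub (t ## Var) R" for \<Psi> t
        using that by (simp add: all_iff imp_iff)
      have "\<Psi> \<Vdash> B" if l: "\<Phi> \<preceq> \<Psi>" "\<Psi> \<Vdash> A" for \<Psi>
      proof -
        have "\<Psi> \<Vdash> Ex R" using l(2) \<Delta>(3)[OF ext_trans[OF \<Phi> l(1)]] by simp
        then show ?thesis by (rule fm_exE) (auto intro: * ext_trans[OF l(1)])
      qed
      then show "\<Phi> \<Vdash> Imp A B" by (rule fm_impI)
    next
      assume A: "\<Phi> \<Vdash> Imp A B"
      have "\<Psi> \<Vdash> B" if l: "\<Phi> \<preceq> \<Psi>" "\<Psi> \<Vdash> fsub (t ## Var) R" for \<Psi> t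
        using fm_exI[OF l(2)] \<Delta>(3)[OF ext_trans[OF \<Phi> l(1)]] A l(1) by (simp add: imp_iff)
      then show "\<Phi> \<Vdash> All (Imp R (fren Suc B))" by (simp add: all_iff imp_iff)
    qed
  qed
qed

text \<open>A number n names the disjunct, 0 for A and anything else for B. Since
  \<open>n = 0\<close> is decidable, the body is for each n equivalent to A or to B, hence
  representable.\<close>

lemma rep_or:
  assumes "\<Gamma> \<Vdash> rep A" "\<Gamma> \<Vdash> rep B"
  shows "\<Gamma> \<Vdash> rep (Or A B)"
proof -
  let ?B = "\<lambda>n A B. Or (And (Eq n Zr) A) (And (Imp (Eq n Zr) Bot) B)"
  have "\<Gamma> \<Vdash> rep (Ex (And (Eq Zr Zr) (?B (Var 0) (fren Suc A) (fren Suc B))))"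
  proof (rule rep_exand)
    show "\<Gamma> \<Vdash> cond (fsub (n ## Var) (Eq Zr Zr))" for n by (simp add: cond_eq)
    fix \<Delta> n assume \<Delta>: "\<Gamma> \<preceq> \<Delta>"
    have "\<Delta> \<Vdash> rep (?B n A B)"
    proof (rule eq_dec[of \<Delta> n Zr])
      fix \<Phi> assume \<Phi>: "\<Delta> \<preceq> \<Phi>" "\<Phi> \<Vdash> Eq n Zr"
      from mono[OF assms(1) ext_trans[OF \<Delta> \<Phi>(1)]] show "\<Phi> \<Vdash> rep (?B n A B)"
      proof (rule rep_cong)
        fix \<Psi> assume "\<Phi> \<preceq> \<Psi>"
        then have n: "\<Psi> \<Vdash> Eq n Zr" by (rule mono[OF \<Phi>(2)])
        show "\<Psi> \<Vdash> A \<longleftrightarrow> \<Psi> \<Vdash> ?B n A B"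
        proof
          assume "\<Psi> \<Vdash> ?B n A B"
          then show "\<Psi> \<Vdash> A"
          proof (rule orE)
            fix \<Psi>' assume "\<Psi> \<preceq> \<Psi>'" "\<Psi>' \<Vdash> And (Imp (Eq n Zr) Bot) B"
            then show "\<Psi>' \<Vdash> A" using mono[OF n] by (auto intro: botE fm_impE)
          qed simp
        qed (use n in \<open>auto intro!: orI1\<close>)
      qed
    next
      fix \<Phi> assume \<Phi>: "\<Delta> \<preceq> \<Phi>" "\<And>\<Psi> D. \<Phi> \<preceq> \<Psi> \<Longrightarrow> \<Psi> \<Vdash> Eq n Zr \<Longrightarrow> \<Psi> \<Vdash> D"
      from mono[OF assms(2) ext_trans[OF \<Delta> \<Phi>(1)]] show "\<Phi> \<Vdash> rep (?B n A B)"
      proof (rule rep_cong)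
        fix \<Psi> assume l: "\<Phi> \<preceq> \<Psi>"
        show "\<Psi> \<Vdash> B \<longleftrightarrow> \<Psi> \<Vdash> ?B n A B"
        proof
          assume "\<Psi> \<Vdash> ?B n A B"
          then show "\<Psi> \<Vdash> B"
            by (rule orE) (auto intro: \<Phi>(2) ext_trans[OF l])
        next
          assume "\<Psi> \<Vdash> B"
          moreover have "\<Psi> \<Vdash> Imp (Eq n Zr) Bot" by (rule fm_impI) (blast intro: \<Phi>(2) ext_trans[OF l])
          ultimately show "\<Psi> \<Vdash> ?B n A B" by (intro orI2) simp
        qed
      qed
    qed
    then show "\<Delta> \<Vdash> rep (fsub (n ## Var) (?B (Var 0) (fren Suc A) (fren Suc B)))" by simp
  qed
  then show ?thesis
  proof (rule rep_cong)
    fix \<Delta>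
    show "\<Delta> \<Vdash> Ex (And (Eq Zr Zr) (?B (Var 0) (fren Suc A) (fren Suc B))) \<longleftrightarrow> \<Delta> \<Vdash> Or A B" (is "?L \<longleftrightarrow> _")
    proof
      assume ?L
      then show "\<Delta> \<Vdash> Or A B"
      proof (rule fm_exE)
        fix \<Phi> n assume "\<Phi> \<Vdash> fsub (n ## Var) (And (Eq Zr Zr) (?B (Var 0) (fren Suc A) (fren Suc B)))"
        then have "\<Phi> \<Vdash> ?B n A B" by simp
        then show "\<Phi> \<Vdash> Or A B" by (rule orE) (auto intro: orI1 orI2)
      qed
    next
      have nz: "\<Phi> \<Vdash> Imp (Eq (Sc Zr) Zr) Bot" for \<Phi> by (rule fm_impI) (erule suc_nz)
      assume "\<Delta> \<Vdash> Or A B"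
      then show ?L
      proof (rule orE)
        show "\<Phi> \<Vdash> Ex (And (Eq Zr Zr) (?B (Var 0) (fren Suc A) (fren Suc B)))" if "\<Phi> \<Vdash> A" for \<Phi>
          using that by (intro fm_exI[of _ Zr]) (simp add: orI1)
        show "\<Phi> \<Vdash> Ex (And (Eq Zr Zr) (?B (Var 0) (fren Suc A) (fren Suc B)))" if "\<Phi> \<Vdash> B" for \<Phi>
          using that nz by (intro fm_exI[of _ "Sc Zr"]) (simp add: orI2)
      qed
    qed
  qed
qed

subsection \<open>V-sets\<close>

lemma ap_mono:
  assumes "\<Gamma> \<Vdash> ap e n A"
    and "\<And>\<Delta> m. \<Gamma> \<preceq> \<Delta> \<Longrightarrow> \<Delta> \<Vdash> App e n m \<Longrightarrow> \<Delta> \<Vdash> fsub (m ## Var) A \<Longrightarrow> \<Delta> \<Vdash> fsub (m ## Var) B"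
  shows "\<Gamma> \<Vdash> ap e n B"
  using assms(1) by (rule apE) (use assms(2) ap_iff in blast)

text \<open>V1 mentions \<open>xn\<close> in several separate clauses; joined under one
  \<open>ap\<close> they can be evaluated at a single value.\<close>

lemma ap_combine:
  "\<Gamma> \<Vdash> And (defd e n) (And (ap e n A) (Imp (ap e n B) (ap e n C))) \<longleftrightarrow> \<Gamma> \<Vdash> ap e n (And A (Imp B C))"
proof -
  have *: "\<Gamma> \<Vdash> And (ap e n A) (Imp (ap e n B) (ap e n C)) \<longleftrightarrow> \<Gamma> \<Vdash> ap e n (And A (Imp B C))"
    if m: "\<Gamma> \<Vdash> App e n m" for \<Gamma> m
    by (simp add: ap_iff[OF m] imp_iff ap_iff[OF mono[OF m]])
  show ?thesis
  proof
    assume A: "\<Gamma> \<Vdash> And (defd e n) (And (ap e n A) (Imp (ap e n B) (ap e n C)))"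
    then have "\<Gamma> \<Vdash> defd e n" by simp
    then show "\<Gamma> \<Vdash> ap e n (And A (Imp B C))"
    proof (rule defdE)
      fix \<Delta> m assume "\<Gamma> \<preceq> \<Delta>" "\<Delta> \<Vdash> App e n m"
      with mono[OF A] * show "\<Delta> \<Vdash> ap e n (And A (Imp B C))" by (metis and_iff)
    qed
  next
    assume A: "\<Gamma> \<Vdash> ap e n (And A (Imp B C))"
    from defd_of_ap[OF A] show "\<Gamma> \<Vdash> And (defd e n) (And (ap e n A) (Imp (ap e n B) (ap e n C)))"
    proof (rule defdE)
      fix \<Delta> m assume "\<Gamma> \<preceq> \<Delta>" "\<Delta> \<Vdash> App e n m"
      with mono[OF A] * defdI show "\<Delta> \<Vdash> And (defd e n) (And (ap e n A) (Imp (ap e n B) (ap e n C)))"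
        by (metis and_iff)
    qed
  qed
qed

abbreviation step_fm :: "fm \<Rightarrow> fm" where
  "step_fm \<phi> \<equiv> And (MM (snd_tm (Var 0))) (Imp (TT (snd_tm (Var 0))) \<phi>)"

lemma vstep_iff:
  "\<Gamma> \<Vdash> fsub (x ## Var) (vstep \<phi>) \<longleftrightarrow>
    (\<forall>n. \<Gamma> \<Vdash> ap x n (step_fm (fsub (fst_tm (Var 0) ## (\<lambda>i. Var (Suc i))) \<phi>)))"
  unfolding ap_combine[symmetric] by (simp add: vstep_def all_iff)

lemma VVI:
  assumes "\<And>n. \<Gamma> \<Vdash> ap x n (step_fm (VV (fst_tm (Var 0))))"
  shows "\<Gamma> \<Vdash> VV x"
proof -
  have "\<Gamma> \<Vdash> fsub (x ## Var) (vstep (VV (Var 0)))"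
    unfolding vstep_iff using assms by simp
  moreover have "\<Gamma> \<Vdash> fsub (x ## Var) (Imp (vstep (VV (Var 0))) (VV (Var 0)))"
    using axI[OF sys_axiom.V1, of \<Gamma>] unfolding all_iff by blast
  ultimately show ?thesis by (auto intro: fm_impE)
qed

lemma VV_induct:
  assumes "\<Gamma> \<Vdash> VV x"
    and "\<And>\<Delta> x. \<Gamma> \<preceq> \<Delta> \<Longrightarrow> (\<And>n. \<Delta> \<Vdash> ap x n (step_fm (fsub (fst_tm (Var 0) ## (\<lambda>i. Var (Suc i))) \<phi>))) \<Longrightarrow>
      \<Delta> \<Vdash> fsub (x ## Var) \<phi>"
  shows "\<Gamma> \<Vdash> fsub (x ## Var) \<phi>"
proof -
  have "\<Gamma> \<Vdash> All (Imp (vstep \<phi>) \<phi>)"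
    unfolding all_iff fsub.simps imp_iff vstep_iff using assms(2) by blast
  from fm_impE[OF axI[OF sys_axiom.V2] this] have "\<Gamma> \<Vdash> Imp (VV x) (fsub (x ## Var) \<phi>)"
    by (simp add: all_iff)
  then show ?thesis using assms(1) by (rule fm_impE)
qed

text \<open>Inversion of V1, obtained from V2 for the formula that x satisfies the step. The
  induction hypothesis says that the elements satisfy it, and V1 turns this into their being
  v-sets.\<close>

lemma VV_step:
  assumes "\<Gamma> \<Vdash> VV x"
  shows "\<Gamma> \<Vdash> ap x n (step_fm (VV (fst_tm (Var 0))))"
proof -
  let ?\<phi> = "All (ap (Var 1) (Var 0) (step_fm (VV (fst_tm (Var 0)))))"
  have "\<Gamma> \<Vdash> fsub (x ## Var) ?\<phi>"
    using assms
  proof (rule VV_induct)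
    fix \<Delta> x assume A: "\<And>n. \<Delta> \<Vdash> ap x n (step_fm (fsub (fst_tm (Var 0) ## (\<lambda>i. Var (Suc i))) ?\<phi>))"
    have "\<Delta> \<Vdash> ap x n (step_fm (VV (fst_tm (Var 0))))" for n
      using A[of n]
    proof (rule ap_mono)
      fix \<Phi> m assume "\<Phi> \<Vdash> fsub (m ## Var) (step_fm (fsub (fst_tm (Var 0) ## (\<lambda>i. Var (Suc i))) ?\<phi>))"
      then show "\<Phi> \<Vdash> fsub (m ## Var) (step_fm (VV (fst_tm (Var 0))))"
        by (auto simp: imp_iff all_iff intro: VVI)
    qed
    then show "\<Delta> \<Vdash> fsub (x ## Var) ?\<phi>" by (simp add: all_iff)
  qed
  then show ?thesis by (simp add: all_iff)
qed

lemma VV_value: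
  assumes "\<Gamma> \<Vdash> VV x"
    and "\<And>\<Delta> m. \<Gamma> \<preceq> \<Delta> \<Longrightarrow> \<Delta> \<Vdash> App x n m \<Longrightarrow> \<Delta> \<Vdash> MM (snd_tm m) \<Longrightarrow> \<Delta> \<Vdash> C"
  shows "\<Gamma> \<Vdash> C"
  using VV_step[OF assms(1), of n] by (rule apE) (use assms(2) in auto)

lemma inELI:
  assumes "\<Gamma> \<Vdash> App x n m" "\<Gamma> \<Vdash> TT (snd_tm m)" "\<Gamma> \<Vdash> Eq a (fst_tm m)"
  shows "\<Gamma> \<Vdash> inEL a x"
  unfolding inEL_def by (rule fm_exI[of _ n]) (use assms in \<open>simp add: ap_iff\<close>)

lemma inELE:
  assumes "\<Gamma> \<Vdash> inEL a x"
    and C: "\<And>\<Delta> n m. \<Gamma> \<preceq> \<Delta> \<Longrightarrow> \<Delta> \<Vdash> App x n m \<Longrightarrow> \<Delta> \<Vdash> TT (snd_tm m) \<Longrightarrow> \<Delta> \<Vdash> Eq a (fst_tm m) \<Longrightarrow> \<Delta> \<Vdash> C"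
  shows "\<Gamma> \<Vdash> C"
  using assms(1) unfolding inEL_def
proof (rule fm_exE)
  fix \<Delta> n assume \<Delta>: "\<Gamma> \<preceq> \<Delta>" and "\<Delta> \<Vdash> fsub (n ## Var) (ap (lift_tm x) (Var 0) (And (TT (snd_tm (Var 0))) (Eq (lift2_tm a) (fst_tm (Var 0)))))"
  then have "\<Delta> \<Vdash> ap x n (And (TT (snd_tm (Var 0))) (Eq (lift_tm a) (fst_tm (Var 0))))" by simp
  then show "\<Delta> \<Vdash> C" by (rule apE) (auto intro: C ext_trans[OF \<Delta>])
qed

lemma VV_value_elem:
  assumes "\<Gamma> \<Vdash> VV x" "\<Gamma> \<Vdash> App x n m" "\<Gamma> \<Vdash> TT (snd_tm m)"
  shows "\<Gamma> \<Vdash> VV (fst_tm m)"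
  using VV_step[OF assms(1), of n] assms(2,3) by (auto simp: ap_iff intro: fm_impE)

lemma VV_elem:
  assumes "\<Gamma> \<Vdash> VV x" "\<Gamma> \<Vdash> inEL a x"
  shows "\<Gamma> \<Vdash> VV a"
  using assms(2)
proof (rule inELE)
  fix \<Delta> n m assume \<Delta>: "\<Gamma> \<preceq> \<Delta>" "\<Delta> \<Vdash> App x n m" "\<Delta> \<Vdash> TT (snd_tm m)" "\<Delta> \<Vdash> Eq a (fst_tm m)"
  show "\<Delta> \<Vdash> VV a"
    using VV_value_elem[OF mono[OF assms(1) \<Delta>(1)] \<Delta>(2,3)] eq_fsub[OF \<Delta>(4), of Var "VV (Var 0)"] by simp
qed

text \<open>The hypothesis of V2 does not provide \<open>VV x\<close> and speaks of values rather
  than of members. Strengthening the formula by \<open>VV\<close> supplies the former, and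
  replacement of equals reaches all members of EL(x).\<close>

lemma set_induct:
  assumes "\<Gamma> \<Vdash> VV x"
    and step: "\<And>\<Delta> x. \<Gamma> \<preceq> \<Delta> \<Longrightarrow> \<Delta> \<Vdash> VV x \<Longrightarrow> (\<And>\<Phi> a. \<Delta> \<preceq> \<Phi> \<Longrightarrow> \<Phi> \<Vdash> inEL a x \<Longrightarrow> \<Phi> \<Vdash> fsub (a ## Var) \<phi>) \<Longrightarrow>
      \<Delta> \<Vdash> fsub (x ## Var) \<phi>"
  shows "\<Gamma> \<Vdash> fsub (x ## Var) \<phi>"
proof -
  have "\<Gamma> \<Vdash> fsub (x ## Var) (And \<phi> (VV (Var 0)))"
    using assms(1)
  proof (rule VV_induct)
    fix \<Delta> x assume \<Delta>: "\<Gamma> \<preceq> \<Delta>"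
      and A: "\<And>n. \<Delta> \<Vdash> ap x n (step_fm (fsub (fst_tm (Var 0) ## (\<lambda>i. Var (Suc i))) (And \<phi> (VV (Var 0)))))"
    have "\<Delta> \<Vdash> ap x n (step_fm (VV (fst_tm (Var 0))))" for n
      using A[of n] by (rule ap_mono) (auto simp: imp_iff)
    then have x: "\<Delta> \<Vdash> VV x" by (rule VVI)
    moreover have "\<Delta> \<Vdash> fsub (x ## Var) \<phi>"
    proof (rule step[OF \<Delta> x])
      fix \<Phi> a assume \<Phi>: "\<Delta> \<preceq> \<Phi>" "\<Phi> \<Vdash> inEL a x"
      from \<Phi>(2) show "\<Phi> \<Vdash> fsub (a ## Var) \<phi>"
      proof (rule inELE)
        fix \<Psi> n m assume l: "\<Phi> \<preceq> \<Psi>" "\<Psi> \<Vdash> App x n m" "\<Psi> \<Vdash> TT (snd_tm m)" "\<Psi> \<Vdash> Eq a (fst_tm m)"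
        have "\<Psi> \<Vdash> fsub (fst_tm m ## Var) \<phi>"
          using mono[OF A[of n] ext_trans[OF \<Phi>(1) l(1)]] l(2,3) by (auto simp: ap_iff imp_iff)
        then show "\<Psi> \<Vdash> fsub (a ## Var) \<phi>" using eq_fsub[OF l(4)] by blast
      qed
    qed
    ultimately show "\<Delta> \<Vdash> fsub (x ## Var) (And \<phi> (VV (Var 0)))" by simp
  qed
  then show ?thesis by simp
qed

section \<open>Quantifiers over EL(x) as quantifiers over indices\<close>

abbreviation dom_fm :: "tm \<Rightarrow> fm" where
  "dom_fm x \<equiv> ap (lift_tm x) (Var 0) (TT (snd_tm (Var 0)))"

abbreviation elem_fm :: "tm \<Rightarrow> fm \<Rightarrow> fm" where
  "elem_fm x A \<equiv> ap (lift_tm x) (Var 0) (fsub (fst_tm (Var 0) ## (\<lambda>i. Var (i + 2))) A)"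

lemma inst_elem_fm:
  "fsub (n ## Var) (dom_fm x) = ap x n (TT (snd_tm (Var 0)))"
  "fsub (n ## Var) (elem_fm x A) = ap x n (fsub (fst_tm (Var 0) ## (\<lambda>i. Var (Suc i))) A)"
  by simp_all

lemma dom_elem_value:
  assumes "\<Gamma> \<Vdash> App x n m"
  shows "\<Gamma> \<Vdash> fsub (n ## Var) (dom_fm x) \<longleftrightarrow> \<Gamma> \<Vdash> TT (snd_tm m)"
    "\<Gamma> \<Vdash> fsub (n ## Var) (elem_fm x A) \<longleftrightarrow> \<Gamma> \<Vdash> fsub (fst_tm m ## Var) A"
  unfolding inst_elem_fm ap_iff[OF assms] by simp_all

lemma cond_dom_fm:
  assumes "\<Gamma> \<Vdash> VV x"
  shows "\<Gamma> \<Vdash> cond (fsub (n ## Var) (dom_fm x))"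
  using assms
proof (rule VV_value)
  fix \<Delta> m assume \<Delta>: "\<Delta> \<Vdash> App x n m" "\<Delta> \<Vdash> MM (snd_tm m)"
  show "\<Delta> \<Vdash> cond (fsub (n ## Var) (dom_fm x))"
    by (rule condI[OF \<Delta>(2)]) (simp only: dom_elem_value[OF mono[OF \<Delta>(1)]])
qed

lemma dom_fmE:
  assumes "\<Gamma> \<Vdash> fsub (n ## Var) (dom_fm x)"
    and "\<And>\<Delta> m. \<Gamma> \<preceq> \<Delta> \<Longrightarrow> \<Delta> \<Vdash> App x n m \<Longrightarrow> \<Delta> \<Vdash> TT (snd_tm m) \<Longrightarrow> \<Delta> \<Vdash> C"
  shows "\<Gamma> \<Vdash> C"
  using assms(1) unfolding inst_elem_fm by (rule apE) (use assms(2) in simp)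

lemma rep_elem_fm:
  assumes x: "\<Gamma> \<Vdash> VV x"
    and A: "\<And>\<Delta> a. \<Gamma> \<preceq> \<Delta> \<Longrightarrow> \<Delta> \<Vdash> inEL a x \<Longrightarrow> \<Delta> \<Vdash> VV a \<Longrightarrow> \<Delta> \<Vdash> rep (fsub (a ## Var) A)"
    and n: "\<Gamma> \<preceq> \<Delta>" "\<Delta> \<Vdash> fsub (n ## Var) (dom_fm x)"
  shows "\<Delta> \<Vdash> rep (fsub (n ## Var) (elem_fm x A))"
  using n(2)
proof (rule dom_fmE)
  fix \<Phi> m assume \<Phi>: "\<Delta> \<preceq> \<Phi>" "\<Phi> \<Vdash> App x n m" "\<Phi> \<Vdash> TT (snd_tm m)"
  note e = ext_trans[OF n(1) \<Phi>(1)]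
  have "\<Phi> \<Vdash> rep (fsub (fst_tm m ## Var) A)"
    by (rule A[OF e inELI[OF \<Phi>(2,3) eq_refl] VV_value_elem[OF mono[OF x e] \<Phi>(2,3)]])
  then show "\<Phi> \<Vdash> rep (fsub (n ## Var) (elem_fm x A))"
    by (rule rep_cong) (simp only: dom_elem_value[OF mono[OF \<Phi>(2)]])
qed

lemma rep_ball:
  assumes x: "\<Gamma> \<Vdash> VV x"
    and A: "\<And>\<Delta> a. \<Gamma> \<preceq> \<Delta> \<Longrightarrow> \<Delta> \<Vdash> inEL a x \<Longrightarrow> \<Delta> \<Vdash> VV a \<Longrightarrow> \<Delta> \<Vdash> rep (fsub (a ## Var) A)"
  shows "\<Gamma> \<Vdash> rep (All (Imp (inEL (Var 0) (lift_tm x)) A))"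
proof -
  have "\<Gamma> \<Vdash> rep (All (Imp (dom_fm x) (elem_fm x A)))"
    by (rule rep_allimp[OF cond_dom_fm[OF x] rep_elem_fm[OF x A]])
  then show ?thesis
  proof (rule rep_cong)
    fix \<Delta>
    have 1: "\<Delta> \<Vdash> All (Imp (inEL (Var 0) (lift_tm x)) A) \<longleftrightarrow>
        (\<forall>a \<Phi>. \<Delta> \<preceq> \<Phi> \<longrightarrow> \<Phi> \<Vdash> inEL a x \<longrightarrow> \<Phi> \<Vdash> fsub (a ## Var) A)"
      by (simp add: all_iff imp_iff)
    have 2: "\<Delta> \<Vdash> All (Imp (dom_fm x) (elem_fm x A)) \<longleftrightarrow>
        (\<forall>n \<Phi>. \<Delta> \<preceq> \<Phi> \<longrightarrow> \<Phi> \<Vdash> fsub (n ## Var) (dom_fm x) \<longrightarrow> \<Phi> \<Vdash> fsub (n ## Var) (elem_fm x A))"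
      unfolding all_iff by (simp only: fsub.simps imp_iff)
    show "\<Delta> \<Vdash> All (Imp (dom_fm x) (elem_fm x A)) \<longleftrightarrow> \<Delta> \<Vdash> All (Imp (inEL (Var 0) (lift_tm x)) A)"
      unfolding 1 2
    proof (intro iffI HOL.allI HOL.impI)
      fix a \<Phi> assume L: "\<forall>n \<Phi>. \<Delta> \<preceq> \<Phi> \<longrightarrow> \<Phi> \<Vdash> fsub (n ## Var) (dom_fm x) \<longrightarrow> \<Phi> \<Vdash> fsub (n ## Var) (elem_fm x A)"
        and \<Phi>: "\<Delta> \<preceq> \<Phi>" "\<Phi> \<Vdash> inEL a x"
      from \<Phi>(2) show "\<Phi> \<Vdash> fsub (a ## Var) A"
      proof (rule inELE)
        fix \<Psi> n m assume l: "\<Phi> \<preceq> \<Psi>" "\<Psi> \<Vdash> App x n m" "\<Psi> \<Vdash> TT (snd_tm m)" "\<Psi> \<Vdash> Eq a (fst_tm m)"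
        then show "\<Psi> \<Vdash> fsub (a ## Var) A"
          using L[rule_format, OF ext_trans[OF \<Phi>(1) l(1)], of n] unfolding dom_elem_value[OF l(2)] eq_fsub[OF l(4)]
          by blast
      qed
    next
      fix n \<Phi> assume R: "\<forall>a \<Phi>. \<Delta> \<preceq> \<Phi> \<longrightarrow> \<Phi> \<Vdash> inEL a x \<longrightarrow> \<Phi> \<Vdash> fsub (a ## Var) A"
        and \<Phi>: "\<Delta> \<preceq> \<Phi>" "\<Phi> \<Vdash> fsub (n ## Var) (dom_fm x)"
      from \<Phi>(2) show "\<Phi> \<Vdash> fsub (n ## Var) (elem_fm x A)"
      proof (rule dom_fmE)
        fix \<Psi> m assume l: "\<Phi> \<preceq> \<Psi>" "\<Psi> \<Vdash> App x n m" "\<Psi> \<Vdash> TT (snd_tm m)"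
        then show "\<Psi> \<Vdash> fsub (n ## Var) (elem_fm x A)"
          unfolding dom_elem_value[OF l(2)] using R ext_trans[OF \<Phi>(1) l(1)] inELI[OF l(2,3) eq_refl] by blast
      qed
    qed
  qed
qed

lemma rep_bex:
  assumes x: "\<Gamma> \<Vdash> VV x"
    and A: "\<And>\<Delta> a. \<Gamma> \<preceq> \<Delta> \<Longrightarrow> \<Delta> \<Vdash> inEL a x \<Longrightarrow> \<Delta> \<Vdash> VV a \<Longrightarrow> \<Delta> \<Vdash> rep (fsub (a ## Var) A)"
  shows "\<Gamma> \<Vdash> rep (Ex (And (inEL (Var 0) (lift_tm x)) A))"
proof -
  have "\<Gamma> \<Vdash> rep (Ex (And (dom_fm x) (elem_fm x A)))"
    by (rule rep_exand[OF cond_dom_fm[OF x] rep_elem_fm[OF x A]])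
  then show ?thesis
  proof (rule rep_cong)
    fix \<Delta>
    show "\<Delta> \<Vdash> Ex (And (dom_fm x) (elem_fm x A)) \<longleftrightarrow> \<Delta> \<Vdash> Ex (And (inEL (Var 0) (lift_tm x)) A)"
    proof
      assume "\<Delta> \<Vdash> Ex (And (dom_fm x) (elem_fm x A))"
      then show "\<Delta> \<Vdash> Ex (And (inEL (Var 0) (lift_tm x)) A)"
      proof (rule fm_exE)
        fix \<Phi> n assume "\<Phi> \<Vdash> fsub (n ## Var) (And (dom_fm x) (elem_fm x A))"
        then have \<Phi>: "\<Phi> \<Vdash> fsub (n ## Var) (dom_fm x)" "\<Phi> \<Vdash> fsub (n ## Var) (elem_fm x A)"
          by (simp_all only: fsub.simps and_iff)
        from \<Phi>(1) show "\<Phi> \<Vdash> Ex (And (inEL (Var 0) (lift_tm x)) A)"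
        proof (rule dom_fmE)
          fix \<Psi> m assume l: "\<Phi> \<preceq> \<Psi>" "\<Psi> \<Vdash> App x n m" "\<Psi> \<Vdash> TT (snd_tm m)"
          then show "\<Psi> \<Vdash> Ex (And (inEL (Var 0) (lift_tm x)) A)"
            using mono[OF \<Phi>(2) l(1)] inELI[OF l(2,3) eq_refl] unfolding dom_elem_value[OF l(2)]
            by (intro fm_exI[of _ "fst_tm m"]) simp
        qed
      qed
    next
      assume "\<Delta> \<Vdash> Ex (And (inEL (Var 0) (lift_tm x)) A)"
      then show "\<Delta> \<Vdash> Ex (And (dom_fm x) (elem_fm x A))"
      proof (rule fm_exE)
        fix \<Phi> a assume "\<Phi> \<Vdash> fsub (a ## Var) (And (inEL (Var 0) (lift_tm x)) A)"
        then have \<Phi>: "\<Phi> \<Vdash> inEL a x" "\<Phi> \<Vdash> fsub (a ## Var) A" by simp_all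
        from \<Phi>(1) show "\<Phi> \<Vdash> Ex (And (dom_fm x) (elem_fm x A))"
        proof (rule inELE)
          fix \<Psi> n m assume l: "\<Phi> \<preceq> \<Psi>" "\<Psi> \<Vdash> App x n m" "\<Psi> \<Vdash> TT (snd_tm m)" "\<Psi> \<Vdash> Eq a (fst_tm m)"
          show "\<Psi> \<Vdash> Ex (And (dom_fm x) (elem_fm x A))"
            by (rule fm_exI[of _ n]) (use l mono[OF \<Phi>(2) l(1)] in \<open>simp only: fsub.simps and_iff dom_elem_value[OF l(2)] eq_fsub[OF l(4)]\<close>)
        qed
      qed
    qed
  qed
qed

text \<open>The set z is not written down as an index. It suffices to describe for each k a suitable
  value m of \<open>zk\<close> and to prove that one exists; ECT then yields z.\<close>

lemma subset_of_rep:
  assumes y: "\<Gamma> \<Vdash> VV y"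
    and A: "\<And>\<Delta> a. \<Gamma> \<preceq> \<Delta> \<Longrightarrow> \<Delta> \<Vdash> inEL a y \<Longrightarrow> \<Delta> \<Vdash> VV a \<Longrightarrow> \<Delta> \<Vdash> rep (fsub (a ## Var) A)"
    and C: "\<And>\<Delta> z. \<Gamma> \<preceq> \<Delta> \<Longrightarrow> \<Delta> \<Vdash> VV z \<Longrightarrow>
      (\<And>\<Phi> a. \<Delta> \<preceq> \<Phi> \<Longrightarrow> \<Phi> \<Vdash> inEL a z \<longleftrightarrow> \<Phi> \<Vdash> inEL a y \<and> \<Phi> \<Vdash> fsub (a ## Var) A) \<Longrightarrow> \<Delta> \<Vdash> C"
  shows "\<Gamma> \<Vdash> C"
proof (rule rep_family[OF cond_dom_fm[OF y] rep_elem_fm[OF y A]])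
  let ?P = "dom_fm y" and ?B = "elem_fm y A"
  fix \<Delta> Q assume \<Delta>: "\<Gamma> \<preceq> \<Delta>"
    and Q1: "\<And>\<Phi> n r. \<Delta> \<preceq> \<Phi> \<Longrightarrow> \<Phi> \<Vdash> fsub (n ## Var) ?P \<Longrightarrow> \<Phi> \<Vdash> cond (fsub (r ## n ## Var) Q)"
    and Q2: "\<And>\<Phi> n. \<Delta> \<preceq> \<Phi> \<Longrightarrow> \<Phi> \<Vdash> fsub (n ## Var) ?P \<Longrightarrow> \<Phi> \<Vdash> fsub (n ## Var) ?B \<longleftrightarrow> \<Phi> \<Vdash> Ex (under n Q)"
  \<comment> \<open>k stands for a pair \<open>\<langle>n, r\<rangle>\<close>. The order of the
    conjuncts matters: Q is a condition only once n is known to be in the domain.\<close>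
  define R where "R k = And (fsub (fst_tm k ## Var) ?P) (fsub (snd_tm k ## fst_tm k ## Var) Q)" for k
  define R0 where "R0 = And (fsub (fst_tm (Var 0) ## (\<lambda>i. Var (Suc i))) ?P)
     (fsub (snd_tm (Var 0) ## fst_tm (Var 0) ## (\<lambda>i. Var (Suc i))) Q)"
  have R0: "fsub (k ## Var) R0 = R k" for k by (simp add: R_def R0_def)
  have condR: "\<Delta> \<Vdash> cond (R k)" for k
    unfolding R_def by (intro cond_and cond_dom_fm mono[OF y \<Delta>] Q1)
  \<comment> \<open>\<psi>(k, m) fixes the element part of m by y and its condition part as a
    meaningful code of R(k). As y is total, such an m exists for every k, whether or not R(k)
    holds.\<close>
  define \<psi> where "\<psi> = And (ap (lift2_tm y) (fst_tm (Var 1)) (Eq (fst_tm (Var 0)) (fst_tm (Var 1))))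
      (And (MM (snd_tm (Var 0))) (Iff (TT (snd_tm (Var 0))) (fren Suc R0)))"
  have \<psi>: "fsub (m ## k ## Var) \<psi> = And (ap y (fst_tm k) (Eq (fst_tm (Var 0)) (fst_tm (lift_tm m))))
      (And (MM (snd_tm m)) (Iff (TT (snd_tm m)) (R k)))" for m k
    by (simp add: \<psi>_def R0)
  have "\<Delta> \<Vdash> Ex (under k \<psi>)" for k
  proof (rule VV_value[OF mono[OF y \<Delta>], of "fst_tm k"])
    fix \<Phi> v assume \<Phi>: "\<Delta> \<preceq> \<Phi>" "\<Phi> \<Vdash> App y (fst_tm k) v"
    from mono[OF condR[of k] \<Phi>(1)] show "\<Phi> \<Vdash> Ex (under k \<psi>)"
    proof (rule condE)
      fix \<Psi> c assume l: "\<Phi> \<preceq> \<Psi>" "\<Psi> \<Vdash> MM c" "\<And>\<Psi>'. \<Psi> \<preceq> \<Psi>' \<Longrightarrow> \<Psi>' \<Vdash> TT c \<longleftrightarrow> \<Psi>' \<Vdash> R k"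
      let ?m = "pair_tm (fst_tm v) c"
      have "\<Psi> \<Vdash> ap y (fst_tm k) (Eq (fst_tm (Var 0)) (fst_tm (lift_tm ?m)))"
        unfolding ap_iff[OF mono[OF \<Phi>(2) l(1)]] using eq_sym[OF fst_pair] by simp
      moreover have "\<Psi> \<Vdash> MM (snd_tm ?m)"
        using eq_fsub[OF snd_pair, of \<Psi> "fst_tm v" c Var "MM (Var 0)"] l(2) by simp
      moreover have "\<Psi>' \<Vdash> TT (snd_tm ?m) \<longleftrightarrow> \<Psi>' \<Vdash> R k" if "\<Psi> \<preceq> \<Psi>'" for \<Psi>'
        using eq_fsub[OF snd_pair, of \<Psi>' "fst_tm v" c Var "TT (Var 0)"] l(3)[OF that] by simp
      ultimately have "\<Psi> \<Vdash> fsub (?m ## k ## Var) \<psi>"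
        unfolding \<psi> and_iff iff_iff by blast
      then show "\<Psi> \<Vdash> Ex (under k \<psi>)" by (intro fm_exI[of _ ?m]) simp
    qed
  qed
  then show "\<Delta> \<Vdash> C"
  proof (rule ect_total)
    fix \<Phi> z assume \<Phi>: "\<Delta> \<preceq> \<Phi>" and z: "\<And>k. \<Phi> \<Vdash> ap z k (under k \<psi>)"
    have val: "\<Psi> \<Vdash> ap y (fst_tm k) (Eq (fst_tm (Var 0)) (fst_tm (lift_tm m)))" "\<Psi> \<Vdash> MM (snd_tm m)"
        "\<Psi> \<Vdash> TT (snd_tm m) \<longleftrightarrow> \<Psi> \<Vdash> R k"
      if "\<Phi> \<preceq> \<Psi>" "\<Psi> \<Vdash> App z k m" for \<Psi> k m
    proof -
      have "\<Psi> \<Vdash> fsub (m ## k ## Var) \<psi>" using mono[OF z[of k] that(1)] ap_iff[OF that(2)] by simp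
      then show "\<Psi> \<Vdash> ap y (fst_tm k) (Eq (fst_tm (Var 0)) (fst_tm (lift_tm m)))" "\<Psi> \<Vdash> MM (snd_tm m)"
        "\<Psi> \<Vdash> TT (snd_tm m) \<longleftrightarrow> \<Psi> \<Vdash> R k"
        unfolding \<psi> and_iff iff_iff by auto
    qed
    \<comment> \<open>A true condition of z at k yields an index of y with a true condition and the
      same element, together with A for it. This serves both the proof that z is a v-set and the
      inclusion of z in y.\<close>
    have valE: "\<Psi> \<Vdash> D" if "\<Phi> \<preceq> \<Psi>" "\<Psi> \<Vdash> App z k m" "\<Psi> \<Vdash> TT (snd_tm m)"
      "\<And>\<Psi>' v. \<Psi> \<preceq> \<Psi>' \<Longrightarrow> \<Psi>' \<Vdash> App y (fst_tm k) v \<Longrightarrow> \<Psi>' \<Vdash> TT (snd_tm v) \<Longrightarrow> \<Psi>' \<Vdash> Eq (fst_tm v) (fst_tm m)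
        \<Longrightarrow> \<Psi>' \<Vdash> fsub (fst_tm m ## Var) A \<Longrightarrow> \<Psi>' \<Vdash> D" for \<Psi> k m D
    proof -
      have k: "\<Psi> \<Vdash> fsub (fst_tm k ## Var) ?P" "\<Psi> \<Vdash> fsub (snd_tm k ## fst_tm k ## Var) Q"
        using val(3)[OF that(1,2)] that(3) unfolding R_def and_iff by auto
      have B: "\<Psi> \<Vdash> fsub (fst_tm k ## Var) ?B"
        unfolding Q2[OF ext_trans[OF \<Phi> that(1)] k(1)] by (rule fm_exI[of _ "snd_tm k"]) (use k(2) in simp)
      from k(1) show "\<Psi> \<Vdash> D"
      proof (rule dom_fmE)
        fix \<Psi>' v assume l: "\<Psi> \<preceq> \<Psi>'" "\<Psi>' \<Vdash> App y (fst_tm k) v" "\<Psi>' \<Vdash> TT (snd_tm v)"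
        have e: "\<Psi>' \<Vdash> Eq (fst_tm v) (fst_tm m)"
          using mono[OF val(1)[OF that(1,2)] l(1)] unfolding ap_iff[OF l(2)] by simp
        have "\<Psi>' \<Vdash> fsub (fst_tm v ## Var) A"
          using mono[OF B l(1)] unfolding dom_elem_value[OF l(2)] .
        then have "\<Psi>' \<Vdash> fsub (fst_tm m ## Var) A" unfolding eq_fsub[OF e] .
        then show "\<Psi>' \<Vdash> D" by (rule that(4)[OF l e])
      qed
    qed
    have "\<Phi> \<Vdash> VV z"
    proof (rule VVI)
      fix k
      from z[of k] show "\<Phi> \<Vdash> ap z k (step_fm (VV (fst_tm (Var 0))))"
      proof (rule ap_mono)
        fix \<Psi> m assume l: "\<Phi> \<preceq> \<Psi>" "\<Psi> \<Vdash> App z k m"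
        have "\<Psi>' \<Vdash> VV (fst_tm m)" if l': "\<Psi> \<preceq> \<Psi>'" "\<Psi>' \<Vdash> TT (snd_tm m)" for \<Psi>'
        proof (rule valE[OF ext_trans[OF l(1) l'(1)] mono[OF l(2) l'(1)] l'(2)])
          fix \<Psi>'' v assume v: "\<Psi>' \<preceq> \<Psi>''" "\<Psi>'' \<Vdash> App y (fst_tm k) v" "\<Psi>'' \<Vdash> TT (snd_tm v)" "\<Psi>'' \<Vdash> Eq (fst_tm v) (fst_tm m)"
          have "\<Psi>'' \<Vdash> VV y"
            by (rule mono[OF y ext_trans[OF \<Delta> ext_trans[OF \<Phi> ext_trans[OF l(1) ext_trans[OF l'(1) v(1)]]]]])
          from VV_value_elem[OF this v(2,3)] show "\<Psi>'' \<Vdash> VV (fst_tm m)"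
            using eq_fsub[OF v(4), of Var "VV (Var 0)"] by simp
        qed
        with val(2)[OF l] show "\<Psi> \<Vdash> fsub (m ## Var) (step_fm (VV (fst_tm (Var 0))))" by (simp add: imp_iff)
      qed
    qed
    then show "\<Phi> \<Vdash> C"
    proof (rule C[OF ext_trans[OF \<Delta> \<Phi>]])
      fix \<Psi> a assume l: "\<Phi> \<preceq> \<Psi>"
      show "\<Psi> \<Vdash> inEL a z \<longleftrightarrow> \<Psi> \<Vdash> inEL a y \<and> \<Psi> \<Vdash> fsub (a ## Var) A"
      proof
        assume "\<Psi> \<Vdash> inEL a z"
        then have "\<Psi> \<Vdash> And (inEL a y) (fsub (a ## Var) A)"
        proof (rule inELE)
          fix \<Psi>' k m assume l': "\<Psi> \<preceq> \<Psi>'" "\<Psi>' \<Vdash> App z k m" "\<Psi>' \<Vdash> TT (snd_tm m)" "\<Psi>' \<Vdash> Eq a (fst_tm m)"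
          show "\<Psi>' \<Vdash> And (inEL a y) (fsub (a ## Var) A)"
          proof (rule valE[OF ext_trans[OF l l'(1)] l'(2,3)])
            fix \<Psi>'' v assume v: "\<Psi>' \<preceq> \<Psi>''" "\<Psi>'' \<Vdash> App y (fst_tm k) v" "\<Psi>'' \<Vdash> TT (snd_tm v)"
              "\<Psi>'' \<Vdash> Eq (fst_tm v) (fst_tm m)" "\<Psi>'' \<Vdash> fsub (fst_tm m ## Var) A"
            note a = mono[OF l'(4) v(1)]
            show "\<Psi>'' \<Vdash> And (inEL a y) (fsub (a ## Var) A)"
              using inELI[OF v(2,3) eq_trans[OF a eq_sym[OF v(4)]]] v(5) unfolding and_iff eq_fsub[OF a] by blast
          qed
        qed
        then show "\<Psi> \<Vdash> inEL a y \<and> \<Psi> \<Vdash> fsub (a ## Var) A" by simp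
      next
        assume a: "\<Psi> \<Vdash> inEL a y \<and> \<Psi> \<Vdash> fsub (a ## Var) A"
        then have "\<Psi> \<Vdash> inEL a y" by simp
        then show "\<Psi> \<Vdash> inEL a z"
        proof (rule inELE)
          fix \<Psi>' n v assume l': "\<Psi> \<preceq> \<Psi>'" "\<Psi>' \<Vdash> App y n v" "\<Psi>' \<Vdash> TT (snd_tm v)" "\<Psi>' \<Vdash> Eq a (fst_tm v)"
          have "\<Psi>' \<Vdash> fsub (a ## Var) A" using a mono[OF _ l'(1)] by blast
          then have "\<Psi>' \<Vdash> fsub (n ## Var) ?B" unfolding dom_elem_value[OF l'(2)] eq_fsub[OF l'(4)] .
          moreover have P: "\<Psi>' \<Vdash> fsub (n ## Var) ?P" unfolding dom_elem_value[OF l'(2)] by (rule l'(3))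
          ultimately have "\<Psi>' \<Vdash> Ex (under n Q)"
            using Q2[OF ext_trans[OF \<Phi> ext_trans[OF l l'(1)]] P] by blast
          then show "\<Psi>' \<Vdash> inEL a z"
          proof (rule fm_exE)
            fix \<Psi>'' r assume r: "\<Psi>' \<preceq> \<Psi>''" "\<Psi>'' \<Vdash> fsub (r ## Var) (under n Q)"
            \<comment> \<open>The index n of a in y paired with a realizer r of A(a) is an index
              under which a enters z.\<close>
            let ?k = "pair_tm n r"
            note e = ext_trans[OF l ext_trans[OF l'(1) r(1)]]
            have R: "\<Psi>'' \<Vdash> R ?k"
              unfolding R_def and_iff pair_fsub using mono[OF P r(1)] r(2) by simp
            from mono[OF z[of ?k] e] show "\<Psi>'' \<Vdash> inEL a z"
            proof (rule apE)
              fix \<Psi>3 m assume m: "\<Psi>'' \<preceq> \<Psi>3" "\<Psi>3 \<Vdash> App z ?k m"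
              note vm = val[OF ext_trans[OF e m(1)] m(2)]
              have "\<Psi>3 \<Vdash> ap y n (Eq (fst_tm (Var 0)) (fst_tm (lift_tm m)))"
                using vm(1) eq_fsub[OF fst_pair, of \<Psi>3 n r Var "ap (lift_tm y) (Var 0) (Eq (fst_tm (Var 0)) (fst_tm (lift2_tm m)))"]
                by simp
              then have "\<Psi>3 \<Vdash> Eq (fst_tm v) (fst_tm m)"
                unfolding ap_iff[OF mono[OF l'(2) ext_trans[OF r(1) m(1)]]] by simp
              with mono[OF l'(4) ext_trans[OF r(1) m(1)]] have "\<Psi>3 \<Vdash> Eq a (fst_tm m)" by (rule eq_trans)
              then show "\<Psi>3 \<Vdash> inEL a z"
                using vm(3) mono[OF R m(1)] by (intro inELI[OF m(2)]) blast
            qed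
          qed
        qed
      qed
    qed
  qed
qed

end

subsection \<open>Bounded separation\<close>

locale vset_equality = vsystem +
  fixes E :: fm
  assumes ext_E: "ext_equality \<xi> E"
begin

text \<open>Opaque for the same reason as \<open>XI\<close>: the formula E is unknown and should not
  be substituted into.\<close>

definition EE :: "tm \<Rightarrow> tm \<Rightarrow> fm" where
  "EE s t = rel_fm E s t"

lemma fsub_EE [simp]: "fsub \<sigma> (EE s t) = EE (tsub \<sigma> s) (tsub \<sigma> t)"
  by (simp add: EE_def)

abbreviation mem :: "tm \<Rightarrow> tm \<Rightarrow> fm" where
  "mem x y \<equiv> Ex (And (inEL (Var 0) (lift_tm y)) (EE (lift_tm x) (Var 0)))"

lemma memI: "\<Gamma> \<Vdash> inEL a y \<Longrightarrow> \<Gamma> \<Vdash> EE x a \<Longrightarrow> \<Gamma> \<Vdash> mem x y"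
  by (rule fm_exI[of _ a]) simp

lemma memE:
  assumes "\<Gamma> \<Vdash> mem x y" and "\<And>\<Delta> a. \<Gamma> \<preceq> \<Delta> \<Longrightarrow> \<Delta> \<Vdash> inEL a y \<Longrightarrow> \<Delta> \<Vdash> EE x a \<Longrightarrow> \<Delta> \<Vdash> C"
  shows "\<Gamma> \<Vdash> C"
  using assms(1) by (rule fm_exE) (auto intro: assms(2))

abbreviation sub :: "tm \<Rightarrow> tm \<Rightarrow> fm" where
  "sub x y \<equiv> All (Imp (inEL (Var 0) (lift_tm x)) (mem (Var 0) (lift_tm y)))"

lemma sub_iff: "\<Gamma> \<Vdash> sub x y \<longleftrightarrow> (\<forall>a \<Delta>. \<Gamma> \<preceq> \<Delta> \<longrightarrow> \<Delta> \<Vdash> inEL a x \<longrightarrow> \<Delta> \<Vdash> mem a y)"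
  by (simp add: all_iff imp_iff)

lemma EE_iff:
  assumes "\<Gamma> \<Vdash> VV x" "\<Gamma> \<Vdash> VV y"
  shows "\<Gamma> \<Vdash> EE x y \<longleftrightarrow> \<Gamma> \<Vdash> sub x y \<and> \<Gamma> \<Vdash> sub y x"
proof -
  have "[] \<Vdash> All (All (Imp (And (VV (Var 1)) (VV (Var 0))) (Iff (EE (Var 1) (Var 0))
      (And (sub (Var 1) (Var 0)) (sub (Var 0) (Var 1))))))"
    using ext_E unfolding ext_equality_def provable_def force_def EE_def
    by (simp add: numeral_2_eq_2 numeral_3_eq_3 del: Var_numeral)
  then have "\<Gamma> \<Vdash> All (All (Imp (And (VV (Var 1)) (VV (Var 0))) (Iff (EE (Var 1) (Var 0))
      (And (sub (Var 1) (Var 0)) (sub (Var 0) (Var 1))))))"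
    by (rule mono) (simp add: extends_def)
  then have "\<Gamma> \<Vdash> Imp (And (VV x) (VV y)) (Iff (EE x y) (And (sub x y) (sub y x)))"
    by (simp add: all_iff)
  then have "\<Gamma> \<Vdash> Iff (EE x y) (And (sub x y) (sub y x))" by (rule fm_impE) (simp add: assms)
  then show ?thesis unfolding and_iff[of \<Gamma> "Imp _ _"] iff_iff by (metis and_iff ext_refl)
qed

section \<open>Extensional equality is a representable equivalence relation\<close>

lemma EE_sym: "\<Gamma> \<Vdash> VV x \<Longrightarrow> \<Gamma> \<Vdash> VV y \<Longrightarrow> \<Gamma> \<Vdash> EE x y \<Longrightarrow> \<Gamma> \<Vdash> EE y x"
  using EE_iff by blast

lemma EE_refl:
  assumes "\<Gamma> \<Vdash> VV x"
  shows "\<Gamma> \<Vdash> EE x x"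
proof -
  have "\<Gamma> \<Vdash> fsub (x ## Var) (EE (Var 0) (Var 0))"
    using assms
  proof (rule set_induct)
    fix \<Delta> x assume x: "\<Delta> \<Vdash> VV x" and "\<And>\<Phi> a. \<Delta> \<preceq> \<Phi> \<Longrightarrow> \<Phi> \<Vdash> inEL a x \<Longrightarrow> \<Phi> \<Vdash> fsub (a ## Var) (EE (Var 0) (Var 0))"
    then have "\<And>\<Phi> a. \<Delta> \<preceq> \<Phi> \<Longrightarrow> \<Phi> \<Vdash> inEL a x \<Longrightarrow> \<Phi> \<Vdash> EE a a" by simp
    then have "\<Delta> \<Vdash> sub x x" unfolding sub_iff by (blast intro: memI)
    then show "\<Delta> \<Vdash> fsub (x ## Var) (EE (Var 0) (Var 0))" using EE_iff[OF x x] by simp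
  qed
  then show ?thesis by simp
qed

text \<open>Induction on x alone, with y and z quantified inside the formula. The inclusion of z in
  x runs backwards, so the hypothesis, which needs its first argument in EL(x), is applied to the
  reversed equations.\<close>

lemma EE_trans:
  assumes "\<Gamma> \<Vdash> VV x" "\<Gamma> \<Vdash> VV y" "\<Gamma> \<Vdash> VV z" "\<Gamma> \<Vdash> EE x y" "\<Gamma> \<Vdash> EE y z"
  shows "\<Gamma> \<Vdash> EE x z"
proof -
  let ?\<phi> = "All (All (Imp (And (And (VV (Var 1)) (VV (Var 0))) (And (EE (Var 2) (Var 1)) (EE (Var 1) (Var 0)))) (EE (Var 2) (Var 0))))"
  have \<phi>: "\<Gamma> \<Vdash> fsub (x ## Var) ?\<phi> \<longleftrightarrow> (\<forall>y z \<Delta>. \<Gamma> \<preceq> \<Delta> \<longrightarrow> \<Delta> \<Vdash> VV y \<longrightarrow> \<Delta> \<Vdash> VV z \<longrightarrow> \<Delta> \<Vdash> EE x y \<longrightarrow> \<Delta> \<Vdash> EE y z \<longrightarrow> \<Delta> \<Vdash> EE x z)" for \<Gamma> x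
    by (simp add: all_iff imp_iff) blast
  have "\<Gamma> \<Vdash> fsub (x ## Var) ?\<phi>"
    using assms(1)
  proof (rule set_induct)
    fix \<Delta> x assume x: "\<Delta> \<Vdash> VV x" and IH: "\<And>\<Phi> a. \<Delta> \<preceq> \<Phi> \<Longrightarrow> \<Phi> \<Vdash> inEL a x \<Longrightarrow> \<Phi> \<Vdash> fsub (a ## Var) ?\<phi>"
    have IH': "\<Phi> \<Vdash> EE a c" if "\<Delta> \<preceq> \<Phi>" "\<Phi> \<Vdash> inEL a x" "\<Phi> \<Vdash> VV b" "\<Phi> \<Vdash> VV c" "\<Phi> \<Vdash> EE a b" "\<Phi> \<Vdash> EE b c" for \<Phi> a b c
      using IH[OF that(1,2)] that(3-) unfolding \<phi> by blast
    show "\<Delta> \<Vdash> fsub (x ## Var) ?\<phi>"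
      unfolding \<phi>
    proof (intro HOL.allI HOL.impI)
      fix y z \<Phi> assume \<Phi>: "\<Delta> \<preceq> \<Phi>" and y: "\<Phi> \<Vdash> VV y" and z: "\<Phi> \<Vdash> VV z" and xy: "\<Phi> \<Vdash> EE x y" and yz: "\<Phi> \<Vdash> EE y z"
      note x = mono[OF x \<Phi>]
      note s = xy[unfolded EE_iff[OF x y] sub_iff] yz[unfolded EE_iff[OF y z] sub_iff]
      have "\<Psi> \<Vdash> mem a z" if l: "\<Phi> \<preceq> \<Psi>" "\<Psi> \<Vdash> inEL a x" for \<Psi> a
      proof -
        have "\<Psi> \<Vdash> mem a y" using s l by blast
        then show ?thesis
        proof (rule memE)
          fix \<Psi>' b assume b: "\<Psi> \<preceq> \<Psi>'" "\<Psi>' \<Vdash> inEL b y" "\<Psi>' \<Vdash> EE a b"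
          have "\<Psi>' \<Vdash> mem b z" using s b ext_trans[OF l(1) b(1)] by blast
          then show "\<Psi>' \<Vdash> mem a z"
          proof (rule memE)
            fix \<Psi>'' c assume c: "\<Psi>' \<preceq> \<Psi>''" "\<Psi>'' \<Vdash> inEL c z" "\<Psi>'' \<Vdash> EE b c"
            note e = ext_trans[OF l(1) ext_trans[OF b(1) c(1)]]
            have "\<Psi>'' \<Vdash> EE a c"
              by (rule IH'[OF ext_trans[OF \<Phi> e] mono[OF mono[OF l(2) b(1)] c(1)] VV_elem[OF mono[OF y e] mono[OF b(2) c(1)]]
                VV_elem[OF mono[OF z e] c(2)] mono[OF b(3) c(1)] c(3)])
            with c(2) show "\<Psi>'' \<Vdash> mem a z" by (rule memI)
          qed
        qed
      qed
      moreover have "\<Psi> \<Vdash> mem c x" if l: "\<Phi> \<preceq> \<Psi>" "\<Psi> \<Vdash> inEL c z" for \<Psi> c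
      proof -
        have "\<Psi> \<Vdash> mem c y" using s l by blast
        then show ?thesis
        proof (rule memE)
          fix \<Psi>' b assume b: "\<Psi> \<preceq> \<Psi>'" "\<Psi>' \<Vdash> inEL b y" "\<Psi>' \<Vdash> EE c b"
          have "\<Psi>' \<Vdash> mem b x" using s b ext_trans[OF l(1) b(1)] by blast
          then show "\<Psi>' \<Vdash> mem c x"
          proof (rule memE)
            fix \<Psi>'' a assume a: "\<Psi>' \<preceq> \<Psi>''" "\<Psi>'' \<Vdash> inEL a x" "\<Psi>'' \<Vdash> EE b a"
            note e = ext_trans[OF l(1) ext_trans[OF b(1) a(1)]]
            have v: "\<Psi>'' \<Vdash> VV a" "\<Psi>'' \<Vdash> VV b" "\<Psi>'' \<Vdash> VV c"
              using VV_elem[OF mono[OF x e] a(2)] VV_elem[OF mono[OF y e] mono[OF b(2) a(1)]]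
                VV_elem[OF mono[OF z e] mono[OF mono[OF l(2) b(1)] a(1)]] by blast+
            have "\<Psi>'' \<Vdash> EE a c"
              by (rule IH'[OF ext_trans[OF \<Phi> e] a(2) v(2,3) EE_sym[OF v(2,1) a(3)] EE_sym[OF v(3,2) mono[OF b(3) a(1)]]])
            then show "\<Psi>'' \<Vdash> mem c x" by (intro memI[OF a(2)] EE_sym[OF v(1,3)])
          qed
        qed
      qed
      ultimately show "\<Phi> \<Vdash> EE x z" unfolding EE_iff[OF x z] sub_iff by blast
    qed
  qed
  then show ?thesis unfolding \<phi> using assms by blast
qed

text \<open>Induction on x for all y at once. The inclusion of x in y leads to
  \<open>a \<simeq> b\<close> and that of y in x to \<open>b \<simeq> a\<close>, with a in EL(x)
  each time; hence the formula contains both orders of the arguments.\<close>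

lemma rep_EE:
  assumes "\<Gamma> \<Vdash> VV x" "\<Gamma> \<Vdash> VV y"
  shows "\<Gamma> \<Vdash> rep (EE x y)"
proof -
  let ?\<phi> = "All (Imp (VV (Var 0)) (And (rep (EE (Var 1) (Var 0))) (rep (EE (Var 0) (Var 1)))))"
  have \<phi>: "\<Gamma> \<Vdash> fsub (x ## Var) ?\<phi> \<longleftrightarrow> (\<forall>y \<Delta>. \<Gamma> \<preceq> \<Delta> \<longrightarrow> \<Delta> \<Vdash> VV y \<longrightarrow> \<Delta> \<Vdash> rep (EE x y) \<and> \<Delta> \<Vdash> rep (EE y x))" for \<Gamma> x
    by (simp add: all_iff imp_iff)
  have "\<Gamma> \<Vdash> fsub (x ## Var) ?\<phi>"
    using assms(1)
  proof (rule set_induct)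
    fix \<Delta> x assume x: "\<Delta> \<Vdash> VV x" and IH: "\<And>\<Phi> a. \<Delta> \<preceq> \<Phi> \<Longrightarrow> \<Phi> \<Vdash> inEL a x \<Longrightarrow> \<Phi> \<Vdash> fsub (a ## Var) ?\<phi>"
    have IH': "\<Phi> \<Vdash> rep (EE a b) \<and> \<Phi> \<Vdash> rep (EE b a)" if "\<Delta> \<preceq> \<Phi>" "\<Phi> \<Vdash> inEL a x" "\<Phi> \<Vdash> VV b" for \<Phi> a b
      using IH[OF that(1,2)] that(3-) unfolding \<phi> by blast
    show "\<Delta> \<Vdash> fsub (x ## Var) ?\<phi>"
      unfolding \<phi>
    proof (intro HOL.allI HOL.impI)
      fix y \<Phi> assume \<Phi>: "\<Delta> \<preceq> \<Phi>" and y: "\<Phi> \<Vdash> VV y"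
      note x = mono[OF x \<Phi>]
      have xy: "\<Phi> \<Vdash> rep (sub x y)"
      proof (rule rep_ball[OF x])
        fix \<Psi> a assume l: "\<Phi> \<preceq> \<Psi>" "\<Psi> \<Vdash> inEL a x"
        have "\<Psi> \<Vdash> rep (mem a y)"
          by (rule rep_bex[OF mono[OF y l(1)]]) (use IH'[OF ext_trans[OF \<Phi> ext_trans[OF l(1)]] mono[OF l(2)]] in simp)
        then show "\<Psi> \<Vdash> rep (fsub (a ## Var) (mem (Var 0) (lift_tm y)))" by simp
      qed
      have yx: "\<Phi> \<Vdash> rep (sub y x)"
      proof (rule rep_ball[OF y])
        fix \<Psi> b assume l: "\<Phi> \<preceq> \<Psi>" "\<Psi> \<Vdash> VV b"
        have "\<Psi> \<Vdash> rep (mem b x)"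
          by (rule rep_bex[OF mono[OF x l(1)]]) (use IH'[OF ext_trans[OF \<Phi> ext_trans[OF l(1)]] _ mono[OF l(2)]] in simp)
        then show "\<Psi> \<Vdash> rep (fsub (b ## Var) (mem (Var 0) (lift_tm x)))" by simp
      qed
      have "\<Phi> \<Vdash> rep (EE x y)"
        by (rule rep_cong[OF rep_and[OF xy yx]]) (simp only: and_iff EE_iff[OF mono[OF x] mono[OF y]])
      moreover have "\<Phi> \<Vdash> rep (EE y x)"
        by (rule rep_cong[OF rep_and[OF yx xy]]) (simp only: and_iff EE_iff[OF mono[OF y] mono[OF x]])
      ultimately show "\<Phi> \<Vdash> rep (EE x y) \<and> \<Phi> \<Vdash> rep (EE y x)" ..
    qed
  qed
  then show ?thesis unfolding \<phi> using assms by blast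
qed

lemma rep_mem:
  assumes "\<Gamma> \<Vdash> VV x" "\<Gamma> \<Vdash> VV y"
  shows "\<Gamma> \<Vdash> rep (mem x y)"
  by (rule rep_bex[OF assms(2)]) (use rep_EE mono[OF assms(1)] in simp)

lemma mem_cong:
  assumes x: "\<Gamma> \<Vdash> VV x" "\<Gamma> \<Vdash> VV x'" "\<Gamma> \<Vdash> EE x x'" and y: "\<Gamma> \<Vdash> VV y" "\<Gamma> \<Vdash> VV y'" "\<Gamma> \<Vdash> EE y y'"
    and m: "\<Gamma> \<Vdash> mem x y"
  shows "\<Gamma> \<Vdash> mem x' y'"
  using m
proof (rule memE)
  fix \<Delta> a assume \<Delta>: "\<Gamma> \<preceq> \<Delta>" "\<Delta> \<Vdash> inEL a y" "\<Delta> \<Vdash> EE x a"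
  have "\<Delta> \<Vdash> mem a y'" using y(3) \<Delta> unfolding EE_iff[OF y(1,2)] sub_iff by blast
  then show "\<Delta> \<Vdash> mem x' y'"
  proof (rule memE)
    fix \<Phi> b assume \<Phi>: "\<Delta> \<preceq> \<Phi>" "\<Phi> \<Vdash> inEL b y'" "\<Phi> \<Vdash> EE a b"
    note e = ext_trans[OF \<Delta>(1) \<Phi>(1)]
    have v: "\<Phi> \<Vdash> VV a" "\<Phi> \<Vdash> VV b"
      using VV_elem[OF mono[OF y(1) e] mono[OF \<Delta>(2) \<Phi>(1)]] VV_elem[OF mono[OF y(2) e] \<Phi>(2)] by blast+
    have "\<Phi> \<Vdash> EE x' x" by (rule mono[OF EE_sym[OF x] e])
    moreover have "\<Phi> \<Vdash> EE x b" by (rule EE_trans[OF mono[OF x(1) e] v mono[OF \<Delta>(3) \<Phi>(1)] \<Phi>(3)])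
    ultimately have "\<Phi> \<Vdash> EE x' b" by (rule EE_trans[OF mono[OF x(2) e] mono[OF x(1) e] v(2)])
    with \<Phi>(2) show "\<Phi> \<Vdash> mem x' y'" by (rule memI)
  qed
qed

text \<open>Every quantifier ranges over EL of a v-set, and \<open>rep_ball\<close> and
  \<open>rep_bex\<close> hand the elements on as v-sets, so the hypothesis on \<sigma> survives each
  binder.\<close>

lemma rep_interp:
  assumes "bounded_sfm \<phi>" "\<And>i. i \<in> sfv \<phi> \<Longrightarrow> \<Gamma> \<Vdash> VV (\<sigma> i)"
  shows "\<Gamma> \<Vdash> rep (fsub \<sigma> (interp E \<phi>))"
  using assms
proof (induction \<phi> arbitrary: \<Gamma> \<sigma>)
  case SBot
  show ?case by (simp add: rep_bot)
next
  case (SEq i j)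
  then show ?case using rep_EE[of \<Gamma> "\<sigma> i" "\<sigma> j"] by (simp add: EE_def)
next
  case (SMem i j)
  then show ?case using rep_mem[of \<Gamma> "\<sigma> i" "\<sigma> j"] by (simp add: EE_def)
next
  case (SBAll v \<phi>)
  have "\<Gamma> \<Vdash> rep (All (Imp (inEL (Var 0) (lift_tm (\<sigma> v))) (fsub (tup \<sigma>) (interp E \<phi>))))"
  proof (rule rep_ball)
    fix \<Delta> a assume \<Delta>: "\<Gamma> \<preceq> \<Delta>" "\<Delta> \<Vdash> VV a"
    have "\<Delta> \<Vdash> rep (fsub (a ## \<sigma>) (interp E \<phi>))"
      using SBAll.prems \<Delta> by (intro SBAll.IH) (auto split: nat.split intro: mono)
    then show "\<Delta> \<Vdash> rep (fsub (a ## Var) (fsub (tup \<sigma>) (interp E \<phi>)))" by simp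
  qed (use SBAll.prems in simp)
  then show ?case by simp
next
  case (SBEx v \<phi>)
  have "\<Gamma> \<Vdash> rep (Ex (And (inEL (Var 0) (lift_tm (\<sigma> v))) (fsub (tup \<sigma>) (interp E \<phi>))))"
  proof (rule rep_bex)
    fix \<Delta> a assume \<Delta>: "\<Gamma> \<preceq> \<Delta>" "\<Delta> \<Vdash> VV a"
    have "\<Delta> \<Vdash> rep (fsub (a ## \<sigma>) (interp E \<phi>))"
      using SBEx.prems \<Delta> by (intro SBEx.IH) (auto split: nat.split intro: mono)
    then show "\<Delta> \<Vdash> rep (fsub (a ## Var) (fsub (tup \<sigma>) (interp E \<phi>)))" by simp
  qed (use SBEx.prems in simp)
  then show ?case by simp
qed (auto intro: rep_and rep_or rep_imp)

text \<open>One direction suffices: by symmetry of \<simeq> the two environments may be exchanged,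
  as happens at the premise of an implication. At a bounded quantifier an element of one bound is
  traded for an equal element of the other.\<close>

lemma interp_cong:
  assumes "bounded_sfm \<phi>" "\<And>i. i \<in> sfv \<phi> \<Longrightarrow> \<Gamma> \<Vdash> VV (\<sigma> i) \<and> \<Gamma> \<Vdash> VV (\<tau> i) \<and> \<Gamma> \<Vdash> EE (\<sigma> i) (\<tau> i)"
    and "\<Gamma> \<Vdash> fsub \<sigma> (interp E \<phi>)"
  shows "\<Gamma> \<Vdash> fsub \<tau> (interp E \<phi>)"
  using assms
proof (induction \<phi> arbitrary: \<Gamma> \<sigma> \<tau>)
  case (SEq i j)
  then have v: "\<Gamma> \<Vdash> VV (\<sigma> i)" "\<Gamma> \<Vdash> VV (\<tau> i)" "\<Gamma> \<Vdash> EE (\<sigma> i) (\<tau> i)" "\<Gamma> \<Vdash> VV (\<sigma> j)" "\<Gamma> \<Vdash> VV (\<tau> j)"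
    "\<Gamma> \<Vdash> EE (\<sigma> j) (\<tau> j)" "\<Gamma> \<Vdash> EE (\<sigma> i) (\<sigma> j)"
    by (auto simp: EE_def)
  have "\<Gamma> \<Vdash> EE (\<tau> i) (\<tau> j)"
    by (rule EE_trans[OF v(2,1,5) EE_sym[OF v(1,2,3)] EE_trans[OF v(1,4,5,7,6)]])
  then show ?case by (simp add: EE_def)
next
  case (SMem i j)
  then have "\<Gamma> \<Vdash> mem (\<sigma> i) (\<sigma> j)" by (simp add: EE_def)
  with SMem.prems(2)[of i] SMem.prems(2)[of j] have "\<Gamma> \<Vdash> mem (\<tau> i) (\<tau> j)"
    by (intro mem_cong[of \<Gamma> "\<sigma> i" "\<tau> i" "\<sigma> j" "\<tau> j"]) simp_all
  then show ?case by (simp add: EE_def)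
next
  case (SAnd \<phi> \<psi>)
  have "\<Gamma> \<Vdash> fsub \<tau> (interp E \<phi>)"
    by (rule SAnd.IH(1)[of \<Gamma> \<sigma>]) (use SAnd.prems in simp_all)
  moreover have "\<Gamma> \<Vdash> fsub \<tau> (interp E \<psi>)"
    by (rule SAnd.IH(2)[of \<Gamma> \<sigma>]) (use SAnd.prems in simp_all)
  ultimately show ?case by simp
next
  case (SOr \<phi> \<psi>)
  have p: "\<Delta> \<Vdash> VV (\<sigma> i) \<and> \<Delta> \<Vdash> VV (\<tau> i) \<and> \<Delta> \<Vdash> EE (\<sigma> i) (\<tau> i)" if "\<Gamma> \<preceq> \<Delta>" "i \<in> sfv (SOr \<phi> \<psi>)" for \<Delta> i
    using SOr.prems(2)[OF that(2)] mono[OF _ that(1)] by blast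
  from SOr.prems(3) have "\<Gamma> \<Vdash> Or (fsub \<sigma> (interp E \<phi>)) (fsub \<sigma> (interp E \<psi>))" by simp
  then have "\<Gamma> \<Vdash> Or (fsub \<tau> (interp E \<phi>)) (fsub \<tau> (interp E \<psi>))"
  proof (rule orE)
    fix \<Delta> assume \<Delta>: "\<Gamma> \<preceq> \<Delta>" "\<Delta> \<Vdash> fsub \<sigma> (interp E \<phi>)"
    show "\<Delta> \<Vdash> Or (fsub \<tau> (interp E \<phi>)) (fsub \<tau> (interp E \<psi>))"
      by (rule orI1, rule SOr.IH(1)[OF _ _ \<Delta>(2)]) (use SOr.prems(1) p[OF \<Delta>(1)] in auto)
  next
    fix \<Delta> assume \<Delta>: "\<Gamma> \<preceq> \<Delta>" "\<Delta> \<Vdash> fsub \<sigma> (interp E \<psi>)"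
    show "\<Delta> \<Vdash> Or (fsub \<tau> (interp E \<phi>)) (fsub \<tau> (interp E \<psi>))"
      by (rule orI2, rule SOr.IH(2)[OF _ _ \<Delta>(2)]) (use SOr.prems(1) p[OF \<Delta>(1)] in auto)
  qed
  then show ?case by simp
next
  case (SImp \<phi> \<psi>)
  have p: "\<Delta> \<Vdash> VV (\<sigma> i) \<and> \<Delta> \<Vdash> VV (\<tau> i) \<and> \<Delta> \<Vdash> EE (\<sigma> i) (\<tau> i)" if "\<Gamma> \<preceq> \<Delta>" "i \<in> sfv (SImp \<phi> \<psi>)" for \<Delta> i
    using SImp.prems(2)[OF that(2)] mono[OF _ that(1)] by blast
  have "\<Gamma> \<Vdash> Imp (fsub \<tau> (interp E \<phi>)) (fsub \<tau> (interp E \<psi>))"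
  proof (rule fm_impI)
    fix \<Delta> assume \<Delta>: "\<Gamma> \<preceq> \<Delta>" "\<Delta> \<Vdash> fsub \<tau> (interp E \<phi>)"
    note p = p[OF \<Delta>(1)]
    have "\<Delta> \<Vdash> fsub \<sigma> (interp E \<phi>)"
      by (rule SImp.IH(1)[OF _ _ \<Delta>(2)]) (use SImp.prems(1) p EE_sym in auto)
    then have "\<Delta> \<Vdash> fsub \<sigma> (interp E \<psi>)"
      using SImp.prems(3) \<Delta>(1) by (simp add: imp_iff)
    then show "\<Delta> \<Vdash> fsub \<tau> (interp E \<psi>)"
      by (rule SImp.IH(2)[rotated 2]) (use SImp.prems(1) p in auto)
  qed
  then show ?case by simp
next
  case (SBAll v \<phi>)
  have p: "\<Delta> \<Vdash> VV (\<sigma> i) \<and> \<Delta> \<Vdash> VV (\<tau> i) \<and> \<Delta> \<Vdash> EE (\<sigma> i) (\<tau> i)" if "\<Gamma> \<preceq> \<Delta>" "i \<in> sfv (SBAll v \<phi>)" for \<Delta> i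
    using SBAll.prems(2)[OF that(2)] mono[OF _ that(1)] by blast
  have v: "\<Gamma> \<Vdash> VV (\<sigma> v)" "\<Gamma> \<Vdash> VV (\<tau> v)" "\<Gamma> \<Vdash> EE (\<sigma> v) (\<tau> v)" using SBAll.prems(2)[of v] by auto
  have \<sigma>: "\<Delta> \<Vdash> fsub (a ## \<sigma>) (interp E \<phi>)" if "\<Gamma> \<preceq> \<Delta>" "\<Delta> \<Vdash> inEL a (\<sigma> v)" for \<Delta> a
    using SBAll.prems(3) that by (simp add: all_iff imp_iff)
  have "\<Delta> \<Vdash> fsub (b ## \<tau>) (interp E \<phi>)" if \<Delta>: "\<Gamma> \<preceq> \<Delta>" "\<Delta> \<Vdash> inEL b (\<tau> v)" for \<Delta> b
  proof -
    have "\<Delta> \<Vdash> mem b (\<sigma> v)" using v(3) \<Delta> unfolding EE_iff[OF v(1,2)] sub_iff by blast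
    then show ?thesis
    proof (rule memE)
      fix \<Phi> a assume \<Phi>: "\<Delta> \<preceq> \<Phi>" "\<Phi> \<Vdash> inEL a (\<sigma> v)" "\<Phi> \<Vdash> EE b a"
      note e = ext_trans[OF \<Delta>(1) \<Phi>(1)]
      have w: "\<Phi> \<Vdash> VV a" "\<Phi> \<Vdash> VV b"
        using VV_elem[OF mono[OF v(1) e] \<Phi>(2)] VV_elem[OF mono[OF v(2) e] mono[OF \<Delta>(2) \<Phi>(1)]] by blast+
      show "\<Phi> \<Vdash> fsub (b ## \<tau>) (interp E \<phi>)"
        by (rule SBAll.IH[OF _ _ \<sigma>[OF e \<Phi>(2)]])
          (use SBAll.prems(1) w EE_sym[OF w(2,1) \<Phi>(3)] p[OF e] in \<open>auto split: nat.split\<close>)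
    qed
  qed
  then show ?case by (simp add: all_iff imp_iff)
next
  case (SBEx v \<phi>)
  have p: "\<Delta> \<Vdash> VV (\<sigma> i) \<and> \<Delta> \<Vdash> VV (\<tau> i) \<and> \<Delta> \<Vdash> EE (\<sigma> i) (\<tau> i)" if "\<Gamma> \<preceq> \<Delta>" "i \<in> sfv (SBEx v \<phi>)" for \<Delta> i
    using SBEx.prems(2)[OF that(2)] mono[OF _ that(1)] by blast
  have v: "\<Gamma> \<Vdash> VV (\<sigma> v)" "\<Gamma> \<Vdash> VV (\<tau> v)" "\<Gamma> \<Vdash> EE (\<sigma> v) (\<tau> v)" using SBEx.prems(2)[of v] by auto
  let ?G = "Ex (And (inEL (Var 0) (lift_tm (\<tau> v))) (fsub (tup \<tau>) (interp E \<phi>)))"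
  have "\<Gamma> \<Vdash> Ex (And (inEL (Var 0) (lift_tm (\<sigma> v))) (fsub (tup \<sigma>) (interp E \<phi>)))"
    using SBEx.prems(3) by simp
  then have "\<Gamma> \<Vdash> ?G"
  proof (rule fm_exE)
    fix \<Delta> a assume \<Delta>: "\<Gamma> \<preceq> \<Delta>" and "\<Delta> \<Vdash> fsub (a ## Var) (And (inEL (Var 0) (lift_tm (\<sigma> v))) (fsub (tup \<sigma>) (interp E \<phi>)))"
    then have a: "\<Delta> \<Vdash> inEL a (\<sigma> v)" "\<Delta> \<Vdash> fsub (a ## \<sigma>) (interp E \<phi>)" by simp_all
    have "\<Delta> \<Vdash> mem a (\<tau> v)" using v(3) \<Delta> a unfolding EE_iff[OF v(1,2)] sub_iff by blast
    then show "\<Delta> \<Vdash> ?G"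
    proof (rule memE)
      fix \<Phi> b assume \<Phi>: "\<Delta> \<preceq> \<Phi>" "\<Phi> \<Vdash> inEL b (\<tau> v)" "\<Phi> \<Vdash> EE a b"
      note e = ext_trans[OF \<Delta>(1) \<Phi>(1)]
      have w: "\<Phi> \<Vdash> VV a" "\<Phi> \<Vdash> VV b"
        using VV_elem[OF mono[OF v(1) e] mono[OF a(1) \<Phi>(1)]] VV_elem[OF mono[OF v(2) e] \<Phi>(2)] by blast+
      have "\<Phi> \<Vdash> fsub (b ## \<tau>) (interp E \<phi>)"
        by (rule SBEx.IH[OF _ _ mono[OF a(2) \<Phi>(1)]])
          (use SBEx.prems(1) w \<Phi>(3) p[OF e] in \<open>auto split: nat.split\<close>)
      with \<Phi>(2) show "\<Phi> \<Vdash> ?G" by (intro fm_exI[of _ b]) simp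
    qed
  qed
  then show ?case by simp
qed auto

lemma interp_sren: "interp E (sren r \<phi>) = fsub (\<lambda>i. Var (r i)) (interp E \<phi>)"
  by (induction \<phi> arbitrary: r) (simp_all add: rup_Var)

text \<open>\<open>subset_of_rep\<close> determines EL(z) exactly, whereas membership is meant up to
  \<simeq>. \<open>interp_cong\<close> carries \<phi> between x and the element a of EL(y) that
  equals it. The 2 in \<open>p + 2\<close> accounts for x and y in front of the parameters.\<close>

lemma separation_holds:
  assumes "bounded_sfm \<phi>" "sfv \<phi> \<subseteq> {..<p + 2}" and \<sigma>: "\<And>i. i < p \<Longrightarrow> \<Gamma> \<Vdash> VV (\<sigma> i)"
  shows "\<Gamma> \<Vdash> fsub \<sigma> (interp E (separation \<phi>))"
proof -
  let ?A = "\<lambda>x y. fsub (x ## y ## \<sigma>) (interp E \<phi>)"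
  let ?M = "\<lambda>x z y. Iff (mem x z) (And (mem x y) (?A x y))"
  have "\<Delta> \<Vdash> Ex (And (VV (Var 0)) (All (Imp (VV (Var 0)) (Iff (mem (Var 0) (Var 1)) (And (mem (Var 0) (lift2_tm y))
      (fsub (Var 0 ## lift2_tm y ## (\<lambda>i. lift2_tm (\<sigma> i))) (interp E \<phi>)))))))"
    (is "_ \<Vdash> ?G") if \<Delta>: "\<Gamma> \<preceq> \<Delta>" and y: "\<Delta> \<Vdash> VV y" for \<Delta> y
  proof (rule subset_of_rep[OF y, where A = "fsub (tup (y ## \<sigma>)) (interp E \<phi>)"])
    have V: "\<Phi> \<Vdash> VV ((x ## y ## \<sigma>) i)" if "\<Delta> \<preceq> \<Phi>" "\<Phi> \<Vdash> VV x" "i \<in> sfv \<phi>" for \<Phi> x i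
    proof -
      have "i < p + 2" using that(3) assms(2) by auto
      then show ?thesis
        using that(2) mono[OF y that(1)] mono[OF \<sigma> ext_trans[OF \<Delta> that(1)]] by (auto split: nat.split)
    qed
    show "\<Phi> \<Vdash> rep (fsub (a ## Var) (fsub (tup (y ## \<sigma>)) (interp E \<phi>)))" if "\<Delta> \<preceq> \<Phi>" "\<Phi> \<Vdash> VV a" for \<Phi> a
      using rep_interp[OF assms(1) V[OF that]] by simp
    have cong: "\<Phi> \<Vdash> ?A x' y" if "\<Delta> \<preceq> \<Phi>" "\<Phi> \<Vdash> VV x" "\<Phi> \<Vdash> VV x'" "\<Phi> \<Vdash> EE x x'" "\<Phi> \<Vdash> ?A x y" for \<Phi> x x'
    proof (rule interp_cong[OF assms(1) _ that(5)])
      fix i assume i: "i \<in> sfv \<phi>"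
      have "\<Phi> \<Vdash> EE ((x ## y ## \<sigma>) i) ((x' ## y ## \<sigma>) i)"
      proof (cases i)
        case (Suc j)
        then show ?thesis using EE_refl[OF V[OF that(1,2) i]] by simp
      qed (simp add: that)
      with V[OF that(1,2) i] V[OF that(1,3) i]
      show "\<Phi> \<Vdash> VV ((x ## y ## \<sigma>) i) \<and> \<Phi> \<Vdash> VV ((x' ## y ## \<sigma>) i) \<and> \<Phi> \<Vdash> EE ((x ## y ## \<sigma>) i) ((x' ## y ## \<sigma>) i)"
        by blast
    qed
    fix \<Phi> z assume \<Phi>: "\<Delta> \<preceq> \<Phi>" and z: "\<Phi> \<Vdash> VV z"
      and "\<And>\<Psi> a. \<Phi> \<preceq> \<Psi> \<Longrightarrow> \<Psi> \<Vdash> inEL a z \<longleftrightarrow> \<Psi> \<Vdash> inEL a y \<and> \<Psi> \<Vdash> fsub (a ## Var) (fsub (tup (y ## \<sigma>)) (interp E \<phi>))"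
    then have el: "\<Psi> \<Vdash> inEL a z \<longleftrightarrow> \<Psi> \<Vdash> inEL a y \<and> \<Psi> \<Vdash> ?A a y" if "\<Phi> \<preceq> \<Psi>" for \<Psi> a
      using that by simp
    have "\<Psi> \<Vdash> mem x z \<longleftrightarrow> \<Psi> \<Vdash> And (mem x y) (?A x y)" if l: "\<Phi> \<preceq> \<Psi>" and x: "\<Psi> \<Vdash> VV x" for \<Psi> x
    proof
      assume "\<Psi> \<Vdash> mem x z"
      then show "\<Psi> \<Vdash> And (mem x y) (?A x y)"
      proof (rule memE)
        fix \<Psi>' a assume l': "\<Psi> \<preceq> \<Psi>'" and a: "\<Psi>' \<Vdash> inEL a z" "\<Psi>' \<Vdash> EE x a"
        note e = ext_trans[OF l l'] and x' = mono[OF x l']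
        have a': "\<Psi>' \<Vdash> inEL a y" "\<Psi>' \<Vdash> ?A a y" using a(1) el[OF e] by blast+
        have va: "\<Psi>' \<Vdash> VV a" by (rule VV_elem[OF mono[OF z e] a(1)])
        have "\<Psi>' \<Vdash> ?A x y"
          by (rule cong[OF ext_trans[OF \<Phi> e] va x' EE_sym[OF x' va a(2)] a'(2)])
        with memI[OF a'(1) a(2)] show "\<Psi>' \<Vdash> And (mem x y) (?A x y)" unfolding and_iff by blast
      qed
    next
      assume A: "\<Psi> \<Vdash> And (mem x y) (?A x y)"
      then have "\<Psi> \<Vdash> mem x y" unfolding and_iff by blast
      then show "\<Psi> \<Vdash> mem x z"
      proof (rule memE)
        fix \<Psi>' a assume l': "\<Psi> \<preceq> \<Psi>'" and a: "\<Psi>' \<Vdash> inEL a y" "\<Psi>' \<Vdash> EE x a"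
        note e = ext_trans[OF l l']
        have va: "\<Psi>' \<Vdash> VV a" by (rule VV_elem[OF mono[OF y ext_trans[OF \<Phi> e]] a(1)])
        have "\<Psi>' \<Vdash> ?A x y" using mono[OF A l'] unfolding and_iff by blast
        from cong[OF ext_trans[OF \<Phi> e] mono[OF x l'] va a(2) this] a(1)
        have "\<Psi>' \<Vdash> inEL a z" using el[OF e] by blast
        then show "\<Psi>' \<Vdash> mem x z" using a(2) by (rule memI)
      qed
    qed
    then have *: "\<Psi> \<Vdash> ?M x z y" if "\<Phi> \<preceq> \<Psi>" "\<Psi> \<Vdash> VV x" for \<Psi> x
      unfolding and_iff[of _ "Imp _ _"] iff_iff using that ext_trans[OF that(1)] mono[OF that(2)] by blast
    show "\<Phi> \<Vdash> ?G"
    proof (rule fm_exI[of _ z])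
      have "\<Phi> \<Vdash> All (Imp (VV (Var 0)) (Iff (mem (Var 0) (lift_tm z)) (And (mem (Var 0) (lift_tm y))
        (fsub (Var 0 ## lift_tm y ## (\<lambda>i. lift_tm (\<sigma> i))) (interp E \<phi>)))))"
        unfolding all_iff fsub.simps imp_iff[of _ "VV _"] using * by simp
      with z show "\<Phi> \<Vdash> fsub (z ## Var) (And (VV (Var 0)) (All (Imp (VV (Var 0)) (Iff (mem (Var 0) (Var 1))
        (And (mem (Var 0) (lift2_tm y)) (fsub (Var 0 ## lift2_tm y ## (\<lambda>i. lift2_tm (\<sigma> i))) (interp E \<phi>)))))))"
        by simp
    qed
  qed
  then have "\<Gamma> \<Vdash> All (Imp (VV (Var 0)) (Ex (And (VV (Var 0)) (All (Imp (VV (Var 0)) (Iff (mem (Var 0) (Var 1)) (And (mem (Var 0) (Var 2))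
      (fsub (Var 0 ## Var 2 ## (\<lambda>i. lift2_tm (lift_tm (\<sigma> i)))) (interp E \<phi>)))))))))"
    unfolding all_iff fsub.simps imp_iff[of \<Gamma> "VV _"] by simp
  then show ?thesis
    by (simp add: separation_def interp_sren EE_def numeral_2_eq_2 del: Var_numeral)
qed

text \<open>q counts the parameters already introduced, so that \<open>p + q\<close> stays fixed in
  the induction on p.\<close>

lemma interp_SAll_pow:
  assumes "\<And>\<Gamma> \<sigma>. (\<And>i. i < p + q \<Longrightarrow> \<Gamma> \<Vdash> VV (\<sigma> i)) \<Longrightarrow> \<Gamma> \<Vdash> fsub \<sigma> (interp E \<psi>)"
    and "\<And>i. i < q \<Longrightarrow> \<Gamma> \<Vdash> VV (\<sigma> i)"
  shows "\<Gamma> \<Vdash> fsub \<sigma> (interp E ((SAll ^^ p) \<psi>))"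
  using assms
proof (induction p arbitrary: q \<Gamma> \<sigma>)
  case (Suc p)
  have "\<Delta> \<Vdash> fsub (t ## \<sigma>) (interp E ((SAll ^^ p) \<psi>))" if "\<Gamma> \<preceq> \<Delta>" "\<Delta> \<Vdash> VV t" for \<Delta> t
  proof (rule Suc.IH[of "Suc q"])
    show "\<Delta> \<Vdash> VV ((t ## \<sigma>) i)" if "i < Suc q" for i
      using that \<open>\<Delta> \<Vdash> VV t\<close> mono[OF Suc.prems(2) \<open>\<Gamma> \<preceq> \<Delta>\<close>] by (auto split: nat.split)
  qed (use Suc.prems(1) in simp)
  then show ?case by (simp add: all_iff imp_iff)
qed simp

end

theorem theorem14:
  fixes \<xi> :: tm and E :: fm and \<phi> :: sfm and p :: nat
  assumes "injective_coding \<xi>"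
    and "ext_equality \<xi> E"
    and "bounded_sfm \<phi>"
    and "sfv \<phi> \<subseteq> {..<p + 2}"
  shows "vset_holds \<xi> E ((SAll ^^ p) (separation \<phi>))"
proof -
  interpret vset_equality \<xi> E by unfold_locales (rule assms(2))
  \<comment> \<open>With \<open>q = 0\<close> nothing is assumed of the environment, and forcing the
    identity instance in the empty context is provability.\<close>
  have "[] \<Vdash> fsub Var (interp E ((SAll ^^ p) (separation \<phi>)))"
    by (rule interp_SAll_pow[where q = 0]) (auto intro: separation_holds[OF assms(3,4)])
  then show ?thesis by (simp add: vset_holds_def provable_def force_def)
qed

end
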